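(* Let $N\in\mathbb{N}$, let $p\in(1,\infty)$ and let $\Omega\subset\mathbb{R}^N$ be a domain. Let $d(x)=\operatorname{dist}(x,\partial\Omega)$ for $x\in\Omega$. Assume that $\Omega$ is sufficiently regular in the sense that the following three requirements hold: (1) $W^{1,p}(\Omega)\cap W^{1,1}_0(\Omega)=W^{1,p}_0(\Omega)$; (2) every weakly differentiable function $v$ on $\Omega$ with $|\nabla v|\in L^p(\Omega)$ satisfies $v\in L^1(\Omega)$; (3) every $v\in W^{1,p}_0(\Omega)$ satisfies $\frac{v}{d}\in L^{1,\infty}_a(\Omega)$. Let $u\colon\Omega\to\mathbb{R}$ be a weakly differentiable function. Then $$|\nabla u|\in L^p(\Omega)\quad\text{and}\quad\frac{u}{d}\in L^{1,\infty}_a(\Omega)$$ if and only if $$u\in W^{1,p}_0(\Omega).$$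
   Context: A domain is an open connected subset of $\mathbb{R}^N$. A function is weakly differentiable if it is locally integrable and has locally integrable first-order weak derivatives; $\nabla u$ is the weak gradient. $\lambda^N$ is the Lebesgue measure. For $q\in[1,\infty)$, $W^{1,q}(\Omega)$ is the Sobolev space of all $u\in L^q(\Omega)$ with all first-order weak derivatives in $L^q(\Omega)$, with its usual norm; $W^{1,q}_0(\Omega)$ is the closure in $W^{1,q}(\Omega)$ of $C^\infty_0(\Omega)$, the infinitely differentiable functions with compact support in $\Omega$. For measurable $f$ on $\Omega$, $f^*(t)=\inf\{\xi\ge0:\lambda^N(\{x\in\Omega:|f(x)|>\xi\})\le t\}$, $t\ge 0$, and $L^{1,\infty}(\Omega)$ is the set of a.e. finite measurable $f$ with $\|f\|_{L^{1,\infty}(\Omega)}=\sup_{0<t<\infty}t f^*(t)<\infty$. $L^{1,\infty}_a(\Omega)$ is the set of all $f\in L^{1,\infty}(\Omega)$ such that $\|f\chi_{E_k}\|_{L^{1,\infty}(\Omega)}\to0$ for every sequence $\{E_k\}$ of measurable subsets of $\Omega$ with $\chi_{E_k}\to0$ a.e. on $\Omega$. *)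

theory Defs
  imports "HOL-Analysis.Analysis"
begin

text \<open>
  Functions on a domain \<open>\<Omega>\<close> are total functions whose values outside \<open>\<Omega>\<close> are irrelevant: every
  notion below depends only on the restriction to \<open>\<Omega>\<close>. Function spaces are sets of functions, not of
  classes modulo null sets; they are closed under modification on null sets.
\<close>

definition boundary_dist :: "'a::euclidean_space set \<Rightarrow> 'a \<Rightarrow> real" where
  "boundary_dist \<Omega> x = infdist x (frontier \<Omega>)"
  \<comment> \<open>If the frontier is empty, this is \<open>0\<close>; then \<open>u / boundary_dist \<Omega>\<close> is \<open>0\<close>, in agreement with
      the convention that the distance to the empty set is infinite.\<close>

subsection \<open>Test functions\<close>

primrec C_k :: "nat \<Rightarrow> ('a::euclidean_space \<Rightarrow> real) \<Rightarrow> bool" where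
  "C_k 0 f \<longleftrightarrow> continuous_on UNIV f"
| "C_k (Suc k) f \<longleftrightarrow> (\<forall>x. f differentiable (at x)) \<and>
     (\<forall>i\<in>Basis. C_k k (\<lambda>x. frechet_derivative f (at x) i))"

definition test_functions :: "'a::euclidean_space set \<Rightarrow> ('a \<Rightarrow> real) set" where
  "test_functions \<Omega> =
     {\<phi>. (\<forall>k. C_k k \<phi>) \<and> compact (closure {x. \<phi> x \<noteq> 0}) \<and> closure {x. \<phi> x \<noteq> 0} \<subseteq> \<Omega>}"
  \<comment> \<open>Test functions on \<open>\<Omega>\<close> are identified with their extensions by zero to the whole space.\<close>

subsection \<open>Weak derivatives\<close>

definition locally_integrable :: "'a::euclidean_space set \<Rightarrow> ('a \<Rightarrow> real) \<Rightarrow> bool" where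
  "locally_integrable \<Omega> f \<longleftrightarrow> (\<forall>K. compact K \<and> K \<subseteq> \<Omega> \<longrightarrow> set_integrable lebesgue K f)"

definition has_weak_gradient ::
    "'a::euclidean_space set \<Rightarrow> ('a \<Rightarrow> real) \<Rightarrow> ('a \<Rightarrow> 'a) \<Rightarrow> bool" where
  "has_weak_gradient \<Omega> u g \<longleftrightarrow>
     locally_integrable \<Omega> u \<and>
     (\<forall>i\<in>Basis. locally_integrable \<Omega> (\<lambda>x. g x \<bullet> i)) \<and>
     (\<forall>i\<in>Basis. \<forall>\<phi>\<in>test_functions \<Omega>.
        (LINT x|lebesgue_on \<Omega>. u x * frechet_derivative \<phi> (at x) i) =
        - (LINT x|lebesgue_on \<Omega>. (g x \<bullet> i) * \<phi> x))"

definition weakly_differentiable :: "'a::euclidean_space set \<Rightarrow> ('a \<Rightarrow> real) \<Rightarrow> bool" where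
  "weakly_differentiable \<Omega> u \<longleftrightarrow> (\<exists>g. has_weak_gradient \<Omega> u g)"

definition weak_grad :: "'a::euclidean_space set \<Rightarrow> ('a \<Rightarrow> real) \<Rightarrow> 'a \<Rightarrow> 'a" where
  "weak_grad \<Omega> u = (SOME g. has_weak_gradient \<Omega> u g)"
  \<comment> \<open>A representative: on an open set, the weak gradient is unique up to null sets.\<close>

subsection \<open>Lebesgue and Sobolev spaces\<close>

definition Lp :: "'a::euclidean_space set \<Rightarrow> real \<Rightarrow> ('a \<Rightarrow> real) set" where
  "Lp \<Omega> q = {f \<in> borel_measurable (lebesgue_on \<Omega>). integrable (lebesgue_on \<Omega>) (\<lambda>x. \<bar>f x\<bar> powr q)}"

definition Lp_norm :: "'a::euclidean_space set \<Rightarrow> real \<Rightarrow> ('a \<Rightarrow> real) \<Rightarrow> real" where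
  "Lp_norm \<Omega> q f = (LINT x|lebesgue_on \<Omega>. \<bar>f x\<bar> powr q) powr (1 / q)"

definition W1 :: "'a::euclidean_space set \<Rightarrow> real \<Rightarrow> ('a \<Rightarrow> real) set" where
  "W1 \<Omega> q = {u \<in> Lp \<Omega> q. weakly_differentiable \<Omega> u \<and>
               (\<forall>i\<in>Basis. (\<lambda>x. weak_grad \<Omega> u x \<bullet> i) \<in> Lp \<Omega> q)}"

definition W1_norm :: "'a::euclidean_space set \<Rightarrow> real \<Rightarrow> ('a \<Rightarrow> real) \<Rightarrow> real" where
  "W1_norm \<Omega> q u = Lp_norm \<Omega> q u + Lp_norm \<Omega> q (\<lambda>x. norm (weak_grad \<Omega> u x))"

definition W1_0 :: "'a::euclidean_space set \<Rightarrow> real \<Rightarrow> ('a \<Rightarrow> real) set" where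
  "W1_0 \<Omega> q = {u \<in> W1 \<Omega> q. \<forall>\<epsilon>>0. \<exists>\<phi>\<in>test_functions \<Omega>. W1_norm \<Omega> q (\<lambda>x. u x - \<phi> x) < \<epsilon>}"

subsection \<open>The weak Lebesgue space\<close>

definition rearrangement :: "'a::euclidean_space set \<Rightarrow> ('a \<Rightarrow> real) \<Rightarrow> real \<Rightarrow> ennreal" where
  "rearrangement \<Omega> f t =
     Inf {ennreal \<xi> |\<xi>. 0 \<le> \<xi> \<and> emeasure lebesgue {x\<in>\<Omega>. \<xi> < \<bar>f x\<bar>} \<le> ennreal t}"
  \<comment> \<open>The infimum of the empty set is \<open>\<infinity>\<close>.\<close>

definition weak_L1_norm :: "'a::euclidean_space set \<Rightarrow> ('a \<Rightarrow> real) \<Rightarrow> ennreal" where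
  "weak_L1_norm \<Omega> f = (SUP t\<in>{0<..}. ennreal t * rearrangement \<Omega> f t)"

definition weak_L1 :: "'a::euclidean_space set \<Rightarrow> ('a \<Rightarrow> real) set" where
  "weak_L1 \<Omega> = {f \<in> borel_measurable (lebesgue_on \<Omega>). weak_L1_norm \<Omega> f < \<infinity>}"

definition weak_L1_a :: "'a::euclidean_space set \<Rightarrow> ('a \<Rightarrow> real) set" where
  "weak_L1_a \<Omega> = {f \<in> weak_L1 \<Omega>.
     \<forall>E :: nat \<Rightarrow> 'a set.
       (\<forall>k. E k \<in> sets (lebesgue_on \<Omega>)) \<and>
       (AE x in lebesgue_on \<Omega>. (\<lambda>k. indicator (E k) x :: real) \<longlonglongrightarrow> 0) \<longrightarrow>
       (\<lambda>k. weak_L1_norm \<Omega> (\<lambda>x. f x * indicator (E k) x)) \<longlonglongrightarrow> 0}"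

end

(*
  Applied to v = 1, requirement (2) shows that \<Omega> has finite measure; applied to u, it gives u in L^1.
  The absolutely continuous weak norm of u/d enters only through the decay of k |{|u| > k d}| as
  k \<rightarrow> \<infinity>. Replace d by a smooth function \<psi> (k times a mollified distance, shifted down, and cut off
  at infinity) that is positive only on a compact subset of \<Omega>. Then max 0 (min u \<psi>) has compact
  support, and differs from the positive part of u only on a set S that is essentially {u > k d}.
  There the gradients differ by at most |grad u| + 2k, so the W^{1,1} error is an integral over a
  small set plus a multiple of k |S|, and both tend to 0. Mollifying puts u into W^{1,1}_0.

  To see that u is in L^p, truncate: min k (max (-k) u) lies in W^{1,p} and, by the same argument, in
  W^{1,1}_0, hence in W^{1,p}_0 by (1). The Poincare inequality bounds its L^p norm independently
  of k. So u lies in W^{1,p} and W^{1,1}_0, and (1) applies once more.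
*)
theory Submission
  imports Defs "HOL-Computational_Algebra.Polynomial"
begin

section \<open>Smooth functions and mollifiers\<close>

text \<open>Requirement (1) cannot be applied to \<open>u\<close> at once:
  \<open>W1 \<Omega> p\<close> asks for \<open>u\<close> in L^p, while (2) only yields L^1. This is
  why the W^{1,1} argument is run for the bounded truncations before it is run for \<open>u\<close>.
  In the approximation the slope is fixed before the smoothing. A truncated, mollified and lowered
  distance cannot dominate \<open>boundary_dist \<Omega>\<close>, but it dominates half of it off a
  set whose measure tends to 0 as the smoothing is refined. Doubling the slope pays for the half,
  and since the slope is already chosen, slope times measure of the exceptional set can still be
  made small. Finite measure gives neither boundedness nor regularity of \<open>\<Omega>\<close>.
  Hence the cut-off at infinity, and a Poincare inequality proved by averaging over translations
  instead of integrating across a slab. It does exclude \<open>\<Omega> = UNIV\<close>, so the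
  distance is positive on \<open>\<Omega>\<close>. \<open>weak_grad\<close> is a choice, so explicit
  gradients are computed first, all from one formula for the positive part (minima and truncations
  reduce to it), and are then identified with \<open>weak_grad\<close> almost everywhere by
  uniqueness.\<close>

definition pd :: "('a::euclidean_space \<Rightarrow> real) \<Rightarrow> 'a \<Rightarrow> 'a \<Rightarrow> real" where
  "pd f i x = frechet_derivative f (at x) i"

definition smooth :: "('a::euclidean_space \<Rightarrow> real) \<Rightarrow> bool" where
  "smooth f \<longleftrightarrow> (\<forall>k. C_k k f)"

lemma C_k_Suc_pd:
  "C_k (Suc k) f \<longleftrightarrow> (\<forall>x. f differentiable (at x)) \<and> (\<forall>i\<in>Basis. C_k k (pd f i))"
  by (simp add: pd_def[abs_def])

lemma pd_eqI: "(f has_derivative f') (at x) \<Longrightarrow> pd f i x = f' i"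
  unfolding pd_def using frechet_derivative_at by metis

lemma has_derivative_pd: "f differentiable (at x) \<Longrightarrow> (f has_derivative (\<lambda>i. pd f i x)) (at x)"
  unfolding pd_def by (simp add: frechet_derivative_works[symmetric] eta_contract_eq)

lemma C_k_SucD: "C_k (Suc k) f \<Longrightarrow> C_k k f"
proof (induction k arbitrary: f)
  case 0
  then show ?case
    by (auto intro!: continuous_at_imp_continuous_on differentiable_imp_continuous_within)
next
  case (Suc k)
  then show ?case unfolding C_k_Suc_pd[of "Suc k"] C_k_Suc_pd[of k] by blast
qed

lemma C_k_const: "C_k k (\<lambda>x. c)"
proof (induction k arbitrary: c)
  case (Suc k)
  have "pd (\<lambda>x::'a. c) i = (\<lambda>x. 0)" for i
    by (rule ext, rule pd_eqI[OF has_derivative_const])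
  with Suc show ?case unfolding C_k_Suc_pd by simp
qed simp

lemma pd_inner: "pd (\<lambda>x. x \<bullet> v) i x = i \<bullet> v"
  by (rule pd_eqI) (auto intro!: derivative_eq_intros)

lemma C_k_inner: "C_k k (\<lambda>x. x \<bullet> v)"
proof (cases k)
  case (Suc m)
  have "(\<lambda>x. x \<bullet> v) differentiable at x" for x
    by simp
  moreover have "pd (\<lambda>x. x \<bullet> v) i = (\<lambda>x. i \<bullet> v)" for i
    using pd_inner by blast
  ultimately show ?thesis unfolding Suc C_k_Suc_pd by (simp add: C_k_const)
qed (auto intro!: continuous_intros)

lemma pd_add:
  assumes "f differentiable (at x)" "g differentiable (at x)"
  shows "pd (\<lambda>x. f x + g x) i x = pd f i x + pd g i x"
  by (rule pd_eqI) (intro has_derivative_add has_derivative_pd assms)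

lemma pd_mult:
  assumes "f differentiable (at x)" "g differentiable (at x)"
  shows "pd (\<lambda>x. f x * g x) i x = f x * pd g i x + pd f i x * g x"
  by (rule pd_eqI) (intro has_derivative_mult has_derivative_pd assms)

lemma C_k_add: "C_k k f \<Longrightarrow> C_k k g \<Longrightarrow> C_k k (\<lambda>x. f x + g x)"
proof (induction k arbitrary: f g)
  case (Suc k)
  then have "pd (\<lambda>x. f x + g x) i = (\<lambda>x. pd f i x + pd g i x)" for i
    by (auto intro!: pd_add)
  with Suc show ?case unfolding C_k_Suc_pd by simp
qed (auto intro!: continuous_intros)

lemma C_k_mult: "C_k k f \<Longrightarrow> C_k k g \<Longrightarrow> C_k k (\<lambda>x. f x * g x)"
proof (induction k arbitrary: f g)
  case (Suc k)
  then have "pd (\<lambda>x. f x * g x) i = (\<lambda>x. f x * pd g i x + pd f i x * g x)" for i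
    by (auto intro!: pd_mult)
  moreover have "C_k k (\<lambda>x. f x * pd g i x + pd f i x * g x)" if "i \<in> Basis" for i
    \<comment> \<open>The product rule leaves one factor undifferentiated in each term, so the
      factors are also needed in the weaker class \<open>C_k k\<close>.\<close>
    using Suc.prems[THEN C_k_SucD] Suc.prems that
    by (intro C_k_add Suc.IH) (auto simp: C_k_Suc_pd simp del: C_k.simps(2))
  ultimately show ?case using Suc.prems unfolding C_k_Suc_pd by simp
qed (auto intro!: continuous_intros)

lemma smooth_const: "smooth (\<lambda>x. c)"
  and smooth_add: "smooth f \<Longrightarrow> smooth g \<Longrightarrow> smooth (\<lambda>x. f x + g x)"
  and smooth_mult: "smooth f \<Longrightarrow> smooth g \<Longrightarrow> smooth (\<lambda>x. f x * g x)"
  unfolding smooth_def by (auto intro: C_k_const C_k_add C_k_mult)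

lemma smooth_diff: "smooth f \<Longrightarrow> smooth g \<Longrightarrow> smooth (\<lambda>x. f x - g x)"
  using smooth_add[of f "\<lambda>x. (-1) * g x"] smooth_mult[OF smooth_const[of "-1"], of g] by simp

lemma smooth_differentiable: "smooth f \<Longrightarrow> f differentiable (at x)"
  unfolding smooth_def using C_k.simps(2) by blast

lemma smooth_pd: "smooth f \<Longrightarrow> i \<in> Basis \<Longrightarrow> smooth (pd f i)"
  unfolding smooth_def by (metis C_k_Suc_pd)

lemma smooth_continuous_on: "smooth f \<Longrightarrow> continuous_on S f"
  unfolding smooth_def by (metis C_k.simps(1) continuous_on_subset subset_UNIV)

lemma pd_diff:
  assumes "f differentiable (at x)" "g differentiable (at x)"
  shows "pd (\<lambda>x. f x - g x) i x = pd f i x - pd g i x"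
  by (rule pd_eqI) (intro has_derivative_diff has_derivative_pd assms)

lemma pd_cmult:
  assumes "f differentiable (at x)"
  shows "pd (\<lambda>x. c * f x) i x = c * pd f i x"
  by (rule pd_eqI) (intro has_derivative_mult_right has_derivative_pd assms)

text \<open>These functions are closed under differentiation, up to the inner factor; hence smoothness by induction.\<close>

definition flat_exp :: "real poly \<Rightarrow> real \<Rightarrow> real" where
  "flat_exp P s = (if 0 < s then poly P (1 / s) * exp (- (1 / s)) else 0)"

lemma poly_div_exp_tendsto_0: "((\<lambda>y. poly P y * exp (- y)) \<longlongrightarrow> (0::real)) at_top"
proof -
  have "((\<lambda>y. \<Sum>i\<le>degree P. coeff P i * (y ^ i / exp y)) \<longlongrightarrow> (\<Sum>i\<le>degree P. coeff P i * (0::real))) at_top"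
    by (intro tendsto_sum tendsto_mult tendsto_const tendsto_power_div_exp_0)
  moreover have "poly P y * exp (- y) = (\<Sum>i\<le>degree P. coeff P i * (y ^ i / exp y))" for y :: real
    by (simp add: poly_altdef sum_distrib_right exp_minus divide_inverse mult.assoc)
  ultimately show ?thesis by simp
qed

lemma flat_exp_tendsto_0: "(flat_exp P \<longlongrightarrow> 0) (at 0)"
proof -
  have "((\<lambda>s. poly P (inverse s) * exp (- inverse s)) \<longlongrightarrow> 0) (at_right 0)"
    using filterlim_compose[OF poly_div_exp_tendsto_0 filterlim_inverse_at_top_right] .
  then have "(flat_exp P \<longlongrightarrow> 0) (at_right 0)"
    by (rule Lim_transform_eventually)
      (auto simp: flat_exp_def eventually_at_filter field_simps)
  moreover have "(flat_exp P \<longlongrightarrow> 0) (at_left 0)"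
    by (rule Lim_transform_eventually[of "\<lambda>_. 0"]) (auto simp: flat_exp_def eventually_at_filter)
  ultimately show ?thesis by (simp add: filterlim_split_at)
qed

text \<open>With y = 1/s one has dy/ds = - y^2, so P(y) exp(-y) has derivative y^2 (P - P')(y)
  exp(-y); the two \<open>pCons 0\<close> are the factor y^2. At 0 both sides of the definition meet
  and the derivative is 0.\<close>

lemma flat_exp_DERIV:
  "(flat_exp P has_real_derivative flat_exp (pCons 0 (pCons 0 (P - pderiv P))) s) (at s)"
proof -
  let ?Q = "pCons 0 (pCons 0 (P - pderiv P))"
  consider "s > 0" | "s < 0" | "s = 0" by linarith
  then show ?thesis
  proof cases
    case 1
    have "((\<lambda>s. poly P (1 / s) * exp (- (1 / s))) has_real_derivative flat_exp ?Q s) (at s)"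
      using 1 by (auto intro!: derivative_eq_intros DERIV_chain'[OF _ poly_DERIV] simp: flat_exp_def field_simps power2_eq_square)
    then show ?thesis
      by (rule has_field_derivative_transform_within_open[where S="{0<..}"]) (use 1 in \<open>auto simp: flat_exp_def\<close>)
  next
    case 2
    have "((\<lambda>s. 0) has_real_derivative flat_exp ?Q s) (at s)"
      using 2 by (auto simp: flat_exp_def)
    then show ?thesis
      by (rule has_field_derivative_transform_within_open[where S="{..<0}"]) (use 2 in \<open>auto simp: flat_exp_def\<close>)
  next
    case 3
    have "((\<lambda>h. (flat_exp P (0 + h) - flat_exp P 0) / h) \<longlongrightarrow> 0) (at 0)"
      \<comment> \<open>Dividing by h multiplies the polynomial in 1/h by its variable, so the
        difference quotient is again a flat exponential, with limit 0.\<close>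
      using flat_exp_tendsto_0[of "pCons 0 P"]
      by (rule Lim_transform_eventually) (auto simp: flat_exp_def eventually_at_filter field_simps)
    then show ?thesis unfolding DERIV_def 3 by (simp add: flat_exp_def)
  qed
qed

lemma flat_exp_quadratic_derivative:
  "((\<lambda>x::'a::euclidean_space. flat_exp P (c - x \<bullet> x)) has_derivative
     (\<lambda>h. flat_exp (pCons 0 (pCons 0 (P - pderiv P))) (c - x \<bullet> x) * (- (2 * (h \<bullet> x))))) (at x)"
proof -
  have "((\<lambda>x::'a. c - x \<bullet> x) has_derivative (\<lambda>h. - (2 * (h \<bullet> x)))) (at x)"
    by (auto intro!: derivative_eq_intros simp: inner_commute)
  from has_derivative_compose[OF this flat_exp_DERIV[unfolded has_field_derivative_def]]
  show ?thesis by simp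
qed

lemma C_k_flat_exp: "C_k k (\<lambda>x::'a::euclidean_space. flat_exp P (c - x \<bullet> x))"
proof (induction k arbitrary: P)
  case 0
  have "isCont (\<lambda>x::'a. flat_exp P (c - x \<bullet> x)) x" for x
    using flat_exp_quadratic_derivative by (rule has_derivative_continuous)
  then show ?case
    by (simp add: continuous_at_imp_continuous_on)
next
  case (Suc k)
  have "pd (\<lambda>x::'a. flat_exp P (c - x \<bullet> x)) i
      = (\<lambda>x. flat_exp (pCons 0 (pCons 0 (P - pderiv P))) (c - x \<bullet> x) * ((-2) * (x \<bullet> i)))" for i
    by (rule ext, subst pd_eqI[OF flat_exp_quadratic_derivative]) (simp add: inner_commute)
  moreover have "(\<lambda>x::'a. flat_exp P (c - x \<bullet> x)) differentiable (at x)" for x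
    using flat_exp_quadratic_derivative unfolding differentiable_def by blast
  moreover have "C_k k (\<lambda>x::'a. flat_exp (pCons 0 (pCons 0 (P - pderiv P))) (c - x \<bullet> x) * ((-2) * (x \<bullet> i)))" for i
    by (intro C_k_mult C_k_inner C_k_const Suc)
  ultimately show ?case unfolding C_k_Suc_pd by (simp only: simp_thms) simp
qed

section \<open>Mollifiers and functions of bounded support\<close>

lemma integrable_continuous_compact_support:
  fixes f :: "'a::euclidean_space \<Rightarrow> 'b::euclidean_space"
  assumes "continuous_on UNIV f" and "\<And>x. f x \<noteq> 0 \<Longrightarrow> norm x \<le> r"
  shows "integrable lborel f"
proof -
  have "integrable lborel (\<lambda>x. indicator (cball 0 r) x *\<^sub>R f x)"
    by (rule borel_integrable_compact) (use continuous_on_subset[OF assms(1)] in auto)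
  moreover have "(\<lambda>x. indicator (cball 0 r) x *\<^sub>R f x) = f"
    using assms(2) by (force simp: indicator_def)
  ultimately show ?thesis by simp
qed

text \<open>The normalised standard bump exp(-1/(r^2 - |x|^2)). It can be normalised because it is
  positive on a ball, which is not a null set.\<close>

lemma mollifier_exists:
  assumes "0 < r"
  obtains \<rho> :: "'a::euclidean_space \<Rightarrow> real" where "smooth \<rho>" "\<And>x. 0 \<le> \<rho> x"
    "\<And>x. \<rho> x \<noteq> 0 \<Longrightarrow> norm x < r" "integrable lborel \<rho>" "integral\<^sup>L lborel \<rho> = 1"
proof -
  define g where "g x = flat_exp 1 (r\<^sup>2 - x \<bullet> x)" for x :: 'a
  have g_pos: "g x > 0 \<longleftrightarrow> norm x < r" and g_nn: "g x \<ge> 0" and g_0: "g x \<noteq> 0 \<Longrightarrow> norm x < r" for x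
  proof -
    have "0 < r\<^sup>2 - x \<bullet> x \<longleftrightarrow> norm x < r"
      using assms power_strict_mono[of "norm x" r 2] power2_less_imp_less[of "norm x" r]
      by (auto simp: power2_norm_eq_inner[symmetric])
    then show "g x > 0 \<longleftrightarrow> norm x < r" "g x \<ge> 0" "g x \<noteq> 0 \<Longrightarrow> norm x < r"
      by (simp_all add: g_def flat_exp_def split: if_splits)
  qed
  have sm: "smooth g" unfolding g_def smooth_def using C_k_flat_exp by blast
  have int: "integrable lborel g"
    by (rule integrable_continuous_compact_support[OF smooth_continuous_on[OF sm], of r]) (use g_0 in fastforce)
  have "integral\<^sup>L lborel g \<noteq> 0"
  proof
    assume "integral\<^sup>L lborel g = 0"
    then have "AE x in lborel. g x = 0"
      using integral_nonneg_eq_0_iff_AE[OF int] g_nn by auto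
    then have "AE x in lborel. x \<notin> ball (0::'a) r"
    proof eventually_elim
      case (elim x)
      then show ?case using g_pos[of x] by simp
    qed
    then have "ball (0::'a) r \<in> null_sets lborel"
      by (subst AE_iff_null_sets) auto
    then have "negligible (ball (0::'a) r)"
      using negligible_iff_null_sets null_sets_completionI by blast
    then show False
      using assms open_not_negligible[of "ball (0::'a) r"] by auto
  qed
  moreover have "integral\<^sup>L lborel g \<ge> 0" using g_nn by simp
  ultimately have pos: "integral\<^sup>L lborel g > 0" by simp
  let ?c = "1 / integral\<^sup>L lborel g"
  show ?thesis
  proof (rule that[of "\<lambda>x. ?c * g x"])
    show "smooth (\<lambda>x. ?c * g x)" by (intro smooth_mult smooth_const sm)
    show "0 \<le> ?c * g x" for x using g_nn[of x] pos by simp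
    show "?c * g x \<noteq> 0 \<Longrightarrow> norm x < r" for x using g_0[of x] by auto
    show "integrable lborel (\<lambda>x. ?c * g x)" using int by (intro integrable_mult_right)
    show "integral\<^sup>L lborel (\<lambda>x. ?c * g x) = 1" using pos by simp
  qed
qed

lemma pd_sum_Basis:
  assumes "f differentiable (at x)"
  shows "pd f h x = (\<Sum>i\<in>Basis. (h \<bullet> i) * pd f i x)"
proof -
  interpret bounded_linear "\<lambda>h. pd f h x"
    using has_derivative_pd[OF assms] by (rule has_derivative_bounded_linear)
  have "pd f h x = pd f (\<Sum>i\<in>Basis. (h \<bullet> i) *\<^sub>R i) x" by (simp add: euclidean_representation)
  also have "\<dots> = (\<Sum>i\<in>Basis. (h \<bullet> i) * pd f i x)" by (simp only: sum scaleR real_scaleR_def)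
  finally show ?thesis .
qed

lemma pd_mvt:
  fixes f :: "'a::euclidean_space \<Rightarrow> real"
  assumes "\<And>x. f differentiable (at x)"
  obtains t where "0 < t" "t < 1" "f (x + h) - f x = pd f h (x + t *\<^sub>R h)"
proof -
  have *: "((\<lambda>s. f (x + s *\<^sub>R h)) has_derivative (\<lambda>s. pd f (s *\<^sub>R h) (x + t *\<^sub>R h))) (at t within S)" for t S
    by (rule has_derivative_at_withinI, rule has_derivative_compose[OF _ has_derivative_pd[OF assms]])
      (auto intro!: derivative_eq_intros)
  show ?thesis
    using mvt_simple[of 0 1 "\<lambda>s. f (x + s *\<^sub>R h)", OF _ *] that by auto
qed

text \<open>The inequality is weak so that the region where \<open>f\<close> must vanish is open;
  then partial derivatives inherit the bound with the same \<open>r\<close>.\<close>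

definition support_bound :: "real \<Rightarrow> ('a::euclidean_space \<Rightarrow> real) \<Rightarrow> bool" where
  "support_bound r f \<longleftrightarrow> (\<forall>x. f x \<noteq> 0 \<longrightarrow> norm x \<le> r)"

lemma pd_eq_0:
  assumes "open S" "x \<in> S" "\<And>y. y \<in> S \<Longrightarrow> f y = 0"
  shows "pd f i x = 0"
proof -
  have "((\<lambda>_. 0) has_derivative (\<lambda>_. 0)) (at x)" by simp
  then have "(f has_derivative (\<lambda>_. 0)) (at x)"
    by (rule has_derivative_transform_within_open[OF _ assms(1,2)]) (simp add: assms(3))
  then show ?thesis by (rule pd_eqI)
qed

lemma support_bound_pd:
  assumes "support_bound r f"
  shows "support_bound r (pd f i)"
proof -
  have "pd f i x = 0" if "r < norm x" for x
    by (rule pd_eq_0[of "- cball 0 r"]) (use assms that in \<open>auto simp: support_bound_def open_Compl\<close>)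
  then show ?thesis unfolding support_bound_def by force
qed

lemma support_bound_bounded:
  fixes f :: "'a::euclidean_space \<Rightarrow> real"
  assumes "continuous_on UNIV f" "support_bound r f"
  obtains M where "0 < M" "\<And>x. \<bar>f x\<bar> \<le> M"
proof -
  have "bounded (f ` cball 0 r)"
    by (intro compact_imp_bounded compact_continuous_image continuous_on_subset[OF assms(1)]) auto
  then obtain M where M: "0 < M" "\<And>x. x \<in> cball 0 r \<Longrightarrow> \<bar>f x\<bar> \<le> M"
    unfolding bounded_pos by auto
  then have "\<bar>f x\<bar> \<le> M" for x
    using assms(2) by (cases "f x = 0") (auto simp: support_bound_def)
  with M show ?thesis using that by blast
qed

lemma support_bound_uniformly_continuous:
  fixes f :: "'a::euclidean_space \<Rightarrow> real"
  assumes "continuous_on UNIV f" "support_bound r f" "0 < e"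
  obtains d where "0 < d" "\<And>x y. dist x y < d \<Longrightarrow> \<bar>f x - f y\<bar> < e"
proof -
  \<comment> \<open>The margin 1 serves pairs of points at distance below 1: either both lie in the
    larger ball, or both lie outside \<open>cball 0 r\<close>, where \<open>f\<close>
    vanishes.\<close>
  have "uniformly_continuous_on (cball 0 (r + 1)) f"
    by (intro compact_uniformly_continuous continuous_on_subset[OF assms(1)]) auto
  then obtain d where d: "0 < d" "\<And>x y. x \<in> cball 0 (r + 1) \<Longrightarrow> y \<in> cball 0 (r + 1) \<Longrightarrow> dist x y < d \<Longrightarrow> \<bar>f x - f y\<bar> < e"
    unfolding uniformly_continuous_on_def dist_real_def using \<open>0 < e\<close> by metis
  have "\<bar>f x - f y\<bar> < e" if "dist x y < min d 1" for x y
  proof (cases "x \<in> cball 0 (r + 1) \<and> y \<in> cball 0 (r + 1)")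
    case True
    with d that show ?thesis by simp
  next
    case False
    then have "norm x > r \<and> norm y > r"
      using that norm_triangle_ineq2[of x y] norm_triangle_ineq2[of y x]
      by (auto simp: dist_norm norm_minus_commute)
    then have "f x = 0 \<and> f y = 0" using assms(2) unfolding support_bound_def by fastforce
    then show ?thesis using \<open>0 < e\<close> by simp
  qed
  with d(1) that[of "min d 1"] show ?thesis by simp
qed

lemma integrable_support_bound:
  "continuous_on UNIV f \<Longrightarrow> support_bound r f \<Longrightarrow> integrable lborel f"
  by (rule integrable_continuous_compact_support[of f r]) (auto simp: support_bound_def)

section \<open>Translation and reflection invariance; the integral of a derivative\<close>

lemma nn_integral_translate:
  fixes f :: "'a::euclidean_space \<Rightarrow> ennreal"
  assumes [measurable]: "f \<in> borel_measurable borel"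
  shows "(\<integral>\<^sup>+x. f (x + a) \<partial>lborel) = (\<integral>\<^sup>+x. f x \<partial>lborel)"
  by (subst (2) lborel_distr_plus[of a, symmetric]) (simp add: nn_integral_distr add.commute)

lemma integrable_translate:
  fixes f :: "'a::euclidean_space \<Rightarrow> real"
  assumes "integrable lborel f"
  shows "integrable lborel (\<lambda>x. f (x + a))"
proof -
  have "integrable (distr lborel borel ((+) a)) f"
    using assms by (simp add: lborel_distr_plus)
  then have "integrable lborel (\<lambda>x. f (a + x))"
    by (rule integrable_distr[rotated]) simp
  then show ?thesis by (simp add: add.commute)
qed

lemma integral_translate:
  fixes f :: "'a::euclidean_space \<Rightarrow> real"
  assumes [measurable]: "f \<in> borel_measurable borel"
  shows "(LINT x|lborel. f (x + a)) = integral\<^sup>L lborel f"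
  by (subst (2) lborel_distr_plus[of a, symmetric]) (simp add: integral_distr add.commute)

lemma lborel_reflect: "distr lborel borel (\<lambda>x::'a::euclidean_space. a - x) = lborel"
  using lborel_affine[of "-1" a] by (simp add: density_1)

lemma integrable_reflect:
  fixes f :: "'a::euclidean_space \<Rightarrow> real"
  assumes "integrable lborel f"
  shows "integrable lborel (\<lambda>x. f (a - x))"
proof -
  have "integrable (distr lborel borel (\<lambda>x. a - x)) f"
    using assms by (simp add: lborel_reflect)
  then show ?thesis
    by (rule integrable_distr[rotated]) simp
qed

lemma integral_reflect:
  fixes f :: "'a::euclidean_space \<Rightarrow> real"
  assumes [measurable]: "f \<in> borel_measurable borel"
  shows "(LINT x|lborel. f (a - x)) = integral\<^sup>L lborel f"
  by (subst (2) lborel_reflect[of a, symmetric]) (simp add: integral_distr)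

lemma pd_difference_quotient:
  fixes f :: "'a::euclidean_space \<Rightarrow> real"
  assumes "f differentiable (at x)"
  shows "((\<lambda>s. (f (x + s *\<^sub>R i) - f x) / s) \<longlongrightarrow> pd f i x) (at 0)"
proof -
  have d: "(f has_derivative (\<lambda>h. pd f h x)) (at (x + 0 *\<^sub>R i))"
    using has_derivative_pd[OF assms] by simp
  have "((\<lambda>s. x + s *\<^sub>R i) has_derivative (\<lambda>s. s *\<^sub>R i)) (at 0)"
    by (auto intro!: derivative_eq_intros)
  from has_derivative_compose[where f="\<lambda>s. x + s *\<^sub>R i" and g=f and x=0 and s=UNIV, OF this d]
  have "((\<lambda>s. f (x + s *\<^sub>R i)) has_derivative (\<lambda>s. pd f (s *\<^sub>R i) x)) (at 0)" .
  moreover have "pd f (s *\<^sub>R i) x = pd f i x * s" for s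
    using linear_scale[OF has_derivative_linear[OF has_derivative_pd[OF assms]], of s i] by simp
  ultimately have "((\<lambda>s. f (x + s *\<^sub>R i)) has_real_derivative pd f i x) (at 0)"
    by (simp add: has_field_derivative_def mult_commute_abs)
  then show ?thesis by (simp add: DERIV_def)
qed

text \<open>The difference quotients have integral \<open>0\<close> by translation invariance.\<close>

lemma integral_pd_eq_0:
  fixes f :: "'a::euclidean_space \<Rightarrow> real"
  assumes diff: "\<And>x. f differentiable (at x)" and cont: "continuous_on UNIV (pd f i)"
    and supp: "support_bound r f" and i: "i \<in> Basis"
  shows "integral\<^sup>L lborel (pd f i) = 0"
proof -
  define D where "D n x = (f (x + (1 / Suc n) *\<^sub>R i) - f x) * Suc n" for n x
  obtain M where M: "0 < M" "\<And>x. \<bar>pd f i x\<bar> \<le> M"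
    using support_bound_bounded[OF cont support_bound_pd[OF supp]] by blast
  have cf: "continuous_on UNIV f"
    by (simp add: continuous_at_imp_continuous_on diff differentiable_imp_continuous_within)
  then have [measurable]: "f \<in> borel_measurable borel" "pd f i \<in> borel_measurable borel"
    using cont by (auto intro: borel_measurable_continuous_onI)
  have intf: "integrable lborel f" using cf supp by (rule integrable_support_bound)
  have "integral\<^sup>L lborel (D n) = 0" for n
    unfolding D_def using integrable_translate[OF intf] intf integral_translate[of f] by simp
  moreover have "(\<lambda>n. integral\<^sup>L lborel (D n)) \<longlonglongrightarrow> integral\<^sup>L lborel (pd f i)"
  \<comment> \<open>The steps have length at most 1, so every quotient vanishes outside radius
    \<open>r + 1\<close>; by the mean value theorem it is bounded by \<open>M\<close>.\<close>
  proof (rule integral_dominated_convergence[where w="\<lambda>x. M * indicator (cball 0 (r + 1)) x"])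
    show "integrable lborel (\<lambda>x. M * indicator (cball (0::'a) (r + 1)) x)"
      by (intro integrable_mult_right integrable_real_indicator) (use emeasure_bounded_finite[of "cball (0::'a) (r + 1)"] in auto)
    show "AE x in lborel. (\<lambda>n. D n x) \<longlonglongrightarrow> pd f i x"
    proof (rule AE_I2)
      fix x
      note pd_difference_quotient[OF diff, of x i]
      moreover have "filterlim (\<lambda>n. 1 / real (Suc n)) (at 0) sequentially"
        using LIMSEQ_inverse_real_of_nat by (auto simp: filterlim_at inverse_eq_divide)
      ultimately have "(\<lambda>n. (f (x + (1 / Suc n) *\<^sub>R i) - f x) / (1 / Suc n)) \<longlonglongrightarrow> pd f i x"
        by (rule filterlim_compose)
      then show "(\<lambda>n. D n x) \<longlonglongrightarrow> pd f i x" by (simp add: D_def)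
    qed
    show "AE x in lborel. norm (D n x) \<le> M * indicator (cball 0 (r + 1)) x" for n
    proof (rule AE_I2)
      fix x
      let ?h = "(1 / Suc n) *\<^sub>R i"
      obtain t where t: "f (x + ?h) - f x = pd f ?h (x + t *\<^sub>R ?h)"
        using pd_mvt[OF diff] by metis
      also have "\<dots> = (1 / Suc n) * pd f i (x + t *\<^sub>R ?h)"
        using linear_scale[OF has_derivative_linear[OF has_derivative_pd[OF diff]]] by simp
      finally have "\<bar>D n x\<bar> \<le> M" using M by (simp add: D_def)
      moreover have "D n x = 0" if "norm x > r + 1"
      proof -
        have "norm ?h \<le> 1" using i by (simp add: divide_le_eq)
        moreover have "norm x \<le> norm (x + ?h) + norm ?h" using norm_triangle_ineq4[of "x + ?h" ?h] by simp
        ultimately have "norm (x + ?h) > r" using that by linarith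
        with that supp have "f x = 0" "f (x + ?h) = 0" unfolding support_bound_def by force+
        then show ?thesis by (simp add: D_def)
      qed
      ultimately show "norm (D n x) \<le> M * indicator (cball 0 (r + 1)) x"
        by (auto simp: indicator_def not_le)
    qed
  qed (auto simp: D_def[abs_def])
  ultimately show ?thesis by (simp add: LIMSEQ_const_iff)
qed

section \<open>Convolution\<close>

text \<open>Induction over integrable functions: indicators, sums, dominated limits. For an
  indicator, outer regularity replaces the set by an open one, whose indicator satisfies a one-sided
  pointwise convergence under translation. Sums and limits use the triangle inequality and
  translation invariance.\<close>

lemma L1_translation_continuous:
  fixes f :: "'a::euclidean_space \<Rightarrow> real" and Y :: "nat \<Rightarrow> 'a"
  assumes "integrable lborel f" and Y: "Y \<longlonglongrightarrow> 0"
  shows "(\<lambda>n. LINT x|lborel. \<bar>f (x - Y n) - f x\<bar>) \<longlonglongrightarrow> 0"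
  using assms(1)
proof (induction rule: integrable_induct)
  case (base A c)
  have emA: "emeasure lborel A < \<infinity>" and [measurable]: "A \<in> sets borel" using base by auto
  have ind: "(\<lambda>n. LINT x|lborel. \<bar>indicator A (x - Y n) - indicator A x :: real\<bar>) \<longlonglongrightarrow> 0"
  proof (rule LIMSEQ_I)
    fix e :: real assume "0 < e"
    then obtain U where U: "open U" "A \<subseteq> U" "emeasure lborel (U - A) < ennreal (e / 4)"
      using outer_regular_lborel[of A "e / 4"] by auto
    have [measurable]: "U \<in> sets borel" using U by auto
    have "emeasure lborel U \<le> emeasure lborel A + emeasure lborel (U - A)"
      using U(2) emeasure_subadditive[of A lborel "U - A"] by (simp add: Un_absorb1)
    also have "\<dots> < \<infinity>" using emA U(3) by (auto simp: less_top[symmetric])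
    finally have emU: "emeasure lborel U < \<infinity>" .
    define J where "J x = (indicator U x :: real)" for x
    have J: "integrable lborel J" unfolding J_def using emU by (intro integrable_real_indicator) auto
    have J': "integrable lborel (\<lambda>x. J (x - a))" for a using integrable_translate[OF J, of "- a"] by simp
    have [measurable]: "J \<in> borel_measurable borel" unfolding J_def by measurable
    \<comment> \<open>\<open>J x - J (x - Y n)\<close> has integral \<open>0\<close>, so its absolute value has twice the integral of its
        positive part, which tends to \<open>0\<close> pointwise because \<open>U\<close> is open.\<close>
    have "(\<lambda>n. LINT x|lborel. max 0 (J x - J (x - Y n))) \<longlonglongrightarrow> (LINT x|(lborel::'a measure). 0::real)"
    proof (rule integral_dominated_convergence[where w=J])
      show "AE x in lborel. (\<lambda>n. max 0 (J x - J (x - Y n))) \<longlonglongrightarrow> 0"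
      proof (rule AE_I2)
        fix x
        have "eventually (\<lambda>n. max 0 (J x - J (x - Y n)) = 0) sequentially"
        proof (cases "x \<in> U")
          case True
          have "(\<lambda>n. x - Y n) \<longlonglongrightarrow> x - 0" by (intro tendsto_intros Y)
          then have "eventually (\<lambda>n. x - Y n \<in> U) sequentially"
            using topological_tendstoD[OF _ U(1)] True by auto
          then show ?thesis by eventually_elim (simp add: J_def)
        qed (simp add: J_def)
        then show "(\<lambda>n. max 0 (J x - J (x - Y n))) \<longlonglongrightarrow> 0"
          by (rule tendsto_eventually)
      qed
    qed (auto simp: J J_def indicator_def)
    then obtain N where N: "\<And>n. n \<ge> N \<Longrightarrow> \<bar>LINT x|lborel. max 0 (J x - J (x - Y n))\<bar> < e / 4"
      using LIMSEQ_D[of _ 0 "e / 4"] \<open>0 < e\<close> by force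
    have "\<bar>LINT x|lborel. \<bar>indicator A (x - Y n) - indicator A x :: real\<bar>\<bar> < e" if "n \<ge> N" for n
    proof -
      define I where "I x = (indicator A x :: real)" for x
      have I: "integrable lborel I" unfolding I_def using emA by (intro integrable_real_indicator) auto
      have I': "integrable lborel (\<lambda>x. I (x - a))" for a using integrable_translate[OF I, of "- a"] by simp
      have [measurable]: "I \<in> borel_measurable borel" unfolding I_def by measurable
      have IJ: "I x \<le> J x" for x using U(2) by (auto simp: I_def J_def indicator_def)
      have IJi: "(LINT x|lborel. J x - I x) < e / 4"
      proof -
        have "(\<lambda>x. J x - I x) = indicator (U - A)" using U(2) by (auto simp: I_def J_def indicator_def fun_eq_iff)
        moreover have "measure lborel (U - A) < e / 4"
        proof -
          have "emeasure lborel (U - A) \<noteq> top" using U(3) by (metis ennreal_less_top order_less_irrefl order.strict_trans)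
          then have "ennreal (measure lborel (U - A)) < ennreal (e / 4)"
            using U(3) emeasure_eq_ennreal_measure by metis
          then show ?thesis by (simp only: ennreal_less_iff[OF measure_nonneg])
        qed
        ultimately show ?thesis by simp
      qed
      have tr: "(LINT x|lborel. J (x - a) - I (x - a)) = (LINT x|lborel. J x - I x)"
        "(LINT x|lborel. J (x - a)) = (LINT x|lborel. J x)" for a
        using integral_translate[of "\<lambda>x. J x - I x" "- a"] integral_translate[of J "- a"] by simp_all
      \<comment> \<open>Triangle inequality through \<open>J\<close>, with |a| written as 2 max 0 a
        - a for the difference of \<open>J\<close> and its translate. The integrals contribute e/4 +
        e/4 + 2 (e/4) and a term that vanishes by translation invariance.\<close>
      have "\<bar>I (x - Y n) - I x\<bar> \<le> (J (x - Y n) - I (x - Y n)) + (J x - I x)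
            + (2 * max 0 (J x - J (x - Y n)) - (J x - J (x - Y n)))" for x
        using IJ[of x] IJ[of "x - Y n"] by (auto simp: max_def abs_if)
      then have "(LINT x|lborel. \<bar>I (x - Y n) - I x\<bar>) \<le> (LINT x|lborel. (J (x - Y n) - I (x - Y n)) + (J x - I x)
            + (2 * max 0 (J x - J (x - Y n)) - (J x - J (x - Y n))))"
        by (intro integral_mono) (auto intro!: Bochner_Integration.integrable_diff Bochner_Integration.integrable_add
            integrable_max integrable_mult_right integrable_abs I I' J J')
      also have "\<dots> = (LINT x|lborel. J (x - Y n) - I (x - Y n)) + (LINT x|lborel. J x - I x)
            + (2 * (LINT x|lborel. max 0 (J x - J (x - Y n))) - ((LINT x|lborel. J x) - (LINT x|lborel. J (x - Y n))))"
        by (simp add: I I' J J' Bochner_Integration.integrable_diff Bochner_Integration.integrable_add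
            integrable_max integrable_mult_right)
      also have "\<dots> < e" using IJi N[OF that] unfolding tr by linarith
      finally show ?thesis by (simp add: I_def)
    qed
    then show "\<exists>no. \<forall>n\<ge>no. norm ((LINT x|lborel. \<bar>indicator A (x - Y n) - indicator A x :: real\<bar>) - 0) < e"
      by auto
  qed
  have "\<bar>indicator A (x - Y n) *\<^sub>R c - indicator A x *\<^sub>R c\<bar>
      = \<bar>c\<bar> * \<bar>indicator A (x - Y n) - indicator A x\<bar>" for x n
    by (auto simp: indicator_def)
  then show ?case using tendsto_mult_right_zero[OF ind, of "\<bar>c\<bar>"] by simp
next
  case (add f g)
  have i: "integrable lborel (\<lambda>x. f (x - a))" "integrable lborel (\<lambda>x. g (x - a))" for a
    using integrable_translate[OF add(1), of "- a"] integrable_translate[OF add(2), of "- a"] by simp_all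
  show ?case
  proof (rule tendsto_sandwich[OF _ _ tendsto_const tendsto_add_zero[OF add.IH]])
    show "eventually (\<lambda>n. (LINT x|lborel. \<bar>f (x - Y n) + g (x - Y n) - (f x + g x)\<bar>)
       \<le> (LINT x|lborel. \<bar>f (x - Y n) - f x\<bar>) + (LINT x|lborel. \<bar>g (x - Y n) - g x\<bar>)) sequentially"
    proof (rule always_eventually, rule allI)
      fix n
      have "(LINT x|lborel. \<bar>f (x - Y n) + g (x - Y n) - (f x + g x)\<bar>)
         \<le> (LINT x|lborel. \<bar>f (x - Y n) - f x\<bar> + \<bar>g (x - Y n) - g x\<bar>)"
        by (intro integral_mono) (auto intro!: integrable_abs simp: add i)
      also have "\<dots> = (LINT x|lborel. \<bar>f (x - Y n) - f x\<bar>) + (LINT x|lborel. \<bar>g (x - Y n) - g x\<bar>)"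
        by (simp add: add i)
      finally show "(LINT x|lborel. \<bar>f (x - Y n) + g (x - Y n) - (f x + g x)\<bar>) \<le> \<dots>" .
    qed
  qed auto
next
  case (lim f s)
  have i: "integrable lborel (\<lambda>x. f (x - a))" "integrable lborel (\<lambda>x. s n (x - a))" for a n
    using integrable_translate[OF lim(4), of "- a"] integrable_translate[OF lim(1), of "n" "- a"] by simp_all
  have [measurable]: "f \<in> borel_measurable borel" "s n \<in> borel_measurable borel" for n
    using borel_measurable_integrable[OF lim(4)] borel_measurable_integrable[OF lim(1)] by simp_all
  have "(\<lambda>n. LINT x|lborel. \<bar>f x - s n x\<bar>) \<longlonglongrightarrow> (LINT x|(lborel::'a measure). 0::real)"
  proof (rule integral_dominated_convergence[where w="\<lambda>x. 3 * \<bar>f x\<bar>"])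
    show "AE x in lborel. (\<lambda>i. \<bar>f x - s i x\<bar>) \<longlonglongrightarrow> 0"
    proof (rule AE_I2)
      fix x
      have "(\<lambda>i. \<bar>f x - s i x\<bar>) \<longlonglongrightarrow> \<bar>f x - f x\<bar>"
        using lim(2)[of x] by (intro tendsto_intros) simp
      then show "(\<lambda>i. \<bar>f x - s i x\<bar>) \<longlonglongrightarrow> 0" by simp
    qed
    show "AE x in lborel. norm \<bar>f x - s i x\<bar> \<le> 3 * \<bar>f x\<bar>" for i
    proof (rule AE_I2)
      fix x
      have "\<bar>s i x\<bar> \<le> 2 * \<bar>f x\<bar>" using lim(3)[of x i] by simp
      then show "norm \<bar>f x - s i x\<bar> \<le> 3 * \<bar>f x\<bar>" by simp
    qed
  qed (auto simp: lim)
  then have z: "(\<lambda>n. LINT x|lborel. \<bar>f x - s n x\<bar>) \<longlonglongrightarrow> 0" by simp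
  show ?case
  proof (rule LIMSEQ_I)
    fix e :: real assume "0 < e"
    then obtain k where k: "\<bar>LINT x|lborel. \<bar>f x - s k x\<bar>\<bar> < e / 3"
      using LIMSEQ_D[OF z, of "e / 3"] by force
    obtain N where N: "\<And>n. n \<ge> N \<Longrightarrow> \<bar>LINT x|lborel. \<bar>s k (x - Y n) - s k x\<bar>\<bar> < e / 3"
      using LIMSEQ_D[OF lim(5)[of k], of "e / 3"] \<open>0 < e\<close> by force
    have "(LINT x|lborel. \<bar>f (x - Y n) - f x\<bar>) < e" if "n \<ge> N" for n
    proof -
      have "(LINT x|lborel. \<bar>f (x - Y n) - f x\<bar>)
         \<le> (LINT x|lborel. \<bar>f (x - Y n) - s k (x - Y n)\<bar> + \<bar>s k (x - Y n) - s k x\<bar> + \<bar>f x - s k x\<bar>)"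
        by (intro integral_mono) (auto intro!: integrable_abs Bochner_Integration.integrable_diff Bochner_Integration.integrable_add simp: lim i)
      also have "\<dots> = (LINT x|lborel. \<bar>f (x - Y n) - s k (x - Y n)\<bar>) + (LINT x|lborel. \<bar>s k (x - Y n) - s k x\<bar>) + (LINT x|lborel. \<bar>f x - s k x\<bar>)"
        by (simp add: lim i)
      also have "(LINT x|lborel. \<bar>f (x - Y n) - s k (x - Y n)\<bar>) = (LINT x|lborel. \<bar>f x - s k x\<bar>)"
        using integral_translate[of "\<lambda>x. \<bar>f x - s k x\<bar>" "- Y n"] by simp
      finally show ?thesis using k N[OF that] by linarith
    qed
    then show "\<exists>no. \<forall>n\<ge>no. norm ((LINT x|lborel. \<bar>f (x - Y n) - f x\<bar>) - 0) < e"
      by (auto intro!: exI[of _ N])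
  qed
qed

text \<open>Sequential continuity at 0 turned into a uniform radius: a mollifier averages over all
  shifts of a small ball at the same time.\<close>

lemma L1_translation_small:
  fixes f :: "'a::euclidean_space \<Rightarrow> real"
  assumes "integrable lborel f" "0 < e"
  obtains d where "0 < d" "\<And>y. norm y < d \<Longrightarrow> (LINT x|lborel. \<bar>f (x - y) - f x\<bar>) < e"
proof (rule ccontr)
  assume "\<not> thesis"
  then have "\<exists>y. norm y < 1 / Suc n \<and> \<not> (LINT x|lborel. \<bar>f (x - y) - f x\<bar>) < e" for n
    using that[of "1 / Suc n"] by auto
  then obtain Y where Y: "\<And>n. norm (Y n) < 1 / Suc n" "\<And>n. \<not> (LINT x|lborel. \<bar>f (x - Y n) - f x\<bar>) < e"
    by metis
  have "Y \<longlonglongrightarrow> 0"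
    by (rule Lim_null_comparison[OF _ LIMSEQ_inverse_real_of_nat])
      (use Y(1) in \<open>auto intro!: always_eventually less_imp_le simp: inverse_eq_divide\<close>)
  from L1_translation_continuous[OF assms(1) this] \<open>0 < e\<close> Y(2) show False
    by (meson LIMSEQ_le_const linorder_not_less)
qed

text \<open>The variable \<open>x\<close> sits in the kernel, so that derivatives fall on
  \<open>\<rho>\<close> and \<open>f\<close> need only be integrable. \<open>conv_flip\<close> gives
  the other form, an average of translates of \<open>f\<close>.\<close>

definition conv :: "('a::euclidean_space \<Rightarrow> real) \<Rightarrow> ('a \<Rightarrow> real) \<Rightarrow> 'a \<Rightarrow> real" where
  "conv \<rho> f x = (LINT y|lborel. \<rho> (x - y) * f y)"

lemma integrable_conv_kernel:
  fixes f :: "'a::euclidean_space \<Rightarrow> real"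
  assumes "continuous_on UNIV \<rho>" "support_bound r \<rho>" "integrable lborel f"
  shows "integrable lborel (\<lambda>y. \<rho> (x - y) * f y)"
proof -
  obtain M where M: "0 < M" "\<And>x. \<bar>\<rho> x\<bar> \<le> M" using support_bound_bounded[OF assms(1,2)] by blast
  have [measurable]: "\<rho> \<in> borel_measurable borel" "f \<in> borel_measurable borel"
    using assms(1,3) by (auto intro: borel_measurable_continuous_onI)
  show ?thesis
    by (rule Bochner_Integration.integrable_bound[of _ "\<lambda>y. M * f y"])
      (use M assms(3) in \<open>auto simp: abs_mult intro!: mult_right_mono\<close>)
qed

text \<open>The partial derivatives of \<open>\<rho>\<close> are uniformly continuous, so the
  first-order remainder of the kernel is small relative to the increment, uniformly in the
  integration variable; it can then be integrated against \<open>f\<close>.\<close>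

lemma conv_has_derivative:
  fixes f :: "'a::euclidean_space \<Rightarrow> real"
  assumes \<rho>: "smooth \<rho>" "support_bound r \<rho>" and f: "integrable lborel f"
  shows "(conv \<rho> f has_derivative (\<lambda>h. \<Sum>i\<in>Basis. (h \<bullet> i) * conv (pd \<rho> i) f x)) (at x)"
  unfolding has_derivative_at_alt
proof (intro conjI allI impI)
  show "bounded_linear (\<lambda>h. \<Sum>i\<in>Basis. (h \<bullet> i) * conv (pd \<rho> i) f x)"
    by (intro bounded_linear_intros)
  fix e :: real assume "0 < e"
  define F where "F = (LINT y|lborel. \<bar>f y\<bar>)"
  have F: "0 \<le> F" by (simp add: F_def)
  \<comment> \<open>Each partial derivative may vary by \<open>w\<close>; summed over the basis and
    integrated against \<open>f\<close> this costs at most \<open>e\<close>. The added 1 guards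
    against \<open>F = 0\<close>.\<close>
  define w where "w = e / ((F + 1) * DIM('a))"
  have w: "0 < w" using \<open>0 < e\<close> F by (simp add: w_def)
  have cont: "continuous_on UNIV (pd \<rho> i)" and sup: "support_bound r (pd \<rho> i)" if "i \<in> Basis" for i
    using that \<rho> smooth_continuous_on smooth_pd support_bound_pd by blast+
  have "\<forall>i\<in>Basis. \<exists>d>0. \<forall>x y. dist x y < d \<longrightarrow> \<bar>pd \<rho> i x - pd \<rho> i y\<bar> < w"
    using support_bound_uniformly_continuous[OF cont sup w] by metis
  then obtain d where d: "\<And>i. i \<in> Basis \<Longrightarrow> 0 < d i"
    "\<And>i x y. i \<in> Basis \<Longrightarrow> dist x y < d i \<Longrightarrow> \<bar>pd \<rho> i x - pd \<rho> i y\<bar> < w"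
    by metis
  define \<delta> where "\<delta> = Min (d ` Basis)"
  have \<delta>: "0 < \<delta>" "\<And>i. i \<in> Basis \<Longrightarrow> \<delta> \<le> d i" using d(1) by (auto simp: \<delta>_def)
  show "\<exists>d>0. \<forall>y. norm (y - x) < d \<longrightarrow> norm (conv \<rho> f y - conv \<rho> f x
      - (\<Sum>i\<in>Basis. ((y - x) \<bullet> i) * conv (pd \<rho> i) f x)) \<le> e * norm (y - x)"
  proof (intro exI conjI allI impI)
    fix y assume y: "norm (y - x) < \<delta>"
    define h where "h = y - x"
    define R where "R z = \<rho> (y - z) - \<rho> (x - z) - (\<Sum>i\<in>Basis. (h \<bullet> i) * pd \<rho> i (x - z))" for z
    have R: "\<bar>R z\<bar> \<le> w * DIM('a) * norm h" for z
    proof -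
      obtain t where t: "0 < t" "t < 1" "\<rho> (x - z + h) - \<rho> (x - z) = pd \<rho> h (x - z + t *\<^sub>R h)"
        using pd_mvt[OF smooth_differentiable[OF \<rho>(1)]] by metis
      have "R z = (\<Sum>i\<in>Basis. (h \<bullet> i) * (pd \<rho> i (x - z + t *\<^sub>R h) - pd \<rho> i (x - z)))"
        using t(3) pd_sum_Basis[OF smooth_differentiable[OF \<rho>(1)], of h]
        by (simp add: R_def h_def sum_subtractf right_diff_distrib)
      also have "\<bar>\<dots>\<bar> \<le> (\<Sum>i\<in>(Basis::'a set). norm h * w)"
      proof (rule order_trans[OF sum_abs], rule sum_mono)
        fix i :: 'a assume i: "i \<in> Basis"
        have "dist (x - z + t *\<^sub>R h) (x - z) < d i"
          using t y \<delta>(2)[OF i] mult_left_le_one_le[of "norm h" t] by (simp add: dist_norm h_def)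
        then show "\<bar>(h \<bullet> i) * (pd \<rho> i (x - z + t *\<^sub>R h) - pd \<rho> i (x - z))\<bar> \<le> norm h * w"
          unfolding abs_mult using d(2)[OF i] Basis_le_norm[OF i] by (intro mult_mono) (auto intro: less_imp_le)
      qed
      finally show ?thesis by (simp add: mult_ac)
    qed
    have ik: "integrable lborel (\<lambda>z. \<rho> (a - z) * f z)" for a
      using integrable_conv_kernel[OF smooth_continuous_on[OF \<rho>(1)] \<rho>(2) f] .
    have ip: "integrable lborel (\<lambda>z. pd \<rho> i (x - z) * f z)" if "i \<in> Basis" for i
      using integrable_conv_kernel[OF cont[OF that] sup[OF that] f] .
    have eq: "R z * f z = \<rho> (y - z) * f z - \<rho> (x - z) * f z - (\<Sum>i\<in>Basis. (h \<bullet> i) * (pd \<rho> i (x - z) * f z))" for z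
      by (simp add: R_def left_diff_distrib sum_distrib_right mult.assoc)
    have iR: "integrable lborel (\<lambda>z. R z * f z)"
      unfolding eq using ip ik by (intro Bochner_Integration.integrable_diff Bochner_Integration.integrable_sum integrable_mult_right) auto
    have "conv \<rho> f y - conv \<rho> f x - (\<Sum>i\<in>Basis. (h \<bullet> i) * conv (pd \<rho> i) f x) = (LINT z|lborel. R z * f z)"
      unfolding eq conv_def using ip ik by (simp add: Bochner_Integration.integral_sum)
    also have "\<bar>\<dots>\<bar> \<le> (LINT z|lborel. \<bar>R z * f z\<bar>)"
      by (rule integral_abs_bound)
    also have "\<dots> \<le> (LINT z|lborel. (w * DIM('a) * norm h) * \<bar>f z\<bar>)"
      using R by (intro integral_mono integrable_abs iR integrable_mult_right f) (auto intro!: mult_right_mono simp: abs_mult)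
    also have "\<dots> = w * DIM('a) * norm h * F" by (simp add: F_def)
    also have "\<dots> \<le> e * norm h"
    proof -
      have "w * DIM('a) * F = e * (F / (F + 1))" using F by (simp add: w_def)
      also have "\<dots> \<le> e" using F \<open>0 < e\<close> by (intro mult_right_le_one_le) auto
      finally have "w * DIM('a) * F \<le> e" .
      from mult_right_mono[OF this, of "norm h"] show ?thesis by (simp add: mult_ac)
    qed
    finally show "norm (conv \<rho> f y - conv \<rho> f x
      - (\<Sum>i\<in>Basis. ((y - x) \<bullet> i) * conv (pd \<rho> i) f x)) \<le> e * norm (y - x)" by (simp add: h_def)
  qed (rule \<delta>)
qed

lemma pd_conv:
  assumes "smooth \<rho>" "support_bound r \<rho>" "integrable lborel f" "i \<in> Basis"
  shows "pd (conv \<rho> f) i = conv (pd \<rho> i) f"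
proof
  fix x
  have "pd (conv \<rho> f) i x = (\<Sum>j\<in>Basis. (i \<bullet> j) * conv (pd \<rho> j) f x)"
    by (rule pd_eqI[OF conv_has_derivative[OF assms(1-3)]])
  also have "\<dots> = (\<Sum>j\<in>Basis. if j = i then conv (pd \<rho> j) f x else 0)"
    by (intro sum.cong refl) (use assms(4) in \<open>auto simp: inner_Basis\<close>)
  finally show "pd (conv \<rho> f) i x = conv (pd \<rho> i) f x" using assms(4) by simp
qed

text \<open>Differentiation replaces the kernel by its partial derivative, again smooth and of
  bounded support; hence the induction generalises over the kernel.\<close>

lemma smooth_conv:
  assumes "smooth \<rho>" "support_bound r \<rho>" "integrable lborel f"
  shows "smooth (conv \<rho> f)"
proof -
  have d: "conv \<rho> f differentiable (at x)" if "smooth \<rho>" "support_bound r \<rho>" for \<rho> x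
    using conv_has_derivative[OF that assms(3)] unfolding differentiable_def by blast
  have "C_k k (conv \<rho> f)" if "smooth \<rho>" "support_bound r \<rho>" for k \<rho>
    using that
  proof (induction k arbitrary: \<rho>)
    case 0
    then show ?case using d by (simp add: continuous_at_imp_continuous_on differentiable_imp_continuous_within)
  next
    case (Suc k)
    then show ?case unfolding C_k_Suc_pd using d pd_conv[OF Suc.prems assms(3)] smooth_pd support_bound_pd by metis
  qed
  then show ?thesis using assms by (simp add: smooth_def)
qed

lemma conv_flip:
  fixes f :: "'a::euclidean_space \<Rightarrow> real"
  assumes [measurable]: "\<rho> \<in> borel_measurable borel" "f \<in> borel_measurable borel"
  shows "conv \<rho> f x = (LINT y|lborel. \<rho> y * f (x - y))"
  unfolding conv_def using integral_reflect[of "\<lambda>y. \<rho> y * f (x - y)" x] by simp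

text \<open>As \<open>\<rho>\<close> has integral 1, \<open>conv \<rho> f x - f x\<close> is the
  \<open>\<rho>\<close>-average of the differences f(x - y) - f(x). Exchanging the integrals bounds
  its L^1 norm by the average of the L^1 distances between \<open>f\<close> and its
  translates.\<close>

lemma conv_L1_close:
  fixes f :: "'a::euclidean_space \<Rightarrow> real"
  assumes \<rho>: "smooth \<rho>" "\<And>x. 0 \<le> \<rho> x" "\<And>x. \<rho> x \<noteq> 0 \<Longrightarrow> norm x < r" "integrable lborel \<rho>" "integral\<^sup>L lborel \<rho> = 1"
    and f: "integrable lborel f" and e: "\<And>y. norm y < r \<Longrightarrow> (LINT x|lborel. \<bar>f (x - y) - f x\<bar>) \<le> e" "0 \<le> e"
  shows "integrable lborel (\<lambda>x. conv \<rho> f x - f x)" "(LINT x|lborel. \<bar>conv \<rho> f x - f x\<bar>) \<le> e"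
proof -
  have cont: "continuous_on UNIV \<rho>" using \<rho>(1) by (rule smooth_continuous_on)
  have sup: "support_bound r \<rho>" using \<rho>(3) by (auto simp: support_bound_def intro: less_imp_le)
  have [measurable]: "\<rho> \<in> borel_measurable borel" "f \<in> borel_measurable borel"
    using cont f by (auto intro: borel_measurable_continuous_onI)
  have mc[measurable]: "conv \<rho> f \<in> borel_measurable borel"
    using smooth_continuous_on[OF smooth_conv[OF \<rho>(1) sup f]] by (rule borel_measurable_continuous_onI)
  have split: "conv \<rho> f x - f x = (LINT y|lborel. \<rho> y * (f (x - y) - f x))" for x
  proof -
    have "integrable lborel (\<lambda>y. \<rho> y * f (x - y))"
      using integrable_reflect[OF integrable_conv_kernel[OF cont sup f, of x], of x] by simp
    then show ?thesis using \<rho>(4,5) by (simp add: conv_flip right_diff_distrib)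
  qed
  have fin: "(\<integral>\<^sup>+y. ennreal (\<rho> y) \<partial>lborel) = 1"
    using nn_integral_eq_integral[OF \<rho>(4)] \<rho>(2,5) by simp
  have "(\<integral>\<^sup>+x. ennreal \<bar>conv \<rho> f x - f x\<bar> \<partial>lborel)
      \<le> (\<integral>\<^sup>+x. (\<integral>\<^sup>+y. ennreal (\<rho> y * \<bar>f (x - y) - f x\<bar>) \<partial>lborel) \<partial>lborel)"
  proof (rule nn_integral_mono)
    fix x
    show "ennreal \<bar>conv \<rho> f x - f x\<bar> \<le> (\<integral>\<^sup>+y. ennreal (\<rho> y * \<bar>f (x - y) - f x\<bar>) \<partial>lborel)"
    \<comment> \<open>Without integrability the Bochner integral is 0 by convention, and the
      inequality is trivial.\<close>
    proof (cases "integrable lborel (\<lambda>y. \<rho> y * (f (x - y) - f x))")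
      case True
      from integral_norm_bound_ennreal[OF this] show ?thesis
        by (simp add: split abs_mult \<rho>(2))
    qed (simp add: split not_integrable_integral_eq)
  qed
  also have "\<dots> = (\<integral>\<^sup>+y. (\<integral>\<^sup>+x. ennreal (\<rho> y * \<bar>f (x - y) - f x\<bar>) \<partial>lborel) \<partial>lborel)"
    by (rule lborel_pair.Fubini') measurable
  also have "\<dots> \<le> (\<integral>\<^sup>+y. ennreal (\<rho> y) * ennreal e \<partial>lborel)"
  proof (rule nn_integral_mono)
    fix y
    have i: "integrable lborel (\<lambda>x. \<bar>f (x - y) - f x\<bar>)"
      using integrable_translate[OF f, of "- y"] f by (auto intro!: integrable_abs)
    have "(\<integral>\<^sup>+x. ennreal (\<rho> y * \<bar>f (x - y) - f x\<bar>) \<partial>lborel) = ennreal (\<rho> y) * (\<integral>\<^sup>+x. ennreal \<bar>f (x - y) - f x\<bar> \<partial>lborel)"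
      by (simp add: ennreal_mult \<rho>(2) nn_integral_cmult)
    also have "(\<integral>\<^sup>+x. ennreal \<bar>f (x - y) - f x\<bar> \<partial>lborel) = ennreal (LINT x|lborel. \<bar>f (x - y) - f x\<bar>)"
      using i by (intro nn_integral_eq_integral) auto
    also have "ennreal (\<rho> y) * \<dots> \<le> ennreal (\<rho> y) * ennreal e"
      using e(1)[of y] \<rho>(3)[of y] by (cases "\<rho> y = 0") (auto intro!: mult_left_mono ennreal_leI)
    finally show "(\<integral>\<^sup>+x. ennreal (\<rho> y * \<bar>f (x - y) - f x\<bar>) \<partial>lborel) \<le> ennreal (\<rho> y) * ennreal e" .
  qed
  also have "\<dots> = ennreal e" by (simp add: nn_integral_multc fin)
  finally have le: "(\<integral>\<^sup>+x. ennreal \<bar>conv \<rho> f x - f x\<bar> \<partial>lborel) \<le> ennreal e" .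
  show int: "integrable lborel (\<lambda>x. conv \<rho> f x - f x)"
    by (rule integrableI_bounded) (use le in \<open>auto intro: order.strict_trans1\<close>)
  show "(LINT x|lborel. \<bar>conv \<rho> f x - f x\<bar>) \<le> e"
    using nn_integral_eq_integral[OF integrable_abs[OF int]] le e(2) by (simp add: ennreal_le_iff)
qed

section \<open>Weak gradients\<close>

text \<open>Weak derivatives live on the completed measure, while translation, reflection and the
  exchange of integrals are carried out on \<open>lborel\<close>; this lemma is the passage between
  the two.\<close>

lemma borel_representative:
  fixes f :: "'a::euclidean_space \<Rightarrow> real"
  assumes "integrable lebesgue f"
  obtains f' where "integrable lborel f'" "AE x in lebesgue. f x = f' x"
proof -
  have m: "f \<in> borel_measurable lebesgue" using assms by (rule borel_measurable_integrable)
  obtain f' where f': "f' \<in> borel_measurable lborel" "AE x in lborel. f x = f' x"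
    using completion_ex_borel_measurable_real[OF m] by blast
  then have AE: "AE x in lebesgue. f x = f' x" by (simp add: AE_completion)
  then have "integrable lebesgue f'"
    using assms m f'(1) by (subst integrable_cong_AE[of _ _ f]) (auto intro: measurable_completion)
  then show ?thesis using that AE f'(1) integrable_completion by blast
qed

lemma test_functionD:
  assumes "\<phi> \<in> test_functions \<Omega>"
  obtains K where "smooth \<phi>" "compact K" "K \<subseteq> \<Omega>" "\<And>x. x \<notin> K \<Longrightarrow> \<phi> x = 0" "\<And>x i. x \<notin> K \<Longrightarrow> pd \<phi> i x = 0"
proof -
  define K where "K = closure {x. \<phi> x \<noteq> 0}"
  have K: "smooth \<phi>" "compact K" "K \<subseteq> \<Omega>"
    using assms unfolding test_functions_def smooth_def K_def by blast+
  have z: "\<phi> x = 0" if "x \<notin> K" for x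
  proof (rule ccontr)
    assume "\<phi> x \<noteq> 0"
    then have "x \<in> K" unfolding K_def by (intro subsetD[OF closure_subset]) simp
    with that show False by simp
  qed
  have "pd \<phi> i x = 0" if "x \<notin> K" for x i
  proof (rule pd_eq_0[of "- K"])
    show "open (- K)" by (simp add: K_def open_Compl)
  qed (simp_all add: that z)
  then show ?thesis using that[OF K z] by blast
qed

lemma test_functionI:
  assumes "smooth \<phi>" "compact K" "K \<subseteq> \<Omega>" "\<And>x. \<phi> x \<noteq> 0 \<Longrightarrow> x \<in> K"
  shows "\<phi> \<in> test_functions \<Omega>"
proof -
  have "closure {x. \<phi> x \<noteq> 0} \<subseteq> K" using assms by (intro closure_minimal) (auto simp: compact_imp_closed)
  then show ?thesis using assms compact_Int_closed[of K "closure {x. \<phi> x \<noteq> 0}"]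
    by (auto simp: test_functions_def smooth_def Int_absorb1)
qed

lemma lebesgue_on_open:
  fixes \<Omega> :: "'a::euclidean_space set"
  assumes "open \<Omega>"
  shows "integrable (lebesgue_on \<Omega>) f \<longleftrightarrow> integrable lebesgue (\<lambda>x. indicator \<Omega> x * f x :: real)"
    and "(LINT x|lebesgue_on \<Omega>. f x) = (LINT x|lebesgue. indicator \<Omega> x * f x)"
  using assms by (simp_all add: integrable_restrict_space integral_restrict_space)

text \<open>A test function kills the integrand outside a compact subset of \<open>\<Omega>\<close>,
  so the integrals in the definition of a weak gradient may be taken over the whole space, whatever
  the values of \<open>u\<close> outside \<open>\<Omega>\<close>.\<close>

lemma lebesgue_on_supported:
  fixes \<Omega> :: "'a::euclidean_space set" and f :: "'a \<Rightarrow> real"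
  assumes "open \<Omega>" "K \<subseteq> \<Omega>" "\<And>x. x \<notin> K \<Longrightarrow> f x = 0"
  shows "integrable (lebesgue_on \<Omega>) f \<longleftrightarrow> integrable lebesgue f"
    and "(LINT x|lebesgue_on \<Omega>. f x) = (LINT x|lebesgue. f x)"
proof -
  have "(\<lambda>x. indicator \<Omega> x * f x) = f" using assms by (fastforce simp: indicator_def)
  then show "integrable (lebesgue_on \<Omega>) f \<longleftrightarrow> integrable lebesgue f"
    "(LINT x|lebesgue_on \<Omega>. f x) = (LINT x|lebesgue. f x)"
    using lebesgue_on_open[OF assms(1)] by simp_all
qed

lemma continuous_lebesgue_measurable:
  fixes \<psi> :: "'a::euclidean_space \<Rightarrow> real"
  shows "continuous_on UNIV \<psi> \<Longrightarrow> \<psi> \<in> borel_measurable lebesgue"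
  by (auto intro!: measurable_completion borel_measurable_continuous_onI)

lemma locally_integrable_mult:
  assumes "locally_integrable \<Omega> f" "continuous_on UNIV \<psi>" "compact K" "K \<subseteq> \<Omega>"
  shows "integrable lebesgue (\<lambda>x. indicator K x * (f x * \<psi> x))"
proof -
  have i: "integrable lebesgue (\<lambda>x. indicator K x * f x)"
    using assms by (auto simp: locally_integrable_def set_integrable_def)
  have "bounded (\<psi> ` K)"
    by (intro compact_imp_bounded compact_continuous_image continuous_on_subset[OF assms(2)] assms) auto
  then obtain M where M: "0 < M" "\<And>x. x \<in> K \<Longrightarrow> \<bar>\<psi> x\<bar> \<le> M"
    unfolding bounded_pos by auto
  have "integrable lebesgue (\<lambda>x. (indicator K x * f x) * \<psi> x)"
  proof (rule Bochner_Integration.integrable_bound)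
    show "integrable lebesgue (\<lambda>x. M * (indicator K x * f x))" using i by simp
    show "(\<lambda>x. (indicator K x * f x) * \<psi> x) \<in> borel_measurable lebesgue"
      using borel_measurable_integrable[OF i] continuous_lebesgue_measurable[OF assms(2)] by measurable
    show "AE x in lebesgue. norm ((indicator K x * f x) * \<psi> x) \<le> norm (M * (indicator K x * f x))"
      using M by (intro AE_I2) (auto simp: indicator_def abs_mult mult.commute intro!: mult_right_mono)
  qed
  then show ?thesis by (simp add: mult.assoc)
qed

lemma integrable_locally_integrable_mult:
  assumes "open \<Omega>" "locally_integrable \<Omega> f" "continuous_on UNIV \<psi>" "compact K" "K \<subseteq> \<Omega>" "\<And>x. x \<notin> K \<Longrightarrow> \<psi> x = 0"
  shows "integrable (lebesgue_on \<Omega>) (\<lambda>x. f x * \<psi> x)"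
proof -
  have "(\<lambda>x. indicator K x * (f x * \<psi> x)) = (\<lambda>x. f x * \<psi> x)"
    using assms(6) by (auto simp: indicator_def fun_eq_iff)
  then show ?thesis
    using locally_integrable_mult[OF assms(2-5)] lebesgue_on_supported(1)[OF assms(1,5), of "\<lambda>x. f x * \<psi> x"] assms(6)
    by simp
qed

lemma integrable_test:
  assumes "open \<Omega>" "locally_integrable \<Omega> f" "\<phi> \<in> test_functions \<Omega>"
  shows "integrable (lebesgue_on \<Omega>) (\<lambda>x. f x * \<phi> x)"
    and "i \<in> Basis \<Longrightarrow> integrable (lebesgue_on \<Omega>) (\<lambda>x. f x * pd \<phi> i x)"
proof -
  obtain K where K: "smooth \<phi>" "compact K" "K \<subseteq> \<Omega>" "\<And>x. x \<notin> K \<Longrightarrow> \<phi> x = 0" "\<And>x i. x \<notin> K \<Longrightarrow> pd \<phi> i x = 0"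
    using test_functionD[OF assms(3)] by blast
  show "integrable (lebesgue_on \<Omega>) (\<lambda>x. f x * \<phi> x)"
    using K assms by (intro integrable_locally_integrable_mult[where K=K] smooth_continuous_on) auto
  show "integrable (lebesgue_on \<Omega>) (\<lambda>x. f x * pd \<phi> i x)" if "i \<in> Basis"
    using K assms that by (intro integrable_locally_integrable_mult[where K=K] smooth_continuous_on smooth_pd) auto
qed

lemma has_weak_gradient_pd:
  "has_weak_gradient \<Omega> u g \<longleftrightarrow> locally_integrable \<Omega> u \<and> (\<forall>i\<in>Basis. locally_integrable \<Omega> (\<lambda>x. g x \<bullet> i)) \<and>
     (\<forall>i\<in>Basis. \<forall>\<phi>\<in>test_functions \<Omega>.
        (LINT x|lebesgue_on \<Omega>. u x * pd \<phi> i x) = - (LINT x|lebesgue_on \<Omega>. (g x \<bullet> i) * \<phi> x))"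
  by (simp add: has_weak_gradient_def pd_def)

lemma locally_integrable_diff:
  "locally_integrable \<Omega> f \<Longrightarrow> locally_integrable \<Omega> g \<Longrightarrow> locally_integrable \<Omega> (\<lambda>x. f x - g x)"
  by (auto simp: locally_integrable_def intro: set_integral_diff(1))

lemma has_weak_gradient_diff:
  assumes "open \<Omega>" "has_weak_gradient \<Omega> u g" "has_weak_gradient \<Omega> v h"
  shows "has_weak_gradient \<Omega> (\<lambda>x. u x - v x) (\<lambda>x. g x - h x)"
  using assms unfolding has_weak_gradient_pd
  by (auto simp: inner_diff_left left_diff_distrib integrable_test intro!: locally_integrable_diff)

text \<open>The function y -> \<open>\<rho> (x - y)\<close> is the test function by which the
  derivative of a mollification is moved onto the weak gradient; the minus sign cancels the one in
  the integration by parts formula.\<close>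

lemma smooth_reflect:
  assumes "smooth \<rho>"
  shows "smooth (\<lambda>y. \<rho> (x - y))" "pd (\<lambda>y. \<rho> (x - y)) i y = - pd \<rho> i (x - y)"
proof -
  have d: "((\<lambda>y. \<rho> (x - y)) has_derivative (\<lambda>h. pd \<rho> (- h) (x - y))) (at y)" if "\<rho> differentiable (at (x - y))" for \<rho> y
  proof (rule has_derivative_compose[of "\<lambda>y. x - y" "\<lambda>h. - h" y UNIV \<rho>])
    show "((\<lambda>y. x - y) has_derivative (\<lambda>h. - h)) (at y)" by (auto intro!: derivative_eq_intros)
    show "(\<rho> has_derivative (\<lambda>i. pd \<rho> i (x - y))) (at (x - y))" using that by (rule has_derivative_pd)
  qed
  have p: "pd (\<lambda>y. \<rho> (x - y)) i y = (- 1) * pd \<rho> i (x - y)" if "\<rho> differentiable (at (x - y))" for \<rho> y i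
    using pd_eqI[OF d[OF that]] linear_neg[OF has_derivative_linear[OF has_derivative_pd[OF that]]] by simp
  show "pd (\<lambda>y. \<rho> (x - y)) i y = - pd \<rho> i (x - y)" using p[OF smooth_differentiable[OF assms]] by simp
  have "C_k k (\<lambda>y. \<rho> (x - y))" if "C_k k \<rho>" for k \<rho>
    using that
  proof (induction k arbitrary: \<rho>)
    case 0
    then show ?case by (auto intro!: continuous_on_compose2[of UNIV \<rho>] continuous_intros)
  next
    case (Suc k)
    then have "\<And>y. \<rho> differentiable (at y)" "\<And>i. i \<in> Basis \<Longrightarrow> C_k k (pd \<rho> i)"
      unfolding C_k_Suc_pd by blast+
    moreover from this have "pd (\<lambda>y. \<rho> (x - y)) i = (\<lambda>y. (- 1) * pd \<rho> i (x - y))" for i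
      using p by blast
    ultimately show ?case unfolding C_k_Suc_pd
      using d C_k_mult[OF C_k_const] Suc.IH unfolding differentiable_def by metis
  qed
  then show "smooth (\<lambda>y. \<rho> (x - y))" using assms by (simp add: smooth_def)
qed

text \<open>The closed neighbourhood is the Minkowski sum of \<open>K\<close> and a closed
  ball.\<close>

lemma compact_cball_union:
  fixes K :: "'a::euclidean_space set"
  assumes "compact K"
  shows "compact (\<Union>x\<in>K. cball x d)"
proof -
  have "(\<Union>x\<in>K. cball x d) = {x + y |x y. x \<in> K \<and> y \<in> cball 0 d}"
  proof (intro equalityI subsetI)
    fix z assume "z \<in> (\<Union>x\<in>K. cball x d)"
    then obtain x where "x \<in> K" "z \<in> cball x d" by auto
    then show "z \<in> {x + y |x y. x \<in> K \<and> y \<in> cball 0 d}"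
      by (intro CollectI exI[of _ x] exI[of _ "z - x"]) (auto simp: dist_norm norm_minus_commute)
  next
    fix z assume "z \<in> {x + y |x y. x \<in> K \<and> y \<in> cball 0 d}"
    then obtain x y where "x \<in> K" "norm y \<le> d" "z = x + y" by auto
    then show "z \<in> (\<Union>x\<in>K. cball x d)" by (intro UN_I[of x]) (auto simp: dist_norm)
  qed
  then show ?thesis using compact_sums[OF assms compact_cball[of 0 d]] by simp
qed

lemma conv_borel_representative:
  fixes f :: "'a::euclidean_space \<Rightarrow> real"
  assumes "continuous_on UNIV \<rho>" "f \<in> borel_measurable lebesgue" "integrable lborel f'" "AE x in lebesgue. f x = f' x"
  shows "conv \<rho> f' x = (LINT y|lebesgue. \<rho> (x - y) * f y)"
proof -
  have [measurable]: "f' \<in> borel_measurable borel" "\<rho> \<in> borel_measurable borel"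
    using assms by (auto intro!: borel_measurable_continuous_onI)
  have m: "(\<lambda>y. \<rho> (x - y)) \<in> borel_measurable lebesgue" "f' \<in> borel_measurable lebesgue"
    by (auto intro!: measurable_completion)
  have "conv \<rho> f' x = (LINT y|lebesgue. \<rho> (x - y) * f' y)"
    unfolding conv_def by (subst integral_completion) auto
  also have "\<dots> = (LINT y|lebesgue. \<rho> (x - y) * f y)"
    using assms(4) m assms(2) by (intro integral_cong_AE) auto
  finally show ?thesis .
qed

text \<open>Mollify \<open>u\<close> after cutting it off to a closed neighbourhood
  \<open>K'\<close> of \<open>K\<close> inside \<open>\<Omega>\<close>. For x in \<open>K\<close>
  the kernel centred at x is supported in \<open>K'\<close>, hence is a test function, and the
  derivative of the mollification is the mollification of the weak gradient. The last conclusion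
  localises \<open>w\<close> near the points where \<open>u\<close> is nonzero; it serves for test
  functions and for uniqueness.\<close>

lemma local_smooth_approximation:
  fixes \<Omega> :: "'a::euclidean_space set"
  assumes \<Omega>: "open \<Omega>" and u: "has_weak_gradient \<Omega> u g" and K: "compact K" "K \<subseteq> \<Omega>" and "0 < e" "0 < \<eta>"
  obtains w where "smooth w" "(LINT x|lebesgue. indicator K x * \<bar>w x - u x\<bar>) < e"
    "\<forall>i\<in>Basis. (LINT x|lebesgue. indicator K x * \<bar>pd w i x - g x \<bullet> i\<bar>) < e"
    "\<forall>x. w x \<noteq> 0 \<longrightarrow> (\<exists>y\<in>\<Omega>. u y \<noteq> 0 \<and> dist x y < \<eta>)"
proof -
  obtain \<delta> where \<delta>: "0 < \<delta>" "(\<Union>x\<in>K. cball x \<delta>) \<subseteq> \<Omega>"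
    using compact_subset_open_imp_cball_epsilon_subset[OF K(1) \<Omega> K(2)] by blast
  define K' where "K' = (\<Union>x\<in>K. cball x \<delta>)"
  have K': "compact K'" "K' \<subseteq> \<Omega>" "K \<subseteq> K'" using compact_cball_union[OF K(1)] \<delta> by (auto simp: K'_def)
  have [measurable]: "K \<in> sets lebesgue" "K' \<in> sets lebesgue"
    using K K' by (auto simp: borel_compact)
  \<comment> \<open>The cut-offs are merely integrable: the jump at the edge of \<open>K'\<close>
    prevents \<open>h\<close> from being the gradient of \<open>f\<close>. The two are related only
    through kernels centred in \<open>K\<close>.\<close>
  define f where "f x = indicator K' x * u x" for x
  define h where "h i x = indicator K' x * (g x \<bullet> i)" for i x
  have f: "integrable lebesgue f" and h: "\<And>i. i \<in> Basis \<Longrightarrow> integrable lebesgue (h i)"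
    using u K' by (auto simp: has_weak_gradient_def locally_integrable_def set_integrable_def f_def[abs_def] h_def[abs_def])
  obtain f' where f': "integrable lborel f'" "AE x in lebesgue. f x = f' x"
    using borel_representative[OF f] .
  have "\<forall>i\<in>Basis. \<exists>h'. integrable lborel h' \<and> (AE x in lebesgue. h i x = h' x)"
    using borel_representative[OF h] by metis
  then obtain h' where h': "\<And>i. i \<in> Basis \<Longrightarrow> integrable lborel (h' i)" "\<And>i. i \<in> Basis \<Longrightarrow> AE x in lebesgue. h i x = h' i x"
    by metis
  obtain d0 where d0: "0 < d0" "\<And>y. norm y < d0 \<Longrightarrow> (LINT x|lborel. \<bar>f' (x - y) - f' x\<bar>) < e / 2"
    using L1_translation_small[OF f'(1), of "e / 2"] \<open>0 < e\<close> by auto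
  have "\<forall>i\<in>Basis. \<exists>d>0. \<forall>y. norm y < d \<longrightarrow> (LINT x|lborel. \<bar>h' i (x - y) - h' i x\<bar>) < e / 2"
    using L1_translation_small[OF h'(1), of _ "e / 2"] \<open>0 < e\<close> by (metis half_gt_zero)
  then obtain di where di: "\<And>i. i \<in> Basis \<Longrightarrow> 0 < di i"
    "\<And>i y. i \<in> Basis \<Longrightarrow> norm y < di i \<Longrightarrow> (LINT x|lborel. \<bar>h' i (x - y) - h' i x\<bar>) < e / 2"
    by metis
  \<comment> \<open>At most \<open>\<delta>\<close> for kernels to stay in \<open>K'\<close>, at
    most \<open>\<eta>\<close> for the support clause, and below the remaining radii for L^1
    closeness of the function and of each partial derivative.\<close>
  define r where "r = Min (insert d0 (insert \<delta> (insert \<eta> (di ` Basis))))"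
  have "r \<in> insert d0 (insert \<delta> (insert \<eta> (di ` Basis)))" unfolding r_def by (intro Min_in) auto
  then have r: "0 < r" using d0(1) di(1) \<delta>(1) \<open>0 < \<eta>\<close> by auto
  have r_le: "r \<le> d0" "r \<le> \<delta>" "r \<le> \<eta>" "\<And>i. i \<in> Basis \<Longrightarrow> r \<le> di i"
    unfolding r_def by (auto intro!: Min_le simp del: Min_insert)
  obtain \<rho> :: "'a \<Rightarrow> real" where \<rho>: "smooth \<rho>" "\<And>x. 0 \<le> \<rho> x" "\<And>x. \<rho> x \<noteq> 0 \<Longrightarrow> norm x < r" "integrable lborel \<rho>" "integral\<^sup>L lborel \<rho> = 1"
    using mollifier_exists[OF r] by metis
  have sup: "support_bound r \<rho>" using \<rho>(3) by (auto simp: support_bound_def intro: less_imp_le)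
  have cont: "continuous_on UNIV \<rho>" using \<rho>(1) by (rule smooth_continuous_on)
  define w where "w = conv \<rho> f'"
  have sw: "smooth w" unfolding w_def by (rule smooth_conv[OF \<rho>(1) sup f'(1)])
  \<comment> \<open>One estimate for the function and for every partial derivative: \<open>q\<close>
    is the original, \<open>p\<close> its cut-off, \<open>q'\<close> a Borel representative of
    \<open>p\<close>, and \<open>c\<close> the smooth function compared with \<open>q\<close> on
    \<open>K\<close>.\<close>
  have ind: "(LINT x|lebesgue. indicator K x * \<bar>c x - q x\<bar>) < e"
    if "q' \<in> borel_measurable lebesgue" "integrable lborel q'" "integrable lebesgue p"
       "\<And>y. norm y < r \<Longrightarrow> (LINT x|lborel. \<bar>q' (x - y) - q' x\<bar>) \<le> e / 2"
       "AE x in lebesgue. p x = q' x" "\<And>x. p x = indicator K' x * q x" "\<And>x. x \<in> K \<Longrightarrow> c x = conv \<rho> q' x" for c q q' p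
  proof -
    have mc: "conv \<rho> q' \<in> borel_measurable lebesgue"
      using smooth_continuous_on[OF smooth_conv[OF \<rho>(1) sup that(2)]] by (rule continuous_lebesgue_measurable)
    have c: "integrable lborel (\<lambda>x. conv \<rho> q' x - q' x)" "(LINT x|lborel. \<bar>conv \<rho> q' x - q' x\<bar>) \<le> e / 2"
      using conv_L1_close[OF \<rho> that(2,4)] \<open>0 < e\<close> by simp_all
    have ci: "integrable lebesgue (\<lambda>x. conv \<rho> q' x - q' x)"
      using c(1) by (simp add: integrable_completion borel_measurable_integrable)
    have "indicator K x * \<bar>c x - q x\<bar> = indicator K x * \<bar>conv \<rho> q' x - p x\<bar>" for x
      using that(6,7) K'(3) by (auto simp: indicator_def)
    then have "(LINT x|lebesgue. indicator K x * \<bar>c x - q x\<bar>) = (LINT x|lebesgue. indicator K x * \<bar>conv \<rho> q' x - p x\<bar>)"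
      by (simp only:)
    also have "\<dots> = (LINT x|lebesgue. indicator K x * \<bar>conv \<rho> q' x - q' x\<bar>)"
    proof (rule integral_cong_AE)
      have [measurable]: "p \<in> borel_measurable lebesgue" using that(3) by simp
      note [measurable] = mc that(1)
      show "(\<lambda>x. indicator K x * \<bar>conv \<rho> q' x - p x\<bar>) \<in> borel_measurable lebesgue"
        "(\<lambda>x. indicator K x * \<bar>conv \<rho> q' x - q' x\<bar>) \<in> borel_measurable lebesgue" by measurable
      show "AE x in lebesgue. indicator K x * \<bar>conv \<rho> q' x - p x\<bar> = indicator K x * \<bar>conv \<rho> q' x - q' x\<bar>"
        using that(5) by eventually_elim simp
    qed
    also have "\<dots> \<le> (LINT x|lebesgue. \<bar>conv \<rho> q' x - q' x\<bar>)"
    proof (rule integral_mono')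
      show "integrable lebesgue (\<lambda>x. \<bar>conv \<rho> q' x - q' x\<bar>)" using ci by simp
    qed (auto simp: indicator_def)
    also have "\<dots> = (LINT x|lborel. \<bar>conv \<rho> q' x - q' x\<bar>)"
      using borel_measurable_integrable[OF c(1)] by (intro integral_completion) simp
    finally show ?thesis using c(2) \<open>0 < e\<close> by simp
  qed
  have fm: "f \<in> borel_measurable lebesgue" using f by simp
  \<comment> \<open>Written with \<open>f\<close> instead of \<open>f'\<close>, because the support
    clause speaks of points where \<open>u\<close> itself is nonzero and the representative may
    differ there.\<close>
  have w_eq: "w x = (LINT y|lebesgue. \<rho> (x - y) * f y)" for x
    unfolding w_def by (rule conv_borel_representative[OF cont fm f'])
  have 1: "(LINT x|lebesgue. indicator K x * \<bar>w x - u x\<bar>) < e"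
    by (rule ind[of f' f])
      (use f' f d0 r_le in \<open>auto simp: w_def f_def less_imp_le intro!: measurable_completion\<close>)
  have 2: "(LINT x|lebesgue. indicator K x * \<bar>pd w i x - g x \<bullet> i\<bar>) < e" if i: "i \<in> Basis" for i
  proof (rule ind[of "h' i" "h i"])
    show "pd w i x = conv \<rho> (h' i) x" if x: "x \<in> K" for x
    proof -
      define \<phi> where "\<phi> y = \<rho> (x - y)" for y
      have \<phi>0: "y \<in> cball x r" if "\<phi> y \<noteq> 0" for y
        using \<rho>(3)[of "x - y"] that by (simp add: \<phi>_def dist_norm)
      have sub: "cball x r \<subseteq> K'" using x r_le(2) by (force simp: K'_def)
      have t: "\<phi> \<in> test_functions \<Omega>"
        by (rule test_functionI[of _ "cball x r"])
          (use sub K' \<phi>0 smooth_reflect(1)[OF \<rho>(1)] in \<open>auto simp: \<phi>_def[abs_def]\<close>)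
      have pd0: "pd \<phi> i y = 0" if "y \<notin> cball x r" for y
        by (rule pd_eq_0[of "- cball x r"]) (use that \<phi>0 in \<open>auto simp: open_Compl\<close>)
      have \<phi>K: "\<phi> y = 0" "pd \<phi> i y = 0" if "y \<notin> K'" for y
        using that \<phi>0 pd0 sub by blast+
      have "pd w i x = conv (pd \<rho> i) f' x"
        unfolding w_def using pd_conv[OF \<rho>(1) sup f'(1) i] by simp
      also have "\<dots> = (LINT y|lebesgue. pd \<rho> i (x - y) * f y)"
        by (rule conv_borel_representative[OF smooth_continuous_on[OF smooth_pd[OF \<rho>(1) i]] fm f'])
      also have "\<dots> = (LINT y|lebesgue. - (u y * pd \<phi> i y))"
      proof (intro Bochner_Integration.integral_cong refl)
        fix y
        have "pd \<phi> i y = - pd \<rho> i (x - y)" unfolding \<phi>_def by (rule smooth_reflect(2)[OF \<rho>(1)])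
        then show "pd \<rho> i (x - y) * f y = - (u y * pd \<phi> i y)"
          using \<phi>K[of y] by (cases "y \<in> K'") (auto simp: f_def)
      qed
      also have "\<dots> = - (LINT y|lebesgue_on \<Omega>. u y * pd \<phi> i y)"
        using lebesgue_on_supported(2)[OF \<Omega> K'(2), of "\<lambda>y. u y * pd \<phi> i y"] \<phi>K(2) by simp
      also have "\<dots> = (LINT y|lebesgue_on \<Omega>. (g y \<bullet> i) * \<phi> y)"
        using u t i by (simp add: has_weak_gradient_pd)
      also have "\<dots> = (LINT y|lebesgue. (g y \<bullet> i) * \<phi> y)"
        using lebesgue_on_supported(2)[OF \<Omega> K'(2), of "\<lambda>y. (g y \<bullet> i) * \<phi> y"] \<phi>K(1) by simp
      also have "\<dots> = (LINT y|lebesgue. \<rho> (x - y) * h i y)"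
      proof (intro Bochner_Integration.integral_cong refl)
        fix y
        show "(g y \<bullet> i) * \<phi> y = \<rho> (x - y) * h i y"
          using \<phi>K[of y] by (cases "y \<in> K'") (auto simp: h_def \<phi>_def)
      qed
      also have "\<dots> = conv \<rho> (h' i) x"
        using conv_borel_representative[OF cont _ h'[OF i]] h[OF i] by simp
      finally show ?thesis .
    qed
    show "(LINT x|lborel. \<bar>h' i (x - y) - h' i x\<bar>) \<le> e / 2" if "norm y < r" for y
      using di(2)[OF i, of y] r_le(4)[OF i] that by simp
  qed (use h'[OF i] h[OF i] in \<open>auto simp: h_def intro!: measurable_completion\<close>)
  have 3: "\<exists>y\<in>\<Omega>. u y \<noteq> 0 \<and> dist x y < \<eta>" if "w x \<noteq> 0" for x
  proof -
    have "\<exists>y. \<rho> (x - y) * f y \<noteq> 0"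
    proof (rule ccontr)
      assume "\<not> ?thesis"
      then have "(\<lambda>y. \<rho> (x - y) * f y) = (\<lambda>y. 0)" by blast
      with that show False unfolding w_eq by simp
    qed
    then obtain y where y: "\<rho> (x - y) \<noteq> 0" "f y \<noteq> 0" by auto
    then have "y \<in> K'" "u y \<noteq> 0" by (auto simp: f_def indicator_def split: if_splits)
    with \<rho>(3)[OF y(1)] K'(2) r_le(3) show ?thesis by (intro bexI[of _ y]) (auto simp: dist_norm)
  qed
  show ?thesis using that[OF sw 1] 2 3 by blast
qed

text \<open>Approximations are available on compact subsets only; an open set is a countable union
  of them, so the exceptional null sets add up to a null set.\<close>

lemma AE_compact_cover:
  fixes \<Omega> :: "'a::euclidean_space set"
  assumes "open \<Omega>" "\<And>K. compact K \<Longrightarrow> K \<subseteq> \<Omega> \<Longrightarrow> AE x in lebesgue. x \<in> K \<longrightarrow> P x"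
  shows "AE x in lebesgue_on \<Omega>. P x"
proof -
  obtain C where C: "\<And>n::nat. compact (C n)" "\<And>n. C n \<subseteq> \<Omega>" "\<Union>(range C) = \<Omega>"
    using open_Union_compact_subsets[OF assms(1)] by metis
  have "AE x in lebesgue. \<forall>n. x \<in> C n \<longrightarrow> P x"
    using assms(2)[OF C(1,2)] by (subst AE_all_countable) simp
  then have "AE x in lebesgue. x \<in> \<Omega> \<longrightarrow> P x"
    by eventually_elim (use C(3) in blast)
  then show ?thesis using assms(1) by (subst AE_restrict_space_iff) auto
qed

text \<open>The difference of two weak gradients is a weak gradient of \<open>0\<close>, whose mollifications vanish.\<close>

lemma weak_gradient_unique:
  fixes \<Omega> :: "'a::euclidean_space set"
  assumes \<Omega>: "open \<Omega>" and "has_weak_gradient \<Omega> u g" "has_weak_gradient \<Omega> u h"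
  shows "AE x in lebesgue_on \<Omega>. g x = h x"
proof -
  have z: "has_weak_gradient \<Omega> (\<lambda>x. 0) (\<lambda>x. g x - h x)"
    using has_weak_gradient_diff[OF assms] by simp
  show ?thesis
  proof (rule AE_compact_cover[OF \<Omega>])
    fix K assume K: "compact K" "K \<subseteq> \<Omega>"
    have "AE x in lebesgue. indicator K x * \<bar>(g x - h x) \<bullet> i\<bar> = 0" if i: "i \<in> Basis" for i
    proof -
      have int: "integrable lebesgue (\<lambda>x. indicator K x * \<bar>(g x - h x) \<bullet> i\<bar>)"
      proof -
        have "integrable lebesgue (\<lambda>x. indicator K x * ((g x - h x) \<bullet> i))"
          using z K i by (auto simp: has_weak_gradient_def locally_integrable_def set_integrable_def)
        then have "integrable lebesgue (\<lambda>x. \<bar>indicator K x * ((g x - h x) \<bullet> i)\<bar>)" by (rule integrable_abs)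
        then show ?thesis by (simp add: abs_mult)
      qed
      have "(LINT x|lebesgue. indicator K x * \<bar>(g x - h x) \<bullet> i\<bar>) < e" if e: "0 < e" for e
      proof -
        obtain w where w: "smooth w" "(LINT x|lebesgue. indicator K x * \<bar>w x - 0\<bar>) < e"
          "\<forall>i\<in>Basis. (LINT x|lebesgue. indicator K x * \<bar>pd w i x - (g x - h x) \<bullet> i\<bar>) < e"
          "\<forall>x. w x \<noteq> 0 \<longrightarrow> (\<exists>y\<in>\<Omega>. (0::real) \<noteq> 0 \<and> dist x y < 1)"
          by (rule local_smooth_approximation[OF \<Omega> z K e zero_less_one])
        \<comment> \<open>The support clause for the zero function has no admissible point, so
          \<open>w\<close> is identically 0, and the derivative estimate becomes an estimate of
          \<open>g - h\<close> itself.\<close>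
        have "w x = 0" for x using w(4) by blast
        then have "pd w i x = 0" for x using pd_eq_0[of UNIV x w i] by simp
        then show ?thesis using bspec[OF w(3) i] by simp
      qed
      then have "(LINT x|lebesgue. indicator K x * \<bar>(g x - h x) \<bullet> i\<bar>) \<le> 0"
        by (meson dense not_less order.asym)
      moreover have "(LINT x|lebesgue. indicator K x * \<bar>(g x - h x) \<bullet> i\<bar>) \<ge> 0" by simp
      ultimately have "(LINT x|lebesgue. indicator K x * \<bar>(g x - h x) \<bullet> i\<bar>) = 0" by simp
      then show ?thesis using integral_nonneg_eq_0_iff_AE[OF int] by auto
    qed
    then have "AE x in lebesgue. \<forall>i\<in>Basis. indicator K x * \<bar>(g x - h x) \<bullet> i\<bar> = 0"
      by (intro AE_finite_allI) auto
    then show "AE x in lebesgue. x \<in> K \<longrightarrow> g x = h x"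
      by eventually_elim (auto simp: euclidean_eq_iff[where 'a='a] inner_diff_left)
  qed
qed

section \<open>Local integrability, integration by parts and chain rules\<close>

lemma borel_measurable_lebesgue_on_open:
  fixes \<Omega> :: "'a::euclidean_space set" and f :: "'a \<Rightarrow> real"
  assumes "open \<Omega>"
  shows "f \<in> borel_measurable (lebesgue_on \<Omega>) \<longleftrightarrow> (\<lambda>x. indicator \<Omega> x * f x) \<in> borel_measurable lebesgue"
  using assms by (simp add: borel_measurable_restrict_space_iff)

text \<open>Along an increasing exhaustion by compact sets, the cut-off functions are eventually
  constant at each point.\<close>

lemma locally_integrable_measurable:
  fixes \<Omega> :: "'a::euclidean_space set"
  assumes \<Omega>: "open \<Omega>" and f: "locally_integrable \<Omega> f"
  shows "f \<in> borel_measurable (lebesgue_on \<Omega>)"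
proof -
  obtain C where C: "\<And>n::nat. compact (C n)" "\<And>n. C n \<subseteq> \<Omega>" "\<And>n. C n \<subseteq> interior (C (Suc n))" "\<Union>(range C) = \<Omega>"
    by (rule open_Union_compact_subsets[OF \<Omega>]) (rule that)
  have "C n \<subseteq> C (Suc n)" for n using C(3)[of n] interior_subset by (rule subset_trans)
  then have mono: "C m \<subseteq> C n" if "m \<le> n" for m n
    using that by (rule lift_Suc_mono_le)
  have "(\<lambda>x. indicator \<Omega> x * f x) \<in> borel_measurable lebesgue"
  proof (rule borel_measurable_LIMSEQ_real)
    show "(\<lambda>x. indicator (C n) x * f x) \<in> borel_measurable lebesgue" for n
      using f C(1,2) by (auto simp: locally_integrable_def set_integrable_def)
    show "(\<lambda>n. indicator (C n) x * f x) \<longlonglongrightarrow> indicator \<Omega> x * f x" for x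
    proof (rule tendsto_eventually)
      show "eventually (\<lambda>n. indicator (C n) x * f x = indicator \<Omega> x * f x) sequentially"
      proof (cases "x \<in> \<Omega>")
        case True
        then obtain m where "x \<in> C m" using C(4) by auto
        then have "x \<in> C n" if "m \<le> n" for n using mono that by blast
        then show ?thesis using True unfolding eventually_sequentially by (intro exI[of _ m]) simp
      next
        case False
        then have "x \<notin> C n" for n using C(2) by blast
        with False show ?thesis by simp
      qed
    qed
  qed
  then show ?thesis using \<Omega> by (simp add: borel_measurable_lebesgue_on_open)
qed

lemma locally_integrable_bound:
  fixes \<Omega> :: "'a::euclidean_space set"
  assumes \<Omega>: "open \<Omega>" and f: "locally_integrable \<Omega> f" and h: "h \<in> borel_measurable (lebesgue_on \<Omega>)"
    and le: "\<And>x. x \<in> \<Omega> \<Longrightarrow> \<bar>h x\<bar> \<le> \<bar>f x\<bar>"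
  shows "locally_integrable \<Omega> h"
  unfolding locally_integrable_def set_integrable_def
proof (intro allI impI)
  fix K assume K: "compact K \<and> K \<subseteq> \<Omega>"
  have [measurable]: "K \<in> sets lebesgue" using K by (auto simp: borel_compact)
  have m: "(\<lambda>x. indicator \<Omega> x * h x) \<in> borel_measurable lebesgue"
    using h \<Omega> by (simp add: borel_measurable_lebesgue_on_open)
  have "(\<lambda>x. indicator K x * (indicator \<Omega> x * h x)) \<in> borel_measurable lebesgue"
    using m by measurable
  moreover have "(\<lambda>x. indicator K x * (indicator \<Omega> x * h x)) = (\<lambda>x. indicator K x *\<^sub>R h x)"
    using K by (auto simp: indicator_def fun_eq_iff)
  ultimately have hm: "(\<lambda>x. indicator K x *\<^sub>R h x) \<in> borel_measurable lebesgue" by simp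
  show "integrable lebesgue (\<lambda>x. indicator K x *\<^sub>R h x)"
  proof (rule Bochner_Integration.integrable_bound[OF _ hm])
    show "integrable lebesgue (\<lambda>x. indicator K x *\<^sub>R f x)"
      using f K by (auto simp: locally_integrable_def set_integrable_def)
    show "AE x in lebesgue. norm (indicator K x *\<^sub>R h x) \<le> norm (indicator K x *\<^sub>R f x)"
      using le K by (intro AE_I2) (auto simp: indicator_def)
  qed
qed

lemma locally_integrable_continuous:
  fixes f :: "'a::euclidean_space \<Rightarrow> real"
  assumes "continuous_on UNIV f"
  shows "locally_integrable \<Omega> f"
  unfolding locally_integrable_def set_integrable_def
proof (intro allI impI)
  fix K assume K: "compact K \<and> K \<subseteq> \<Omega>"
  have "integrable lborel (\<lambda>x. indicator K x *\<^sub>R f x)"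
    using K continuous_on_subset[OF assms] by (intro borel_integrable_compact) auto
  then show "integrable lebesgue (\<lambda>x. indicator K x *\<^sub>R f x)"
    by (subst integrable_completion) (auto dest: borel_measurable_integrable)
qed

lemma locally_integrable_add:
  "locally_integrable \<Omega> f \<Longrightarrow> locally_integrable \<Omega> g \<Longrightarrow> locally_integrable \<Omega> (\<lambda>x. f x + g x)"
  by (auto simp: locally_integrable_def intro: set_integral_add(1))

lemma locally_integrable_abs:
  "locally_integrable \<Omega> f \<Longrightarrow> locally_integrable \<Omega> (\<lambda>x. \<bar>f x\<bar>)"
  by (auto simp: locally_integrable_def intro: set_integrable_abs)

text \<open>The product of \<open>v\<close> and the test function is differentiable with bounded
  support, so the integral of its partial derivative is 0. Only one continuous derivative of
  \<open>v\<close> is asked for: the chain rule applies this to compositions with a C^1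
  function.\<close>

lemma integral_C1_test:
  fixes v :: "'a::euclidean_space \<Rightarrow> real"
  assumes \<Omega>: "open \<Omega>" and v: "\<And>x. v differentiable (at x)" "continuous_on UNIV (pd v i)"
    and i: "i \<in> Basis" and \<phi>: "\<phi> \<in> test_functions \<Omega>"
  shows "(LINT x|lebesgue_on \<Omega>. v x * pd \<phi> i x) = - (LINT x|lebesgue_on \<Omega>. pd v i x * \<phi> x)"
proof -
  obtain K where K: "smooth \<phi>" "compact K" "K \<subseteq> \<Omega>" "\<And>x. x \<notin> K \<Longrightarrow> \<phi> x = 0" "\<And>x i. x \<notin> K \<Longrightarrow> pd \<phi> i x = 0"
    using test_functionD[OF \<phi>] by blast
  have cv: "continuous_on UNIV v"
    by (simp add: continuous_at_imp_continuous_on v differentiable_imp_continuous_within)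
  have c: "continuous_on UNIV \<phi>" "continuous_on UNIV (pd \<phi> i)"
    using K(1) i by (auto intro: smooth_continuous_on smooth_pd)
  obtain r where r: "\<And>x. x \<in> K \<Longrightarrow> norm x \<le> r"
    using compact_imp_bounded[OF K(2)] by (auto simp: bounded_iff)
  define f where "f x = v x * \<phi> x" for x
  have pf: "pd f i x = v x * pd \<phi> i x + pd v i x * \<phi> x" for x
    unfolding f_def by (rule pd_mult[OF v(1) smooth_differentiable[OF K(1)]])
  have "integral\<^sup>L lborel (pd f i) = 0"
  proof (rule integral_pd_eq_0[OF _ _ _ i])
    show "f differentiable (at x)" for x
      unfolding f_def by (intro differentiable_mult v smooth_differentiable K)
    show "continuous_on UNIV (pd f i)"
      unfolding pf[abs_def] by (intro continuous_intros c cv v)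
    show "support_bound r f" using r K(4) unfolding support_bound_def f_def by fastforce
  qed
  then have "(LINT x|lebesgue. v x * pd \<phi> i x + pd v i x * \<phi> x) = 0"
    unfolding pf[abs_def]
    by (subst integral_completion) (auto intro!: borel_measurable_continuous_onI continuous_intros c cv v)
  then have "(LINT x|lebesgue_on \<Omega>. v x * pd \<phi> i x + pd v i x * \<phi> x) = 0"
    using lebesgue_on_supported(2)[OF \<Omega> K(3), of "\<lambda>x. v x * pd \<phi> i x + pd v i x * \<phi> x"] K(4,5) by simp
  then show ?thesis
    using integrable_test[OF \<Omega> locally_integrable_continuous \<phi>] v cv i by simp
qed

lemma sum_Basis_inner:
  "i \<in> Basis \<Longrightarrow> (\<Sum>j\<in>Basis. c j *\<^sub>R j) \<bullet> i = c i" for i :: "'a::euclidean_space"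
  by (simp add: inner_sum_left inner_Basis if_distrib cong: if_cong)

lemma smooth_weak_gradient:
  fixes v :: "'a::euclidean_space \<Rightarrow> real"
  assumes "open \<Omega>" "smooth v"
  shows "has_weak_gradient \<Omega> v (\<lambda>x. \<Sum>i\<in>Basis. pd v i x *\<^sub>R i)"
  unfolding has_weak_gradient_pd using assms
  by (auto simp: sum_Basis_inner intro!: integral_C1_test locally_integrable_continuous smooth_continuous_on
      smooth_differentiable smooth_pd)

lemma abs_integral_le:
  fixes f g :: "'a \<Rightarrow> real"
  assumes "integrable M f" "integrable M g" "\<And>x. norm (f x) \<le> g x"
  shows "norm (integral\<^sup>L M f) \<le> integral\<^sup>L M g"
proof -
  have "(LINT x|M. \<bar>f x\<bar>) \<le> integral\<^sup>L M g"
    using assms by (intro integral_mono integrable_abs) simp_all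
  from order_trans[OF integral_abs_bound this] show ?thesis by simp
qed

text \<open>On the compact support of the test function, \<open>u\<close> and its gradient are L^1
  limits of smooth \<open>w n\<close> and their gradients. Integrate by parts for
  \<open>F (w n x)\<close> and pass to the limit: \<open>F\<close> is 1-Lipschitz, and the bounded
  continuous \<open>F'\<close> is handled by dominated convergence.\<close>

lemma weak_gradient_chain:
  fixes \<Omega> :: "'a::euclidean_space set"
  assumes \<Omega>: "open \<Omega>" and u: "has_weak_gradient \<Omega> u g"
    and F: "\<And>s. (F has_real_derivative F' s) (at s)" "continuous_on UNIV F'" "\<And>s. \<bar>F' s\<bar> \<le> 1"
  shows "has_weak_gradient \<Omega> (\<lambda>x. F (u x)) (\<lambda>x. F' (u x) *\<^sub>R g x)"
proof -
  have lu: "locally_integrable \<Omega> u" and lg: "\<And>i. i \<in> Basis \<Longrightarrow> locally_integrable \<Omega> (\<lambda>x. g x \<bullet> i)"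
    using u by (auto simp: has_weak_gradient_def)
  have [measurable]: "u \<in> borel_measurable (lebesgue_on \<Omega>)"
    using locally_integrable_measurable[OF \<Omega> lu] .
  have gm: "(\<lambda>x. g x \<bullet> i) \<in> borel_measurable (lebesgue_on \<Omega>)" if "i \<in> Basis" for i
    using locally_integrable_measurable[OF \<Omega> lg[OF that]] .
  have cF: "continuous_on UNIV F" using F(1) DERIV_continuous_on has_field_derivative_at_within by blast
  have [measurable]: "F \<in> borel_measurable borel" "F' \<in> borel_measurable borel"
    using cF F(2) by (auto intro: borel_measurable_continuous_onI)
  have lip: "\<bar>F s - F t\<bar> \<le> \<bar>s - t\<bar>" for s t
    using field_differentiable_bound[of UNIV F F' 1 s t] F by auto
  have F'_mult_le: "norm (F' s * a * b) \<le> \<bar>a * b\<bar>" for s a b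
  proof -
    have "\<bar>F' s\<bar> * \<bar>a * b\<bar> \<le> 1 * \<bar>a * b\<bar>"
      by (rule mult_right_mono[OF F(3) abs_ge_zero])
    then show ?thesis by (simp only: real_norm_def abs_mult mult.assoc mult_1)
  qed
  have lFu: "locally_integrable \<Omega> (\<lambda>x. F (u x))"
  proof (rule locally_integrable_bound[OF \<Omega>, of "\<lambda>x. \<bar>F 0\<bar> + \<bar>u x\<bar>"])
    show "locally_integrable \<Omega> (\<lambda>x. \<bar>F 0\<bar> + \<bar>u x\<bar>)"
      by (intro locally_integrable_add locally_integrable_abs lu locally_integrable_continuous continuous_intros)
    show "\<bar>F (u x)\<bar> \<le> \<bar>\<bar>F 0\<bar> + \<bar>u x\<bar>\<bar>" for x using lip[of "u x" 0] by simp
  qed measurable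
  have lFg: "locally_integrable \<Omega> (\<lambda>x. F' (u x) * (g x \<bullet> i))" if i: "i \<in> Basis" for i
  proof (rule locally_integrable_bound[OF \<Omega> lg[OF i]])
    show "(\<lambda>x. F' (u x) * (g x \<bullet> i)) \<in> borel_measurable (lebesgue_on \<Omega>)" using gm[OF i] by measurable
    show "\<bar>F' (u x) * (g x \<bullet> i)\<bar> \<le> \<bar>g x \<bullet> i\<bar>" for x
      using mult_right_mono[OF F(3)[of "u x"], of "\<bar>g x \<bullet> i\<bar>"] by (simp add: abs_mult)
  qed
  have "(LINT x|lebesgue_on \<Omega>. F (u x) * pd \<phi> i x) = - (LINT x|lebesgue_on \<Omega>. F' (u x) * (g x \<bullet> i) * \<phi> x)"
    if i: "i \<in> Basis" and \<phi>: "\<phi> \<in> test_functions \<Omega>" for i \<phi>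
  proof -
    obtain K where K: "smooth \<phi>" "compact K" "K \<subseteq> \<Omega>" "\<And>x. x \<notin> K \<Longrightarrow> \<phi> x = 0" "\<And>x i. x \<notin> K \<Longrightarrow> pd \<phi> i x = 0"
      using test_functionD[OF \<phi>] by blast
    obtain r where "\<And>x. x \<in> K \<Longrightarrow> norm x \<le> r"
      using compact_imp_bounded[OF K(2)] by (auto simp: bounded_iff)
    then have sb: "support_bound r \<phi>" "support_bound r (pd \<phi> i)"
      using K(4,5) unfolding support_bound_def by fastforce+
    obtain M1 where M1: "0 < M1" "\<And>x. \<bar>\<phi> x\<bar> \<le> M1"
      using support_bound_bounded[OF smooth_continuous_on[OF K(1)] sb(1)] by blast
    obtain M2 where M2: "0 < M2" "\<And>x. \<bar>pd \<phi> i x\<bar> \<le> M2"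
      using support_bound_bounded[OF smooth_continuous_on[OF smooth_pd[OF K(1) i]] sb(2)] by blast
    have "\<forall>n. \<exists>w. smooth w \<and> (LINT x|lebesgue. indicator K x * \<bar>w x - u x\<bar>) < 1 / Suc n
        \<and> (LINT x|lebesgue. indicator K x * \<bar>pd w i x - g x \<bullet> i\<bar>) < 1 / Suc n"
    proof
      fix n
      show "\<exists>w. smooth w \<and> (LINT x|lebesgue. indicator K x * \<bar>w x - u x\<bar>) < 1 / Suc n
        \<and> (LINT x|lebesgue. indicator K x * \<bar>pd w i x - g x \<bullet> i\<bar>) < 1 / Suc n"
      proof -
        have e: "0 < 1 / real (Suc n)" by simp
        show ?thesis
          by (rule local_smooth_approximation[OF \<Omega> u K(2,3) e zero_less_one]) (use i in blast)
      qed
    qed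
    from choice[OF this] obtain w where w: "\<And>n. smooth (w n)"
        "\<And>n. (LINT x|lebesgue. indicator K x * \<bar>w n x - u x\<bar>) < 1 / Suc n"
        "\<And>n. (LINT x|lebesgue. indicator K x * \<bar>pd (w n) i x - g x \<bullet> i\<bar>) < 1 / Suc n"
      by blast
    define a where "a n x = indicator K x * \<bar>w n x - u x\<bar>" for n x
    define b where "b n x = indicator K x * \<bar>pd (w n) i x - g x \<bullet> i\<bar>" for n x
    have inv0: "(\<lambda>n. 1 / Suc n :: real) \<longlonglongrightarrow> 0"
      using LIMSEQ_inverse_real_of_nat by (simp add: inverse_eq_divide)
    have ai: "integrable lebesgue (a n)" and bi: "integrable lebesgue (b n)" for n
    proof -
      have "locally_integrable \<Omega> (\<lambda>x. \<bar>w n x - u x\<bar>)" "locally_integrable \<Omega> (\<lambda>x. \<bar>pd (w n) i x - g x \<bullet> i\<bar>)"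
        by (intro locally_integrable_abs locally_integrable_diff locally_integrable_continuous
            smooth_continuous_on smooth_pd w lu lg i)+
      then show "integrable lebesgue (a n)" "integrable lebesgue (b n)"
        using K(2,3) by (auto simp: locally_integrable_def set_integrable_def a_def[abs_def] b_def[abs_def])
    qed
    have ann: "0 \<le> a n x" "0 \<le> b n x" for n x by (auto simp: a_def b_def)
    have a0: "(\<lambda>n. integral\<^sup>L lebesgue (a n)) \<longlonglongrightarrow> 0" and b0: "(\<lambda>n. integral\<^sup>L lebesgue (b n)) \<longlonglongrightarrow> 0"
      using w(2,3) ann by (auto intro!: tendsto_sandwich[OF _ _ tendsto_const inv0] always_eventually
          simp: a_def[abs_def] b_def[abs_def] less_imp_le)
    \<comment> \<open>L^1 convergence gives pointwise convergence almost everywhere only along a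
      subsequence, which is all that the limit of \<open>F' (w n x)\<close> requires.\<close>
    obtain q where q: "strict_mono q" "AE x in lebesgue. (\<lambda>n. a (q n) x) \<longlonglongrightarrow> 0"
      using tendsto_L1_AE_subseq[of lebesgue a] ai a0 ann by auto
    have cw: "continuous_on UNIV (\<lambda>x. F (w n x))" for n
      by (rule continuous_on_compose2[OF cF smooth_continuous_on[OF w(1)]]) auto
    have cw': "continuous_on UNIV (\<lambda>x. F' (w n x))" for n
      by (rule continuous_on_compose2[OF F(2) smooth_continuous_on[OF w(1)]]) auto
    have Fw: "((\<lambda>x. F (w n x)) has_derivative (\<lambda>h. F' (w n x) * pd (w n) h x)) (at x)" for n x
      using has_derivative_compose[OF has_derivative_pd[OF smooth_differentiable[OF w(1)[of n]]], of F "\<lambda>h. F' (w n x) * h" x]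
        F(1)[of "w n x"] unfolding has_field_derivative_def by simp
    have pdF: "pd (\<lambda>x. F (w n x)) i = (\<lambda>x. F' (w n x) * pd (w n) i x)" for n
      using pd_eqI[OF Fw] by blast
    have parts: "(LINT x|lebesgue_on \<Omega>. F (w n x) * pd \<phi> i x)
        = - (LINT x|lebesgue_on \<Omega>. F' (w n x) * pd (w n) i x * \<phi> x)" for n
    proof -
      have d: "(\<lambda>x. F (w n x)) differentiable (at x)" for x using Fw unfolding differentiable_def by blast
      have c: "continuous_on UNIV (pd (\<lambda>x. F (w n x)) i)"
        unfolding pdF by (intro continuous_intros cw' smooth_continuous_on smooth_pd w i)
      show ?thesis using integral_C1_test[OF \<Omega> d c i \<phi>] by (simp only: pdF)
    qed
    have l1: "(\<lambda>n. LINT x|lebesgue_on \<Omega>. F (w n x) * pd \<phi> i x) \<longlonglongrightarrow> (LINT x|lebesgue_on \<Omega>. F (u x) * pd \<phi> i x)"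
    proof (rule LIM_zero_cancel, rule Lim_null_comparison[OF always_eventually], rule allI)
      fix n
      have i1: "integrable (lebesgue_on \<Omega>) (\<lambda>x. F (w n x) * pd \<phi> i x)"
        by (rule integrable_test(2)[OF \<Omega> locally_integrable_continuous[OF cw] \<phi> i])
      have i2: "integrable (lebesgue_on \<Omega>) (\<lambda>x. F (u x) * pd \<phi> i x)"
        by (rule integrable_test(2)[OF \<Omega> lFu \<phi> i])
      have "(LINT x|lebesgue_on \<Omega>. F (w n x) * pd \<phi> i x) - (LINT x|lebesgue_on \<Omega>. F (u x) * pd \<phi> i x)
          = (LINT x|lebesgue_on \<Omega>. (F (w n x) - F (u x)) * pd \<phi> i x)"
        using i1 i2 by (simp add: left_diff_distrib)
      also have "\<dots> = (LINT x|lebesgue. (F (w n x) - F (u x)) * pd \<phi> i x)"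
        using K(5) by (intro lebesgue_on_supported(2)[OF \<Omega> K(3)]) simp
      also have "norm \<dots> \<le> (LINT x|lebesgue. M2 * a n x)"
      proof (rule abs_integral_le)
        show "integrable lebesgue (\<lambda>x. (F (w n x) - F (u x)) * pd \<phi> i x)"
          using Bochner_Integration.integrable_diff[OF i1 i2] lebesgue_on_supported(1)[OF \<Omega> K(3), of "\<lambda>x. (F (w n x) - F (u x)) * pd \<phi> i x"] K(5)
          by (simp add: left_diff_distrib)
        show "norm ((F (w n x) - F (u x)) * pd \<phi> i x) \<le> M2 * a n x" for x
        proof (cases "x \<in> K")
          case True
          then show ?thesis using mult_mono[OF lip[of "w n x" "u x"] M2(2)[of x]]
            by (simp add: a_def abs_mult mult.commute)
        qed (simp add: K(5) a_def)
      qed (simp add: ai)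
      finally show "norm ((LINT x|lebesgue_on \<Omega>. F (w n x) * pd \<phi> i x) - (LINT x|lebesgue_on \<Omega>. F (u x) * pd \<phi> i x))
          \<le> M2 * integral\<^sup>L lebesgue (a n)" by simp
    qed (rule tendsto_mult_right_zero[OF a0])
    have i3: "integrable (lebesgue_on \<Omega>) (\<lambda>x. F' (w n x) * (g x \<bullet> i) * \<phi> x)" for n
    proof -
      have "locally_integrable \<Omega> (\<lambda>x. F' (w n x) * (g x \<bullet> i))"
      proof (rule locally_integrable_bound[OF \<Omega> lg[OF i]])
        have "(\<lambda>x. F' (w n x)) \<in> borel_measurable (lebesgue_on \<Omega>)"
          using continuous_lebesgue_measurable[OF cw'] measurable_restrict_space1 by blast
        then show "(\<lambda>x. F' (w n x) * (g x \<bullet> i)) \<in> borel_measurable (lebesgue_on \<Omega>)"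
          using gm[OF i] by measurable
        show "\<bar>F' (w n x) * (g x \<bullet> i)\<bar> \<le> \<bar>g x \<bullet> i\<bar>" for x
          using mult_right_mono[OF F(3)[of "w n x"], of "\<bar>g x \<bullet> i\<bar>"] by (simp add: abs_mult)
      qed
      then show ?thesis by (rule integrable_test(1)[OF \<Omega> _ \<phi>])
    qed
    \<comment> \<open>Both factors of \<open>F' (w n x) * pd (w n) i x\<close> depend on n. The
      gradient is replaced by its limit first, using L^1 convergence and the bound on
      \<open>F'\<close>; afterwards only \<open>F'\<close> varies, under a fixed integrable
      majorant.\<close>
    have l2: "(\<lambda>n. (LINT x|lebesgue_on \<Omega>. F' (w n x) * pd (w n) i x * \<phi> x)
        - (LINT x|lebesgue_on \<Omega>. F' (w n x) * (g x \<bullet> i) * \<phi> x)) \<longlonglongrightarrow> 0"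
    proof (rule Lim_null_comparison[OF always_eventually], rule allI)
      fix n
      let ?d = "\<lambda>x. F' (w n x) * (pd (w n) i x - g x \<bullet> i) * \<phi> x"
      have i1: "integrable (lebesgue_on \<Omega>) (\<lambda>x. F' (w n x) * pd (w n) i x * \<phi> x)"
        by (intro integrable_test(1)[OF \<Omega> locally_integrable_continuous \<phi>] continuous_intros cw'
            smooth_continuous_on smooth_pd w i)
      have "(LINT x|lebesgue_on \<Omega>. F' (w n x) * pd (w n) i x * \<phi> x)
        - (LINT x|lebesgue_on \<Omega>. F' (w n x) * (g x \<bullet> i) * \<phi> x) = (LINT x|lebesgue_on \<Omega>. ?d x)"
        using i1 i3 by (simp add: left_diff_distrib right_diff_distrib)
      also have "\<dots> = (LINT x|lebesgue. ?d x)"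
        using K(4) by (intro lebesgue_on_supported(2)[OF \<Omega> K(3)]) simp
      also have "norm \<dots> \<le> (LINT x|lebesgue. M1 * b n x)"
      proof (rule abs_integral_le)
        show "integrable lebesgue ?d"
          using Bochner_Integration.integrable_diff[OF i1 i3] lebesgue_on_supported(1)[OF \<Omega> K(3), of ?d] K(4)
          by (simp add: left_diff_distrib right_diff_distrib)
        show "norm (?d x) \<le> M1 * b n x" for x
        proof (cases "x \<in> K")
          case True
          have "\<bar>F' (w n x)\<bar> * \<bar>pd (w n) i x - g x \<bullet> i\<bar> * \<bar>\<phi> x\<bar> \<le> 1 * \<bar>pd (w n) i x - g x \<bullet> i\<bar> * M1"
            by (intro mult_mono F M1) auto
          then show ?thesis using True by (simp add: b_def abs_mult mult.commute)
        qed (simp add: K(4) b_def)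
      qed (simp add: bi)
      finally show "norm ((LINT x|lebesgue_on \<Omega>. F' (w n x) * pd (w n) i x * \<phi> x)
        - (LINT x|lebesgue_on \<Omega>. F' (w n x) * (g x \<bullet> i) * \<phi> x)) \<le> M1 * integral\<^sup>L lebesgue (b n)" by simp
    qed (rule tendsto_mult_right_zero[OF b0])
    have l3: "(\<lambda>n. LINT x|lebesgue_on \<Omega>. F' (w (q n) x) * (g x \<bullet> i) * \<phi> x)
        \<longlonglongrightarrow> (LINT x|lebesgue_on \<Omega>. F' (u x) * (g x \<bullet> i) * \<phi> x)"
    proof (rule integral_dominated_convergence[where w="\<lambda>x. \<bar>(g x \<bullet> i) * \<phi> x\<bar>"])
      show "integrable (lebesgue_on \<Omega>) (\<lambda>x. \<bar>(g x \<bullet> i) * \<phi> x\<bar>)"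
        by (rule integrable_abs[OF integrable_test(1)[OF \<Omega> lg[OF i] \<phi>]])
      show "(\<lambda>x. F' (u x) * (g x \<bullet> i) * \<phi> x) \<in> borel_measurable (lebesgue_on \<Omega>)"
        using integrable_test(1)[OF \<Omega> lFg[OF i] \<phi>] by (rule borel_measurable_integrable)
      show "(\<lambda>x. F' (w (q n) x) * (g x \<bullet> i) * \<phi> x) \<in> borel_measurable (lebesgue_on \<Omega>)" for n
        using i3 by (rule borel_measurable_integrable)
      show "AE x in lebesgue_on \<Omega>. norm (F' (w (q n) x) * (g x \<bullet> i) * \<phi> x) \<le> \<bar>(g x \<bullet> i) * \<phi> x\<bar>" for n
      proof (rule AE_I2)
        fix x
        show "norm (F' (w (q n) x) * (g x \<bullet> i) * \<phi> x) \<le> \<bar>(g x \<bullet> i) * \<phi> x\<bar>"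
          by (rule F'_mult_le)
      qed
      have lim: "(\<lambda>n. F' (w (q n) x) * (g x \<bullet> i) * \<phi> x) \<longlonglongrightarrow> F' (u x) * (g x \<bullet> i) * \<phi> x"
        if ax: "(\<lambda>n. a (q n) x) \<longlonglongrightarrow> 0" for x
      proof (cases "x \<in> K")
        case True
        have "(\<lambda>n. \<bar>w (q n) x - u x\<bar>) \<longlonglongrightarrow> 0"
          using ax True by (simp add: a_def)
        then have "(\<lambda>n. w (q n) x - u x) \<longlonglongrightarrow> 0" by (rule tendsto_rabs_zero_cancel)
        then have "(\<lambda>n. w (q n) x) \<longlonglongrightarrow> u x" by (rule LIM_zero_cancel)
        moreover have "isCont F' (u x)" using F(2) by (simp add: continuous_on_eq_continuous_at)
        ultimately have "(\<lambda>n. F' (w (q n) x)) \<longlonglongrightarrow> F' (u x)" by (rule isCont_tendsto_compose[rotated])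
        then show ?thesis by (rule tendsto_mult_right[THEN tendsto_mult_right])
      qed (simp add: K(4))
      have "AE x in lebesgue. (\<lambda>n. F' (w (q n) x) * (g x \<bullet> i) * \<phi> x) \<longlonglongrightarrow> F' (u x) * (g x \<bullet> i) * \<phi> x"
        using q(2) lim by (rule eventually_mono)
      then show "AE x in lebesgue_on \<Omega>. (\<lambda>n. F' (w (q n) x) * (g x \<bullet> i) * \<phi> x) \<longlonglongrightarrow> F' (u x) * (g x \<bullet> i) * \<phi> x"
        using \<Omega> by (subst AE_restrict_space_iff) (auto elim: eventually_mono)
    qed
    have "(\<lambda>n. LINT x|lebesgue_on \<Omega>. F' (w (q n) x) * pd (w (q n)) i x * \<phi> x)
        \<longlonglongrightarrow> 0 + (LINT x|lebesgue_on \<Omega>. F' (u x) * (g x \<bullet> i) * \<phi> x)"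
      using tendsto_add[OF LIMSEQ_subseq_LIMSEQ[OF l2 q(1)] l3] by (simp add: o_def)
    then have "(\<lambda>n. LINT x|lebesgue_on \<Omega>. F (w (q n) x) * pd \<phi> i x)
        \<longlonglongrightarrow> - (LINT x|lebesgue_on \<Omega>. F' (u x) * (g x \<bullet> i) * \<phi> x)"
      unfolding parts by (intro tendsto_minus) simp
    with LIMSEQ_subseq_LIMSEQ[OF l1 q(1)] show ?thesis
      by (auto simp: o_def intro: LIMSEQ_unique)
  qed
  then show ?thesis unfolding has_weak_gradient_pd using lFu lFg by simp
qed

text \<open>A continuously differentiable approximation of the positive part, with derivative in \<open>[0, 1)\<close>;
  one formula for the derivative serves both sides of \<open>0\<close>.\<close>

lemma smooth_positive_part_DERIV:
  fixes a :: real
  assumes "0 < a"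
  shows "((\<lambda>s. (max 0 s)\<^sup>2 / (max 0 s + a)) has_real_derivative 1 - (a / (max 0 s + a))\<^sup>2) (at s)"
proof -
  consider "s > 0" | "s < 0" | "s = 0" by linarith
  then show ?thesis
  proof cases
    case 1
    have "((\<lambda>s. s\<^sup>2 / (s + a)) has_real_derivative (2 * s * (s + a) - s\<^sup>2) / (s + a)\<^sup>2) (at s)"
      using 1 assms by (auto intro!: derivative_eq_intros simp: power2_eq_square)
    moreover have "(2 * s * (s + a) - s\<^sup>2) / (s + a)\<^sup>2 = 1 - (a / (max 0 s + a))\<^sup>2"
    proof -
      have "1 - (a / (s + a))\<^sup>2 = ((s + a)\<^sup>2 - a\<^sup>2) / (s + a)\<^sup>2"
        using 1 assms by (simp add: power_divide diff_divide_distrib)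
      also have "(s + a)\<^sup>2 - a\<^sup>2 = 2 * s * (s + a) - s\<^sup>2" by (simp add: power2_eq_square algebra_simps)
      finally show ?thesis using 1 by simp
    qed
    ultimately have "((\<lambda>s. s\<^sup>2 / (s + a)) has_real_derivative 1 - (a / (max 0 s + a))\<^sup>2) (at s)" by simp
    then show ?thesis
      by (rule has_field_derivative_transform_within_open[where S="{0<..}"]) (use 1 in auto)
  next
    case 2
    have "((\<lambda>s. 0) has_real_derivative 1 - (a / (max 0 s + a))\<^sup>2) (at s)"
      using 2 assms by simp
    then show ?thesis
      by (rule has_field_derivative_transform_within_open[where S="{..<0}"]) (use 2 in auto)
  next
    case 3
    have "((\<lambda>h. ((max 0 (0 + h))\<^sup>2 / (max 0 (0 + h) + a) - (max 0 0)\<^sup>2 / (max 0 0 + a)) / h) \<longlongrightarrow> 0) (at 0)"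
    proof (rule Lim_null_comparison)
      show "((\<lambda>h. \<bar>h\<bar> / a) \<longlongrightarrow> 0) (at 0)"
        using assms by (auto intro!: tendsto_eq_intros)
      show "eventually (\<lambda>h. norm (((max 0 (0 + h))\<^sup>2 / (max 0 (0 + h) + a) - (max 0 0)\<^sup>2 / (max 0 0 + a)) / h) \<le> \<bar>h\<bar> / a) (at 0)"
      proof (rule always_eventually, rule allI)
        fix h
        show "norm (((max 0 (0 + h))\<^sup>2 / (max 0 (0 + h) + a) - (max 0 0)\<^sup>2 / (max 0 0 + a)) / h) \<le> \<bar>h\<bar> / a"
        proof (cases "h > 0")
          case True
          have "h / (h + a) \<le> h / a" using True assms by (intro divide_left_mono) auto
          then show ?thesis using True assms by (simp add: power2_eq_square)
        next
          case False
          then have "max 0 (0 + h) = 0" by simp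
          then have z: "((max 0 (0 + h))\<^sup>2 / (max 0 (0 + h) + a) - (max 0 0)\<^sup>2 / (max 0 0 + a)) / h = 0"
            by simp
          show ?thesis unfolding z using divide_nonneg_pos[OF abs_ge_zero assms, of h] by (simp only: norm_zero)
        qed
      qed
    qed
    then show ?thesis using assms unfolding DERIV_def 3 by simp
  qed
qed

text \<open>Apply the chain rule to the regularised positive parts and let the parameter tend to 0.
  Their derivatives vanish for every s \<le> 0, including 0, so they converge at every point to the
  indicator of s > 0. Thus the gradient 0 on \<open>u x = 0\<close> comes out of the formula without
  a null-set argument.\<close>

lemma weak_gradient_positive_part:
  fixes \<Omega> :: "'a::euclidean_space set"
  assumes \<Omega>: "open \<Omega>" and u: "has_weak_gradient \<Omega> u g"
  shows "has_weak_gradient \<Omega> (\<lambda>x. max 0 (u x)) (\<lambda>x. if 0 < u x then g x else 0)"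
proof -
  define a where "a n = 1 / real (Suc n)" for n
  have a: "0 < a n" for n by (simp add: a_def)
  have a0: "a \<longlonglongrightarrow> 0" using LIMSEQ_inverse_real_of_nat by (simp add: a_def[abs_def] inverse_eq_divide)
  define F where "F n s = (max 0 s)\<^sup>2 / (max 0 s + a n)" for n s
  define F' where "F' n s = 1 - (a n / (max 0 s + a n))\<^sup>2" for n s
  have F'01: "0 \<le> F' n s" "F' n s \<le> 1" for n s
  proof -
    have "(a n / (max 0 s + a n))\<^sup>2 \<le> 1"
      using a[of n] by (intro power_le_one) (auto simp: divide_le_eq)
    then show "0 \<le> F' n s" "F' n s \<le> 1" by (auto simp: F'_def)
  qed
  have F_le: "0 \<le> F n s" "F n s \<le> \<bar>s\<bar>" for n s
  proof -
    show "0 \<le> F n s" using a[of n] by (auto simp: F_def intro!: divide_nonneg_pos add_nonneg_pos)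
    have "F n s = max 0 s * (max 0 s / (max 0 s + a n))" by (simp add: F_def power2_eq_square)
    also have "\<dots> \<le> max 0 s" using a[of n] by (intro mult_right_le_one_le) (auto simp: divide_le_eq)
    finally show "F n s \<le> \<bar>s\<bar>" by simp
  qed
  have pos: "max 0 s + a n \<noteq> 0" for n s using a[of n] by (simp add: max_def) 
  have chain: "has_weak_gradient \<Omega> (\<lambda>x. F n (u x)) (\<lambda>x. F' n (u x) *\<^sub>R g x)" for n
  proof (rule weak_gradient_chain[OF \<Omega> u])
    show "(F n has_real_derivative F' n s) (at s)" for s
      unfolding F_def[abs_def] F'_def by (rule smooth_positive_part_DERIV[OF a])
    show "continuous_on UNIV (F' n)"
      unfolding F'_def[abs_def] using pos by (intro continuous_intros) auto
    show "\<bar>F' n s\<bar> \<le> 1" for s using F'01[of n s] by simp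
  qed
  have Flim: "(\<lambda>n. F n s) \<longlonglongrightarrow> max 0 s" for s
  proof (cases "0 < s")
    case True
    then have "(\<lambda>n. F n s) \<longlonglongrightarrow> (max 0 s)\<^sup>2 / (max 0 s + 0)"
      unfolding F_def by (intro tendsto_intros a0) auto
    then show ?thesis using True by (simp add: power2_eq_square)
  qed (simp add: F_def max_def)
  have F'lim: "(\<lambda>n. F' n s) \<longlonglongrightarrow> (if 0 < s then 1 else 0)" for s
  proof (cases "0 < s")
    case True
    then have "(\<lambda>n. F' n s) \<longlonglongrightarrow> 1 - (0 / (max 0 s + 0))\<^sup>2"
      unfolding F'_def by (intro tendsto_intros a0) auto
    then show ?thesis using True by simp
  qed (use a in \<open>simp add: F'_def max_def less_imp_neq[symmetric]\<close>)
  have lu: "locally_integrable \<Omega> u" and lg: "\<And>i. i \<in> Basis \<Longrightarrow> locally_integrable \<Omega> (\<lambda>x. g x \<bullet> i)"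
    using u by (auto simp: has_weak_gradient_def)
  have um[measurable]: "u \<in> borel_measurable (lebesgue_on \<Omega>)"
    using locally_integrable_measurable[OF \<Omega> lu] .
  have lp: "locally_integrable \<Omega> (\<lambda>x. max 0 (u x))"
  proof (rule locally_integrable_bound[OF \<Omega> lu])
    show "(\<lambda>x. max 0 (u x)) \<in> borel_measurable (lebesgue_on \<Omega>)" by measurable
  qed auto
  have gp: "(if 0 < u x then g x else 0) \<bullet> i = (if 0 < u x then g x \<bullet> i else 0)" for x i by simp
  have lgp: "locally_integrable \<Omega> (\<lambda>x. if 0 < u x then g x \<bullet> i else 0)" if i: "i \<in> Basis" for i
  proof (rule locally_integrable_bound[OF \<Omega> lg[OF i]])
    note [measurable] = locally_integrable_measurable[OF \<Omega> lg[OF i]]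
    show "(\<lambda>x. if 0 < u x then g x \<bullet> i else 0) \<in> borel_measurable (lebesgue_on \<Omega>)" by measurable
  qed auto
  have "(LINT x|lebesgue_on \<Omega>. max 0 (u x) * pd \<phi> i x) = - (LINT x|lebesgue_on \<Omega>. (if 0 < u x then g x \<bullet> i else 0) * \<phi> x)"
    if i: "i \<in> Basis" and \<phi>: "\<phi> \<in> test_functions \<Omega>" for i \<phi>
  proof -
    have l1: "(\<lambda>n. LINT x|lebesgue_on \<Omega>. F n (u x) * pd \<phi> i x) \<longlonglongrightarrow> (LINT x|lebesgue_on \<Omega>. max 0 (u x) * pd \<phi> i x)"
    proof (rule integral_dominated_convergence[where w="\<lambda>x. \<bar>u x * pd \<phi> i x\<bar>"])
      show "integrable (lebesgue_on \<Omega>) (\<lambda>x. \<bar>u x * pd \<phi> i x\<bar>)"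
        by (rule integrable_abs[OF integrable_test(2)[OF \<Omega> lu \<phi> i]])
      show "(\<lambda>x. max 0 (u x) * pd \<phi> i x) \<in> borel_measurable (lebesgue_on \<Omega>)"
        using integrable_test(2)[OF \<Omega> lp \<phi> i] by (rule borel_measurable_integrable)
      show "(\<lambda>x. F n (u x) * pd \<phi> i x) \<in> borel_measurable (lebesgue_on \<Omega>)" for n
        using integrable_test(2)[OF \<Omega> _ \<phi> i, of "\<lambda>x. F n (u x)"] chain[of n]
        by (intro borel_measurable_integrable) (simp add: has_weak_gradient_def)
      show "AE x in lebesgue_on \<Omega>. (\<lambda>n. F n (u x) * pd \<phi> i x) \<longlonglongrightarrow> max 0 (u x) * pd \<phi> i x"
        by (intro AE_I2 tendsto_intros Flim)
      show "AE x in lebesgue_on \<Omega>. norm (F n (u x) * pd \<phi> i x) \<le> \<bar>u x * pd \<phi> i x\<bar>" for n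
        using F_le by (intro AE_I2) (auto simp: abs_mult intro!: mult_right_mono)
    qed
    have l2: "(\<lambda>n. LINT x|lebesgue_on \<Omega>. (F' n (u x) *\<^sub>R g x \<bullet> i) * \<phi> x)
        \<longlonglongrightarrow> (LINT x|lebesgue_on \<Omega>. (if 0 < u x then g x \<bullet> i else 0) * \<phi> x)"
    proof (rule integral_dominated_convergence[where w="\<lambda>x. \<bar>(g x \<bullet> i) * \<phi> x\<bar>"])
      show "integrable (lebesgue_on \<Omega>) (\<lambda>x. \<bar>(g x \<bullet> i) * \<phi> x\<bar>)"
        by (rule integrable_abs[OF integrable_test(1)[OF \<Omega> lg[OF i] \<phi>]])
      show "(\<lambda>x. (if 0 < u x then g x \<bullet> i else 0) * \<phi> x) \<in> borel_measurable (lebesgue_on \<Omega>)"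
        using integrable_test(1)[OF \<Omega> lgp[OF i] \<phi>] by (rule borel_measurable_integrable)
      show "(\<lambda>x. (F' n (u x) *\<^sub>R g x \<bullet> i) * \<phi> x) \<in> borel_measurable (lebesgue_on \<Omega>)" for n
        using integrable_test(1)[OF \<Omega> _ \<phi>, of "\<lambda>x. F' n (u x) *\<^sub>R g x \<bullet> i"] chain[of n] i
        by (intro borel_measurable_integrable) (simp add: has_weak_gradient_def)
      have eq: "((if 0 < u x then 1 else 0) *\<^sub>R g x) \<bullet> i = (if 0 < u x then g x \<bullet> i else 0)" for x by simp
      have "(\<lambda>n. (F' n (u x) *\<^sub>R g x \<bullet> i) * \<phi> x) \<longlonglongrightarrow> ((if 0 < u x then 1 else 0) *\<^sub>R g x \<bullet> i) * \<phi> x" for x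
        by (intro tendsto_intros F'lim)
      then show "AE x in lebesgue_on \<Omega>. (\<lambda>n. (F' n (u x) *\<^sub>R g x \<bullet> i) * \<phi> x) \<longlonglongrightarrow> (if 0 < u x then g x \<bullet> i else 0) * \<phi> x"
        unfolding eq by (intro AE_I2)
      show "AE x in lebesgue_on \<Omega>. norm ((F' n (u x) *\<^sub>R g x \<bullet> i) * \<phi> x) \<le> \<bar>(g x \<bullet> i) * \<phi> x\<bar>" for n
        using F'01 by (intro AE_I2) (auto simp: abs_mult mult.assoc intro!: mult_left_le_one_le)
    qed
    have "(LINT x|lebesgue_on \<Omega>. F n (u x) * pd \<phi> i x) = - (LINT x|lebesgue_on \<Omega>. (F' n (u x) *\<^sub>R g x \<bullet> i) * \<phi> x)" for n
      using chain[of n] i \<phi> unfolding has_weak_gradient_pd by blast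
    with l1 tendsto_minus[OF l2] show ?thesis by (auto intro: LIMSEQ_unique)
  qed
  then show ?thesis unfolding has_weak_gradient_pd gp using lp lgp by blast
qed

section \<open>Approximation by functions with compact support\<close>

text \<open>Averaging over a kernel of radius \<open>r\<close> moves a 1-Lipschitz function by at
  most \<open>r\<close> and leaves it 1-Lipschitz; partial derivatives, as limits of difference
  quotients, are then bounded by 1. Bounded support makes \<open>D\<close> integrable, so that
  \<open>conv\<close> applies.\<close>

lemma Lipschitz_smooth_approximation:
  fixes D :: "'a::euclidean_space \<Rightarrow> real"
  assumes lip: "\<And>x y. \<bar>D x - D y\<bar> \<le> dist x y" and supp: "support_bound R D" and r: "0 < r"
  obtains \<psi> where "smooth \<psi>" "\<And>x. \<bar>\<psi> x - D x\<bar> \<le> r" "\<And>i x. i \<in> Basis \<Longrightarrow> \<bar>pd \<psi> i x\<bar> \<le> 1"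
proof -
  have cD: "continuous_on UNIV D"
  proof (rule continuous_onI)
    fix x and e :: real assume "0 < e"
    then show "\<exists>d>0. \<forall>x'\<in>UNIV. dist x' x < d \<longrightarrow> dist (D x') (D x) \<le> e"
      by (intro exI[of _ e]) (auto simp: dist_real_def intro!: less_imp_le order.strict_trans1[OF lip])
  qed
  have iD: "integrable lborel D" using cD supp by (rule integrable_support_bound)
  obtain \<rho> :: "'a \<Rightarrow> real" where \<rho>: "smooth \<rho>" "\<And>x. 0 \<le> \<rho> x" "\<And>x. \<rho> x \<noteq> 0 \<Longrightarrow> norm x < r" "integrable lborel \<rho>" "integral\<^sup>L lborel \<rho> = 1"
    using mollifier_exists[OF r] by metis
  have sup: "support_bound r \<rho>" using \<rho>(3) by (auto simp: support_bound_def intro: less_imp_le)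
  have cont: "continuous_on UNIV \<rho>" using \<rho>(1) by (rule smooth_continuous_on)
  have [measurable]: "\<rho> \<in> borel_measurable borel" "D \<in> borel_measurable borel"
    using cont cD by (auto intro: borel_measurable_continuous_onI)
  define \<psi> where "\<psi> = conv \<rho> D"
  have sm: "smooth \<psi>" unfolding \<psi>_def by (rule smooth_conv[OF \<rho>(1) sup iD])
  have flip: "\<psi> x = (LINT y|lborel. \<rho> y * D (x - y))" for x
    unfolding \<psi>_def by (rule conv_flip) measurable
  have int: "integrable lborel (\<lambda>y. \<rho> y * D (x - y))" for x
    using integrable_reflect[OF integrable_conv_kernel[OF cont sup iD, of x], of x] by simp
  have close: "\<bar>\<psi> x - D x\<bar> \<le> r" for x
  proof -
    have "\<psi> x - D x = (LINT y|lborel. \<rho> y * D (x - y) - \<rho> y * D x)"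
      using int \<rho>(4,5) by (simp add: flip)
    also have "norm \<dots> \<le> (LINT y|lborel. r * \<rho> y)"
    proof (rule abs_integral_le)
      show "norm (\<rho> y * D (x - y) - \<rho> y * D x) \<le> r * \<rho> y" for y
      proof (cases "\<rho> y = 0")
        case False
        have "\<bar>D (x - y) - D x\<bar> \<le> r" using lip[of "x - y" x] \<rho>(3)[OF False] by (simp add: dist_norm)
        from mult_left_mono[OF this \<rho>(2)[of y]] show ?thesis
          using \<rho>(2)[of y] unfolding right_diff_distrib[symmetric] real_norm_def abs_mult by (simp add: mult.commute)
      qed simp
    qed (use int \<rho>(4) in auto)
    finally show ?thesis using \<rho>(5) by simp
  qed
  have lip\<psi>: "\<bar>\<psi> x - \<psi> x'\<bar> \<le> dist x x'" for x x'
  proof -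
    have "\<psi> x - \<psi> x' = (LINT y|lborel. \<rho> y * D (x - y) - \<rho> y * D (x' - y))"
      using int by (simp add: flip)
    also have "norm \<dots> \<le> (LINT y|lborel. dist x x' * \<rho> y)"
    proof (rule abs_integral_le)
      show "norm (\<rho> y * D (x - y) - \<rho> y * D (x' - y)) \<le> dist x x' * \<rho> y" for y
      proof -
        have "\<bar>D (x - y) - D (x' - y)\<bar> \<le> dist x x'" using lip[of "x - y" "x' - y"] by (simp add: dist_norm)
        from mult_left_mono[OF this \<rho>(2)[of y]] show ?thesis
          using \<rho>(2)[of y] unfolding right_diff_distrib[symmetric] real_norm_def abs_mult by (simp add: mult.commute)
      qed
    qed (use int \<rho>(4) in auto)
    finally show ?thesis using \<rho>(5) by simp
  qed
  have "\<bar>pd \<psi> i x\<bar> \<le> 1" if i: "i \<in> Basis" for i x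
  proof (rule tendsto_upperbound)
    show "((\<lambda>s. \<bar>(\<psi> (x + s *\<^sub>R i) - \<psi> x) / s\<bar>) \<longlongrightarrow> \<bar>pd \<psi> i x\<bar>) (at 0)"
      by (rule tendsto_rabs[OF pd_difference_quotient[OF smooth_differentiable[OF sm]]])
    have "\<bar>(\<psi> (x + s *\<^sub>R i) - \<psi> x) / s\<bar> \<le> 1" for s
      using lip\<psi>[of "x + s *\<^sub>R i" x] i by (simp add: dist_norm divide_le_eq)
    then show "eventually (\<lambda>s. \<bar>(\<psi> (x + s *\<^sub>R i) - \<psi> x) / s\<bar> \<le> 1) (at 0)" by simp
  qed simp
  with sm close show ?thesis using that by blast
qed

text \<open>Absolute continuity of the integral: \<open>f\<close> is the sum of
  \<open>f x - min (f x) n\<close>, small in L^1 for large n, and a function bounded by n, which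
  contributes at most n times the measure of the set.\<close>

lemma integral_small_sets:
  fixes f :: "'a \<Rightarrow> real"
  assumes "finite_measure M" and f: "integrable M f" "\<And>x. 0 \<le> f x" and e: "0 < e"
  obtains \<delta> where "0 < \<delta>" "\<And>S. S \<in> sets M \<Longrightarrow> measure M S < \<delta> \<Longrightarrow> (LINT x|M. indicator S x * f x) < e"
proof -
  interpret finite_measure M by fact
  have [measurable]: "f \<in> borel_measurable M" using f(1) by simp
  have "(\<lambda>n. LINT x|M. f x - min (f x) (real n)) \<longlonglongrightarrow> (LINT x|M. 0)"
  proof (rule integral_dominated_convergence[where w=f])
    show "AE x in M. (\<lambda>n. f x - min (f x) (real n)) \<longlonglongrightarrow> 0"
    proof (rule AE_I2)
      fix x
      obtain N :: nat where "f x \<le> real N" using real_arch_simple by blast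
      then have "f x - min (f x) (real n) = 0" if "N \<le> n" for n using that by simp
      then have "eventually (\<lambda>n. f x - min (f x) (real n) = 0) sequentially"
        unfolding eventually_sequentially by blast
      then show "(\<lambda>n. f x - min (f x) (real n)) \<longlonglongrightarrow> 0" by (rule tendsto_eventually)
    qed
    show "AE x in M. norm (f x - min (f x) (real n)) \<le> f x" for n
      using f(2) by (intro AE_I2) (simp add: min_def)
  qed (use f in auto)
  then have "(\<lambda>n. LINT x|M. f x - min (f x) (real n)) \<longlonglongrightarrow> 0" by simp
  from order_tendstoD(2)[OF this, of "e / 2"] e obtain n :: nat where
    n: "(LINT x|M. f x - min (f x) (real n)) < e / 2"
    by (auto simp: eventually_sequentially)
  show ?thesis
  proof (rule that[of "e / (2 * (real n + 1))"])
    show "0 < e / (2 * (real n + 1))" using e by simp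
    fix S assume S: "S \<in> sets M" "measure M S < e / (2 * (real n + 1))"
    have iS: "integrable M (\<lambda>x. indicator S x :: real)"
      using S by (intro integrable_real_indicator) (auto simp: emeasure_eq_measure)
    have im: "integrable M (\<lambda>x. f x - min (f x) (real n))" using f(1) by simp
    have "(LINT x|M. indicator S x * f x) \<le> (LINT x|M. (f x - min (f x) (real n)) + real n * indicator S x)"
    proof (rule integral_mono)
      show "integrable M (\<lambda>x. indicator S x * f x)"
        using integrable_mult_indicator[OF S(1) f(1)] by simp
      show "integrable M (\<lambda>x. (f x - min (f x) (real n)) + real n * indicator S x)"
        by (intro Bochner_Integration.integrable_add im integrable_mult_right iS)
      show "indicator S x * f x \<le> (f x - min (f x) (real n)) + real n * indicator S x" for x
        by (simp add: indicator_def min_def)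
    qed
    also have "\<dots> = (LINT x|M. f x - min (f x) (real n)) + real n * measure M S"
      using S iS by (subst Bochner_Integration.integral_add[OF im]) (auto simp: Int_absorb2 sets.sets_into_space)
    also have "real n * measure M S \<le> (real n + 1) * measure M S" by (intro mult_right_mono) auto
    also have "(real n + 1) * measure M S \<le> e / 2" using S(2) by (simp add: field_simps)
    finally show "(LINT x|M. indicator S x * f x) < e" using n by simp
  qed
qed

section \<open>The distance to the boundary and its truncation\<close>

lemma finite_measure_lebesgue_on:
  "\<Omega> \<in> lmeasurable \<Longrightarrow> finite_measure (lebesgue_on \<Omega>)"
  by (intro finite_measureI) (auto simp: emeasure_restrict_space fmeasurable_def)

text \<open>An open set other than the whole space that contains a point has nonempty frontier, and
  the frontier is closed and disjoint from the set. For \<open>\<Omega> = UNIV\<close> the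
  convention for \<open>infdist\<close> to the empty set would give 0.\<close>

lemma boundary_dist_pos:
  assumes "open \<Omega>" "\<Omega> \<noteq> UNIV" "x \<in> \<Omega>"
  shows "0 < boundary_dist \<Omega> x"
proof -
  have "frontier \<Omega> \<noteq> {}" using assms frontier_eq_empty[of \<Omega>] by auto
  moreover have "x \<notin> frontier \<Omega>" using assms frontier_disjoint_eq[of \<Omega>] by auto
  ultimately have "infdist x (frontier \<Omega>) \<noteq> 0"
    using in_closed_iff_infdist_zero[OF frontier_closed] by blast
  then show ?thesis using infdist_nonneg[of x "frontier \<Omega>"] by (simp add: boundary_dist_def)
qed

lemma boundary_dist_Lipschitz: "\<bar>boundary_dist \<Omega> x - boundary_dist \<Omega> y\<bar> \<le> dist x y"
  unfolding boundary_dist_def using infdist_triangle_abs by blast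

text \<open>A limit point outside \<open>\<Omega>\<close> would lie on the frontier, at distance 0;
  so the set does not change when \<open>\<Omega>\<close> is replaced by its closure.\<close>

lemma boundary_layer_compact:
  assumes "open \<Omega>" "0 < \<epsilon>"
  shows "compact {x \<in> \<Omega>. \<epsilon> \<le> boundary_dist \<Omega> x \<and> norm x \<le> R}"
proof -
  have "{x \<in> \<Omega>. \<epsilon> \<le> boundary_dist \<Omega> x \<and> norm x \<le> R} = closure \<Omega> \<inter> {x. \<epsilon> \<le> boundary_dist \<Omega> x} \<inter> cball 0 R"
  proof (intro equalityI subsetI)
    fix x assume x: "x \<in> closure \<Omega> \<inter> {x. \<epsilon> \<le> boundary_dist \<Omega> x} \<inter> cball 0 R"
    have "x \<in> \<Omega>"
    proof (rule ccontr)
      assume "x \<notin> \<Omega>"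
      then have "x \<in> frontier \<Omega>" using x \<open>open \<Omega>\<close> by (simp add: frontier_def interior_open)
      then have "boundary_dist \<Omega> x = 0" by (simp add: boundary_dist_def)
      then show False using x \<open>0 < \<epsilon>\<close> by simp
    qed
    then show "x \<in> {x \<in> \<Omega>. \<epsilon> \<le> boundary_dist \<Omega> x \<and> norm x \<le> R}" using x by simp
  qed (use closure_subset in auto)
  moreover have "closed {x. \<epsilon> \<le> boundary_dist \<Omega> x}"
    unfolding boundary_dist_def by (intro closed_Collect_le continuous_intros)
  ultimately show ?thesis by (simp add: compact_Int_closed closed_Int_compact closed_Int)
qed

text \<open>Cut-offs by the 1-Lipschitz function m - |x| and by 0 keep the Lipschitz constant 1 and
  give bounded support; at each point of \<open>\<Omega>\<close> the distance itself is recovered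
  for large m.\<close>

definition truncated_dist :: "'a::euclidean_space set \<Rightarrow> nat \<Rightarrow> 'a \<Rightarrow> real" where
  "truncated_dist \<Omega> m x = max 0 (min (boundary_dist \<Omega> x) (real m - norm x))"

lemma truncated_dist_Lipschitz: "\<bar>truncated_dist \<Omega> m x - truncated_dist \<Omega> m y\<bar> \<le> dist x y"
proof -
  have "\<bar>norm x - norm y\<bar> \<le> dist x y" by (simp add: dist_norm norm_triangle_ineq3)
  with boundary_dist_Lipschitz[of \<Omega> x y] show ?thesis
    unfolding truncated_dist_def by (simp add: max_def min_def) linarith
qed

text \<open>Dominated convergence for the indicators; the sets need not be nested.\<close>

lemma measure_tendsto_0:
  assumes "finite_measure M" "\<And>m. B m \<in> sets M" "\<And>x. x \<in> space M \<Longrightarrow> eventually (\<lambda>m. x \<notin> B m) sequentially"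
  shows "(\<lambda>m. measure M (B m)) \<longlonglongrightarrow> 0"
proof -
  interpret finite_measure M by fact
  have "(\<lambda>m. LINT x|M. indicator (B m) x) \<longlonglongrightarrow> (LINT x|M. 0::real)"
  proof (rule integral_dominated_convergence[where w="\<lambda>x. 1"])
    show "AE x in M. (\<lambda>m. indicator (B m) x :: real) \<longlonglongrightarrow> 0"
    proof (rule AE_I2)
      fix x assume "x \<in> space M"
      from assms(3)[OF this] have "eventually (\<lambda>m. indicator (B m) x = (0::real)) sequentially"
        by (rule eventually_mono) simp
      then show "(\<lambda>m. indicator (B m) x :: real) \<longlonglongrightarrow> 0" by (rule tendsto_eventually)
    qed
  qed (use assms(2) in \<open>auto simp: indicator_def\<close>)
  then show ?thesis using assms(2) by (simp add: Int_absorb2 sets.sets_into_space)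
qed

lemma measurable_lebesgue_on_continuous:
  fixes \<psi> :: "'a::euclidean_space \<Rightarrow> real"
  shows "continuous_on UNIV \<psi> \<Longrightarrow> \<psi> \<in> borel_measurable (lebesgue_on \<Omega>)"
  by (intro measurable_restrict_space1 continuous_lebesgue_measurable)

text \<open>The approximant is the positive part of min u \<open>\<psi>\<close>. It differs from the
  positive part of \<open>u\<close> only on \<open>S\<close>, where the error is at most
  \<open>f\<close> plus the gradient bound of \<open>\<psi>\<close>. The choices are made in the
  order: \<open>\<delta>\<close> by absolute continuity, the slope \<open>n\<close> by
  \<open>H\<close>, and the smoothing index \<open>m\<close> depending on \<open>n\<close>.\<close>

lemma positive_part_approximation:
  fixes \<Omega> :: "'a::euclidean_space set"
  assumes \<Omega>: "open \<Omega>" "\<Omega> \<in> lmeasurable" and u: "has_weak_gradient \<Omega> u g"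
    and int: "integrable (lebesgue_on \<Omega>) u" "\<And>i. i \<in> Basis \<Longrightarrow> integrable (lebesgue_on \<Omega>) (\<lambda>x. g x \<bullet> i)"
    and H: "(\<lambda>k. real k * measure (lebesgue_on \<Omega>) {x\<in>\<Omega>. real k * boundary_dist \<Omega> x < \<bar>u x\<bar>}) \<longlonglongrightarrow> 0"
    and e: "0 < e"
  obtains z h K where "has_weak_gradient \<Omega> z h" "compact K" "K \<subseteq> \<Omega>"
    "\<forall>x\<in>\<Omega> - K. z x = 0 \<and> h x = 0"
    "integrable (lebesgue_on \<Omega>) (\<lambda>x. max 0 (u x) - z x)"
    "\<forall>i\<in>Basis. integrable (lebesgue_on \<Omega>) (\<lambda>x. ((if 0 < u x then g x else 0) - h x) \<bullet> i)"
    "(LINT x|lebesgue_on \<Omega>. \<bar>max 0 (u x) - z x\<bar>) < e"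
    "\<forall>i\<in>Basis. (LINT x|lebesgue_on \<Omega>. \<bar>((if 0 < u x then g x else 0) - h x) \<bullet> i\<bar>) < e"
proof -
  let ?M = "lebesgue_on \<Omega>"
  let ?d = "boundary_dist \<Omega>"
  have finM: "finite_measure ?M" using \<Omega>(2) by (rule finite_measure_lebesgue_on)
  interpret finite_measure ?M by fact
  have \<Omega>s[measurable]: "\<Omega> \<in> sets lebesgue" using \<Omega> by auto
  have sp[simp]: "space ?M = \<Omega>" by simp
  have nU: "\<Omega> \<noteq> UNIV"
    using \<Omega>(2) by (auto simp: fmeasurable_def)
  have um[measurable]: "u \<in> borel_measurable ?M" using int(1) by simp
  have dm[measurable]: "?d \<in> borel_measurable ?M"
    unfolding boundary_dist_def by (intro measurable_lebesgue_on_continuous continuous_intros)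
  \<comment> \<open>One majorant for the function and all partial derivatives, so that a single
    small set serves every estimate.\<close>
  define f where "f x = \<bar>u x\<bar> + (\<Sum>i\<in>Basis. \<bar>g x \<bullet> i\<bar>)" for x
  have f: "integrable ?M f" "\<And>x. 0 \<le> f x"
    unfolding f_def using int by (auto intro!: Bochner_Integration.integrable_add Bochner_Integration.integrable_sum integrable_abs add_nonneg_nonneg sum_nonneg)
  obtain \<delta> where \<delta>: "0 < \<delta>" "\<And>S. S \<in> sets ?M \<Longrightarrow> measure ?M S < \<delta> \<Longrightarrow> (LINT x|?M. indicator S x * f x) < e / 2"
    using integral_small_sets[OF finM f, of "e / 2"] e by auto
  \<comment> \<open>A bound for \<open>2 * real n * measure ?M S\<close>: the part
    \<open>e / 2\<close> pays for the gradient of \<open>\<psi>\<close> on \<open>S\<close>, and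
    \<open>\<delta>\<close> makes the integral of \<open>f\<close> over \<open>S\<close>
    small.\<close>
  define \<tau> where "\<tau> = min (e / 2) \<delta>"
  have \<tau>: "0 < \<tau>" "\<tau> \<le> e / 2" "\<tau> \<le> \<delta>" using e \<delta>(1) by (auto simp: \<tau>_def)
  define A where "A k = {x\<in>\<Omega>. real k * ?d x < \<bar>u x\<bar>}" for k
  have Am: "A k \<in> sets ?M" for k
  proof -
    have "{x\<in>space ?M. real k * ?d x < \<bar>u x\<bar>} \<in> sets ?M" by measurable
    then show ?thesis by (simp add: A_def)
  qed
  have "eventually (\<lambda>k. real k * measure ?M (A k) < \<tau> / 4) sequentially"
    using order_tendstoD(2)[OF H, of "\<tau> / 4"] \<tau>(1) by (simp add: A_def)
  from eventually_conj[OF this eventually_ge_at_top[of 1]] obtain n :: nat where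
    n: "real n * measure ?M (A n) < \<tau> / 4" "1 \<le> n"
    unfolding eventually_sequentially by auto
  define T where "T = truncated_dist \<Omega>"
  define eps where "eps m = 1 / real (Suc m)" for m
  have eps: "0 < eps m" for m by (simp add: eps_def)
  have eps0: "eps \<longlonglongrightarrow> 0" using LIMSEQ_inverse_real_of_nat by (simp add: eps_def[abs_def] inverse_eq_divide)
  \<comment> \<open>The set where the eventual approximation of the distance may fall below half of
    it. Of the \<open>3 * eps m\<close>, one is the mollification error and two are the downward
    shift in \<open>\<psi>\<close>.\<close>
  define B where "B m = {x\<in>\<Omega>. T m x - 3 * eps m < ?d x / 2}" for m
  have Tm[measurable]: "T m \<in> borel_measurable ?M" for m
    unfolding T_def truncated_dist_def[abs_def] boundary_dist_def
    by (intro measurable_lebesgue_on_continuous continuous_intros)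
  have Bm: "B m \<in> sets ?M" for m
  proof -
    have "{x\<in>space ?M. T m x - 3 * eps m < ?d x / 2} \<in> sets ?M" by measurable
    then show ?thesis by (simp add: B_def)
  qed
  have "(\<lambda>m. measure ?M (B m)) \<longlonglongrightarrow> 0"
  proof (rule measure_tendsto_0[OF finM Bm])
    fix x assume "x \<in> space ?M"
    then have d: "0 < ?d x" using boundary_dist_pos[OF \<Omega>(1) nU] by simp
    obtain N :: nat where N: "norm x + ?d x \<le> real N" using real_arch_simple by blast
    have "eventually (\<lambda>m. eps m < ?d x / 6) sequentially"
      using order_tendstoD(2)[OF eps0, of "?d x / 6"] d by simp
    with eventually_ge_at_top[of N] show "eventually (\<lambda>m. x \<notin> B m) sequentially"
    proof eventually_elim
      case (elim m)
      then have "?d x \<le> real m - norm x" using N by linarith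
      then have "T m x = ?d x" using d by (simp add: T_def truncated_dist_def)
      then show ?case using elim by (simp add: B_def)
    qed
  qed
  \<comment> \<open>With \<open>n\<close> already fixed, the bound on \<open>B m\<close> may depend
    on it; \<open>A n\<close> and \<open>B m\<close> then each contribute \<open>\<tau> / 2\<close>
    to twice \<open>n\<close> times the measure.\<close>
  moreover have "0 < \<tau> / (4 * real n)" using \<tau>(1) n(2) by simp
  ultimately have "eventually (\<lambda>m. measure ?M (B m) < \<tau> / (4 * real n)) sequentially"
    by (rule order_tendstoD(2))
  then obtain m where m: "measure ?M (B m) < \<tau> / (4 * real n)"
    unfolding eventually_sequentially by auto
  have "support_bound (real m) (T m)"
    by (auto simp: support_bound_def T_def truncated_dist_def max_def split: if_splits)
  then obtain \<theta> where \<theta>: "smooth \<theta>" "\<And>x. \<bar>\<theta> x - T m x\<bar> \<le> eps m" "\<And>i x. i \<in> Basis \<Longrightarrow> \<bar>pd \<theta> i x\<bar> \<le> 1"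
    using Lipschitz_smooth_approximation[of "T m" "real m" "eps m"] truncated_dist_Lipschitz[of \<Omega> m] eps
    unfolding T_def by metis
  \<comment> \<open>The factor 2 turns half the distance, valid off \<open>B m\<close>, into
    \<open>\<psi> x \<ge> real n * ?d x\<close>. The shift exceeds the mollification error by
    \<open>eps m\<close>, so \<open>\<psi>\<close> can be positive in \<open>\<Omega>\<close> only
    where the truncated distance exceeds \<open>eps m\<close>.\<close>
  define \<psi> where "\<psi> x = (2 * real n) * (\<theta> x - 2 * eps m)" for x
  have s\<psi>: "smooth \<psi>" unfolding \<psi>_def[abs_def] by (intro smooth_mult smooth_diff smooth_const \<theta>)
  have pd\<psi>: "\<bar>pd \<psi> i x\<bar> \<le> 2 * real n" if "i \<in> Basis" for i x
  proof -
    have d: "(\<lambda>x. \<theta> x - 2 * eps m) differentiable (at x)"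
      by (intro smooth_differentiable smooth_diff smooth_const \<theta>)
    have c: "(\<lambda>_. 2 * eps m) differentiable (at x)" by simp
    have "pd (\<lambda>_::'a. 2 * eps m) i x = 0" by (rule pd_eqI) simp
    then have "pd \<psi> i x = 2 * real n * pd \<theta> i x"
      unfolding \<psi>_def[abs_def] using pd_cmult[OF d] pd_diff[OF smooth_differentiable[OF \<theta>(1)] c] by simp
    then show ?thesis using \<theta>(3)[OF that, of x] by (simp add: abs_mult mult_left_le)
  qed
  define G where "G x = (\<Sum>i\<in>Basis. pd \<psi> i x *\<^sub>R i)" for x
  have G: "has_weak_gradient \<Omega> \<psi> G" unfolding G_def[abs_def] by (rule smooth_weak_gradient[OF \<Omega>(1) s\<psi>])
  have Gi: "\<bar>G x \<bullet> i\<bar> \<le> 2 * real n" if "i \<in> Basis" for i x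
    using pd\<psi>[OF that] that by (simp add: G_def sum_Basis_inner)
  have [measurable]: "\<psi> \<in> borel_measurable ?M"
    using smooth_continuous_on[OF s\<psi>] by (rule measurable_lebesgue_on_continuous)
  \<comment> \<open>\<open>v\<close> is \<open>min u \<psi>\<close>, written so that the weak gradient is \<open>g\<close>, not \<open>G\<close>, where \<open>u = \<psi>\<close>.\<close>
  define v where "v x = u x - max 0 (u x - \<psi> x)" for x
  define gv where "gv x = g x - (if 0 < u x - \<psi> x then g x - G x else 0)" for x
  have gv: "has_weak_gradient \<Omega> v gv"
    unfolding v_def[abs_def] gv_def[abs_def]
    by (rule has_weak_gradient_diff[OF \<Omega>(1) u weak_gradient_positive_part[OF \<Omega>(1) has_weak_gradient_diff[OF \<Omega>(1) u G]]])
  define z where "z x = max 0 (v x)" for x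
  define h where "h x = (if 0 < v x then gv x else 0)" for x
  have zh: "has_weak_gradient \<Omega> z h"
    unfolding z_def[abs_def] h_def[abs_def] by (rule weak_gradient_positive_part[OF \<Omega>(1) gv])
  define K where "K = {x \<in> \<Omega>. eps m \<le> ?d x \<and> norm x \<le> real m}"
  have K: "compact K" "K \<subseteq> \<Omega>" using boundary_layer_compact[OF \<Omega>(1) eps] by (auto simp: K_def)
  \<comment> \<open>\<open>\<psi>\<close> may well be positive outside \<open>\<Omega>\<close>,
    where the distance to the frontier is positive too; this is why \<open>K\<close> and the claim
    are confined to \<open>\<Omega>\<close>.\<close>
  have zero: "z x = 0 \<and> h x = 0" if x: "x \<in> \<Omega> - K" for x
  proof -
    have "v x \<le> 0"
    proof (rule ccontr)
      assume "\<not> v x \<le> 0"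
      then have "0 < \<psi> x" by (auto simp: v_def max_def split: if_splits)
      then have "2 * eps m < \<theta> x" using n(2) by (simp add: \<psi>_def zero_less_mult_iff)
      then have "eps m < T m x" using \<theta>(2)[of x] by linarith
      then have "x \<in> K" using x eps[of m] by (auto simp: K_def T_def truncated_dist_def max_def split: if_splits)
      then show False using x by simp
    qed
    then show ?thesis by (simp add: z_def h_def)
  qed
  define S where "S = {x\<in>\<Omega>. 0 < u x \<and> \<psi> x < u x}"
  have Sm: "S \<in> sets ?M"
  proof -
    have "{x\<in>space ?M. 0 < u x \<and> \<psi> x < u x} \<in> sets ?M" by measurable
    then show ?thesis by (simp add: S_def)
  qed
  \<comment> \<open>Off \<open>B m\<close> the cut-off is at least \<open>real n * ?d x\<close>, so
    exceeding it puts a point into the level set controlled by \<open>H\<close>.\<close>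
  have "S \<subseteq> A n \<union> B m"
  proof
    fix x assume x: "x \<in> S"
    show "x \<in> A n \<union> B m"
    proof (cases "x \<in> B m")
      case False
      then have "?d x / 2 \<le> T m x - 3 * eps m" using x by (auto simp: B_def S_def)
      also have "\<dots> \<le> \<theta> x - 2 * eps m" using \<theta>(2)[of x] by linarith
      finally have "2 * real n * (?d x / 2) \<le> \<psi> x" unfolding \<psi>_def by (intro mult_left_mono) auto
      then have "x \<in> A n" using x by (auto simp: A_def S_def)
      then show ?thesis by simp
    qed simp
  qed
  then have "measure ?M S \<le> measure ?M (A n \<union> B m)"
    using Am Bm by (intro finite_measure_mono) auto
  also have "\<dots> \<le> measure ?M (A n) + measure ?M (B m)" by (rule measure_Un_le[OF Am Bm])
  finally have "2 * real n * measure ?M S \<le> 2 * real n * (measure ?M (A n) + measure ?M (B m))"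
    by (intro mult_left_mono) auto
  also have "\<dots> < \<tau>"
  proof -
    have "real n * measure ?M (B m) < \<tau> / 4" using m n(2) by (simp add: field_simps)
    then show ?thesis using n(1) by (simp add: algebra_simps)
  qed
  finally have nS: "2 * real n * measure ?M S < \<tau>" .
  \<comment> \<open>As \<open>n\<close> is at least 1, the weighted bound also controls the measure
    itself.\<close>
  have "measure ?M S \<le> 2 * real n * measure ?M S"
    using n(2) mult_right_mono[of 1 "2 * real n" "measure ?M S"] by simp
  then have "measure ?M S < \<delta>" using nS \<tau>(3) by linarith
  from \<delta>(2)[OF Sm this] have fS: "(LINT x|?M. indicator S x * f x) < e / 2" .
  have iS: "integrable ?M (\<lambda>x. indicator S x * f x)"
    using integrable_mult_indicator[OF Sm f(1)] by simp
  have iSc: "integrable ?M (\<lambda>x. indicator S x * f x + 2 * real n * indicator S x)"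
    using Sm by (intro Bochner_Integration.integrable_add[OF iS] integrable_mult_right integrable_real_indicator)
      (auto simp: emeasure_eq_measure)
  have SM: "(LINT x|?M. indicator S x * f x + 2 * real n * indicator S x) < e"
  proof -
    have "(LINT x|?M. indicator S x * f x + 2 * real n * indicator S x)
        = (LINT x|?M. indicator S x * f x) + 2 * real n * measure ?M S"
      using Sm by (subst Bochner_Integration.integral_add[OF iS])
        (auto simp: Int_absorb2 sets.sets_into_space S_def emeasure_eq_measure intro!: integrable_real_indicator)
    then show ?thesis using fS nS \<tau>(2) by linarith
  qed
  have small: "integrable ?M q \<and> (LINT x|?M. \<bar>q x\<bar>) < e"
    if qm: "q \<in> borel_measurable ?M" and q: "\<And>x. x \<in> \<Omega> \<Longrightarrow> \<bar>q x\<bar> \<le> indicator S x * f x + 2 * real n * indicator S x" for q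
  proof
    show qi: "integrable ?M q"
      by (rule Bochner_Integration.integrable_bound[OF iSc qm]) (use order_trans[OF q abs_ge_self] in \<open>auto intro!: AE_I2\<close>)
    have "(LINT x|?M. \<bar>q x\<bar>) \<le> (LINT x|?M. indicator S x * f x + 2 * real n * indicator S x)"
      using q by (intro integral_mono integrable_abs qi iSc) simp
    then show "(LINT x|?M. \<bar>q x\<bar>) < e" using SM by simp
  qed
  have fge: "\<bar>u x\<bar> \<le> f x" "i \<in> Basis \<Longrightarrow> \<bar>g x \<bullet> i\<bar> \<le> f x" for x i
  proof -
    have s: "i \<in> Basis \<Longrightarrow> \<bar>g x \<bullet> i\<bar> \<le> (\<Sum>i\<in>Basis. \<bar>g x \<bullet> i\<bar>)"
      by (rule member_le_sum) auto
    show "\<bar>u x\<bar> \<le> f x" by (simp add: f_def sum_nonneg)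
    show "i \<in> Basis \<Longrightarrow> \<bar>g x \<bullet> i\<bar> \<le> f x" using s by (simp add: f_def add_increasing)
  qed
  have offS: "z x = max 0 (u x) \<and> h x = (if 0 < u x then g x else 0)" if "x \<in> \<Omega>" "x \<notin> S" for x
  proof (cases "0 < u x")
    case True
    then have "u x \<le> \<psi> x" using that by (auto simp: S_def)
    then show ?thesis using True by (simp add: z_def h_def v_def gv_def)
  next
    case False
    then show ?thesis by (simp add: z_def h_def v_def max_def)
  qed
  have onS: "0 < u x" "z x = max 0 (\<psi> x)" "\<psi> x < u x" "h x = (if 0 < \<psi> x then G x else 0)" if "x \<in> S" for x
    using that by (auto simp: S_def z_def h_def v_def gv_def)
  have mz: "z \<in> borel_measurable ?M" "\<And>i. i \<in> Basis \<Longrightarrow> (\<lambda>x. h x \<bullet> i) \<in> borel_measurable ?M"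
    using zh locally_integrable_measurable[OF \<Omega>(1)] unfolding has_weak_gradient_def by blast+
  have mg: "(\<lambda>x. (if 0 < u x then g x else 0) \<bullet> i) \<in> borel_measurable ?M" if "i \<in> Basis" for i
    using weak_gradient_positive_part[OF \<Omega>(1) u] that locally_integrable_measurable[OF \<Omega>(1)] unfolding has_weak_gradient_def by blast
  have 1: "integrable ?M (\<lambda>x. max 0 (u x) - z x) \<and> (LINT x|?M. \<bar>max 0 (u x) - z x\<bar>) < e"
  proof (rule small)
    show "(\<lambda>x. max 0 (u x) - z x) \<in> borel_measurable ?M" using mz(1) by measurable
    fix x assume x: "x \<in> \<Omega>"
    show "\<bar>max 0 (u x) - z x\<bar> \<le> indicator S x * f x + 2 * real n * indicator S x"
    proof (cases "x \<in> S")
      case True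
      have "\<bar>max 0 (u x) - z x\<bar> \<le> \<bar>u x\<bar>" using onS[OF True] by (auto simp: max_def)
      then show ?thesis using True fge(1)[of x] by simp
    qed (use offS[OF x] in simp)
  qed
  have 2: "integrable ?M (\<lambda>x. ((if 0 < u x then g x else 0) - h x) \<bullet> i) \<and>
      (LINT x|?M. \<bar>((if 0 < u x then g x else 0) - h x) \<bullet> i\<bar>) < e" if i: "i \<in> Basis" for i
  proof (rule small)
    show "(\<lambda>x. ((if 0 < u x then g x else 0) - h x) \<bullet> i) \<in> borel_measurable ?M"
      unfolding inner_diff_left using mg[OF i] mz(2)[OF i] by (rule borel_measurable_diff)
    fix x assume x: "x \<in> \<Omega>"
    show "\<bar>((if 0 < u x then g x else 0) - h x) \<bullet> i\<bar> \<le> indicator S x * f x + 2 * real n * indicator S x"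
    proof (cases "x \<in> S")
      case True
      have "\<bar>h x \<bullet> i\<bar> \<le> 2 * real n" using onS(4)[OF True] Gi[OF i, of x] by auto
      then show ?thesis using True onS(1)[OF True] fge(2)[OF i, of x] by (simp add: inner_diff_left)
    qed (use offS[OF x] in simp)
  qed
  show ?thesis using that[OF zh K] zero 1 2 by blast
qed

text \<open>Mollifying at a scale below the distance from \<open>K\<close> to the complement of
  \<open>\<Omega>\<close> spreads the support only to \<open>K'\<close>; hence the mollification is
  a test function, and its error over \<open>\<Omega>\<close> is the error over
  \<open>K'\<close>.\<close>

lemma compact_support_approximation:
  fixes \<Omega> :: "'a::euclidean_space set"
  assumes \<Omega>: "open \<Omega>" and z: "has_weak_gradient \<Omega> z h" and K: "compact K" "K \<subseteq> \<Omega>"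
    and zero: "\<And>x. x \<in> \<Omega> - K \<Longrightarrow> z x = 0 \<and> h x = 0" and e: "0 < e"
  obtains \<phi> where "\<phi> \<in> test_functions \<Omega>" "integrable (lebesgue_on \<Omega>) (\<lambda>x. z x - \<phi> x)"
    "(LINT x|lebesgue_on \<Omega>. \<bar>z x - \<phi> x\<bar>) < e"
    "\<forall>i\<in>Basis. integrable (lebesgue_on \<Omega>) (\<lambda>x. h x \<bullet> i - pd \<phi> i x)"
    "\<forall>i\<in>Basis. (LINT x|lebesgue_on \<Omega>. \<bar>h x \<bullet> i - pd \<phi> i x\<bar>) < e"
proof -
  obtain \<delta> where \<delta>: "0 < \<delta>" "(\<Union>x\<in>K. cball x \<delta>) \<subseteq> \<Omega>"
    using compact_subset_open_imp_cball_epsilon_subset[OF K(1) \<Omega> K(2)] by blast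
  define K' where "K' = (\<Union>x\<in>K. cball x \<delta>)"
  have K': "compact K'" "K' \<subseteq> \<Omega>" "K \<subseteq> K'" using compact_cball_union[OF K(1)] \<delta> by (auto simp: K'_def)
  obtain w where w: "smooth w" "(LINT x|lebesgue. indicator K' x * \<bar>w x - z x\<bar>) < e"
    "\<forall>i\<in>Basis. (LINT x|lebesgue. indicator K' x * \<bar>pd w i x - h x \<bullet> i\<bar>) < e"
    "\<forall>x. w x \<noteq> 0 \<longrightarrow> (\<exists>y\<in>\<Omega>. z y \<noteq> 0 \<and> dist x y < \<delta>)"
    by (rule local_smooth_approximation[OF \<Omega> z K'(1,2) e \<delta>(1)])
  have wK': "x \<in> K'" if wx: "w x \<noteq> 0" for x
  proof -
    obtain y where y: "y \<in> \<Omega>" "z y \<noteq> 0" "dist x y < \<delta>" using w(4) wx by blast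
    then have "y \<in> K" using zero by blast
    then show ?thesis using y(3) unfolding K'_def by (intro UN_I[of y]) (simp_all add: dist_commute)
  qed
  have pK': "pd w i x = 0" if "x \<notin> K'" for i x
  proof (rule pd_eq_0[of "- K'"])
    show "open (- K')" using compact_imp_closed[OF K'(1)] by (simp add: open_Compl)
  qed (use that wK' in auto)
  have lz: "locally_integrable \<Omega> z" "\<And>i. i \<in> Basis \<Longrightarrow> locally_integrable \<Omega> (\<lambda>x. h x \<bullet> i)"
    using z by (auto simp: has_weak_gradient_def)
  have "integrable (lebesgue_on \<Omega>) q" and "(LINT x|lebesgue_on \<Omega>. \<bar>q x\<bar>) = (LINT x|lebesgue. indicator K' x * \<bar>q x\<bar>)"
    if "locally_integrable \<Omega> q" "\<And>x. x \<in> \<Omega> - K' \<Longrightarrow> q x = 0" for q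
  proof -
    have eq: "(\<lambda>x. indicator \<Omega> x * q x) = (\<lambda>x. indicator K' x * q x)"
      "(\<lambda>x. indicator \<Omega> x * \<bar>q x\<bar>) = (\<lambda>x. indicator K' x * \<bar>q x\<bar>)"
      using that(2) K'(2) by (auto simp: indicator_def fun_eq_iff)
    show "integrable (lebesgue_on \<Omega>) q"
      using that(1) K' unfolding lebesgue_on_open(1)[OF \<Omega>] eq by (auto simp: locally_integrable_def set_integrable_def)
    show "(LINT x|lebesgue_on \<Omega>. \<bar>q x\<bar>) = (LINT x|lebesgue. indicator K' x * \<bar>q x\<bar>)"
      unfolding lebesgue_on_open(2)[OF \<Omega>] eq ..
  qed note * = this
  have zK': "z x = 0" "h x = 0" if "x \<in> \<Omega> - K'" for x using that zero K'(3) by auto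
  have w0: "w x = 0" if "x \<notin> K'" for x using that wK' by blast
  have q1: "locally_integrable \<Omega> (\<lambda>x. z x - w x)" "\<And>x. x \<in> \<Omega> - K' \<Longrightarrow> z x - w x = 0"
    using locally_integrable_diff[OF lz(1) locally_integrable_continuous[OF smooth_continuous_on[OF w(1)]]] zK'(1) w0
    by simp_all
  have q2: "locally_integrable \<Omega> (\<lambda>x. h x \<bullet> i - pd w i x)" "\<And>x. x \<in> \<Omega> - K' \<Longrightarrow> h x \<bullet> i - pd w i x = 0" if "i \<in> Basis" for i
    using locally_integrable_diff[OF lz(2)[OF that] locally_integrable_continuous[OF smooth_continuous_on[OF smooth_pd[OF w(1) that]]]]
      zK'(2) pK'
    by simp_all
  show ?thesis
  proof
    show "w \<in> test_functions \<Omega>" by (rule test_functionI[OF w(1) K'(1,2) wK'])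
    show "integrable (lebesgue_on \<Omega>) (\<lambda>x. z x - w x)" by (rule *(1)[OF q1])
    show "(LINT x|lebesgue_on \<Omega>. \<bar>z x - w x\<bar>) < e"
    proof -
      have "(LINT x|lebesgue_on \<Omega>. \<bar>z x - w x\<bar>) = (LINT x|lebesgue. indicator K' x * \<bar>z x - w x\<bar>)"
        by (rule *(2)[OF q1])
      also have "\<dots> = (LINT x|lebesgue. indicator K' x * \<bar>w x - z x\<bar>)" by (simp only: abs_minus_commute)
      finally show ?thesis using w(2) by simp
    qed
    show "\<forall>i\<in>Basis. integrable (lebesgue_on \<Omega>) (\<lambda>x. h x \<bullet> i - pd w i x)" using *(1)[OF q2] by blast
    show "\<forall>i\<in>Basis. (LINT x|lebesgue_on \<Omega>. \<bar>h x \<bullet> i - pd w i x\<bar>) < e"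
      using *(2)[OF q2] w(3) by (simp add: abs_minus_commute)
  qed
qed

lemma has_weak_gradient_minus:
  assumes "open \<Omega>" "has_weak_gradient \<Omega> u g"
  shows "has_weak_gradient \<Omega> (\<lambda>x. - u x) (\<lambda>x. - g x)"
  using has_weak_gradient_diff[OF assms(1) has_weak_gradient_diff[OF assms assms(2)] assms(2)] by simp

lemma integral_abs_combine:
  fixes a b c :: "'a \<Rightarrow> real"
  assumes "integrable M a" "integrable M b" "integrable M c"
    and "(LINT x|M. \<bar>a x\<bar>) < e" "(LINT x|M. \<bar>b x\<bar>) < e" "(LINT x|M. \<bar>c x\<bar>) < e"
  shows "(LINT x|M. \<bar>a x - b x + c x\<bar>) < 3 * e"
proof -
  have "(LINT x|M. \<bar>a x - b x + c x\<bar>) \<le> (LINT x|M. \<bar>a x\<bar> + \<bar>b x\<bar> + \<bar>c x\<bar>)"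
    using assms by (intro integral_mono) auto
  also have "\<dots> = (LINT x|M. \<bar>a x\<bar>) + (LINT x|M. \<bar>b x\<bar>) + (LINT x|M. \<bar>c x\<bar>)"
    using assms by simp
  finally show ?thesis using assms(4-6) by linarith
qed

text \<open>Treat \<open>u\<close> and \<open>- u\<close> by their positive parts, then mollify the
  difference of the two compactly supported approximants. The three errors get e/3 each.\<close>

lemma test_function_approximation:
  fixes \<Omega> :: "'a::euclidean_space set"
  assumes \<Omega>: "open \<Omega>" "\<Omega> \<in> lmeasurable" and u: "has_weak_gradient \<Omega> u g"
    and int: "integrable (lebesgue_on \<Omega>) u" "\<And>i. i \<in> Basis \<Longrightarrow> integrable (lebesgue_on \<Omega>) (\<lambda>x. g x \<bullet> i)"
    and H: "(\<lambda>k. real k * measure (lebesgue_on \<Omega>) {x\<in>\<Omega>. real k * boundary_dist \<Omega> x < \<bar>u x\<bar>}) \<longlonglongrightarrow> 0"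
    and e: "0 < e"
  obtains \<phi> where "\<phi> \<in> test_functions \<Omega>" "(LINT x|lebesgue_on \<Omega>. \<bar>u x - \<phi> x\<bar>) < e"
    "\<And>i. i \<in> Basis \<Longrightarrow> (LINT x|lebesgue_on \<Omega>. \<bar>g x \<bullet> i - pd \<phi> i x\<bar>) < e"
proof -
  let ?M = "lebesgue_on \<Omega>"
  have e3: "0 < e / 3" using e by simp
  have mu: "has_weak_gradient \<Omega> (\<lambda>x. - u x) (\<lambda>x. - g x)" by (rule has_weak_gradient_minus[OF \<Omega>(1) u])
  have mint: "integrable ?M (\<lambda>x. - u x)" "\<And>i. i \<in> Basis \<Longrightarrow> integrable ?M (\<lambda>x. - g x \<bullet> i)"
    using int by simp_all
  have mH: "(\<lambda>k. real k * measure ?M {x\<in>\<Omega>. real k * boundary_dist \<Omega> x < \<bar>- u x\<bar>}) \<longlonglongrightarrow> 0"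
    using H by simp
  define g1 where "g1 x = (if 0 < u x then g x else 0)" for x
  define g2 where "g2 x = (if 0 < - u x then - g x else 0)" for x
  obtain z1 h1 K1 where 1: "has_weak_gradient \<Omega> z1 h1" "compact K1" "K1 \<subseteq> \<Omega>"
    "\<forall>x\<in>\<Omega> - K1. z1 x = 0 \<and> h1 x = 0"
    "integrable ?M (\<lambda>x. max 0 (u x) - z1 x)"
    "\<forall>i\<in>Basis. integrable ?M (\<lambda>x. ((if 0 < u x then g x else 0) - h1 x) \<bullet> i)"
    "(LINT x|?M. \<bar>max 0 (u x) - z1 x\<bar>) < e / 3"
    "\<forall>i\<in>Basis. (LINT x|?M. \<bar>((if 0 < u x then g x else 0) - h1 x) \<bullet> i\<bar>) < e / 3"
    by (rule positive_part_approximation[OF \<Omega> u int H e3], assumption) (rule that)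
  obtain z2 h2 K2 where 2: "has_weak_gradient \<Omega> z2 h2" "compact K2" "K2 \<subseteq> \<Omega>"
    "\<forall>x\<in>\<Omega> - K2. z2 x = 0 \<and> h2 x = 0"
    "integrable ?M (\<lambda>x. max 0 (- u x) - z2 x)"
    "\<forall>i\<in>Basis. integrable ?M (\<lambda>x. ((if 0 < - u x then - g x else 0) - h2 x) \<bullet> i)"
    "(LINT x|?M. \<bar>max 0 (- u x) - z2 x\<bar>) < e / 3"
    "\<forall>i\<in>Basis. (LINT x|?M. \<bar>((if 0 < - u x then - g x else 0) - h2 x) \<bullet> i\<bar>) < e / 3"
    by (rule positive_part_approximation[OF \<Omega> mu mint mH e3], assumption) (rule that)
  note 1 = 1[folded g1_def] and 2 = 2[folded g2_def]
  have z: "has_weak_gradient \<Omega> (\<lambda>x. z1 x - z2 x) (\<lambda>x. h1 x - h2 x)"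
    by (rule has_weak_gradient_diff[OF \<Omega>(1) 1(1) 2(1)])
  have K: "compact (K1 \<union> K2)" "K1 \<union> K2 \<subseteq> \<Omega>" using 1(2,3) 2(2,3) by auto
  have zero: "z1 x - z2 x = 0 \<and> h1 x - h2 x = 0" if "x \<in> \<Omega> - (K1 \<union> K2)" for x
    using that 1(4) 2(4) by simp
  obtain \<phi> where \<phi>: "\<phi> \<in> test_functions \<Omega>" "integrable ?M (\<lambda>x. z1 x - z2 x - \<phi> x)"
    "(LINT x|?M. \<bar>z1 x - z2 x - \<phi> x\<bar>) < e / 3"
    "\<forall>i\<in>Basis. integrable ?M (\<lambda>x. (h1 x - h2 x) \<bullet> i - pd \<phi> i x)"
    "\<forall>i\<in>Basis. (LINT x|?M. \<bar>(h1 x - h2 x) \<bullet> i - pd \<phi> i x\<bar>) < e / 3"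
    by (rule compact_support_approximation[OF \<Omega>(1) z K zero e3], assumption) (rule that)
  \<comment> \<open>Where \<open>u = 0\<close>, \<open>g1 - g2\<close> is \<open>0\<close> but \<open>g\<close> need not be; uniqueness makes this a null set.\<close>
  have "has_weak_gradient \<Omega> (\<lambda>x. max 0 (u x) - max 0 (- u x)) (\<lambda>x. g1 x - g2 x)"
    unfolding g1_def g2_def
    by (rule has_weak_gradient_diff[OF \<Omega>(1) weak_gradient_positive_part[OF \<Omega>(1) u] weak_gradient_positive_part[OF \<Omega>(1) mu]])
  moreover have "(\<lambda>x. max 0 (u x) - max 0 (- u x)) = u" by (auto simp: max_def)
  ultimately have AE: "AE x in ?M. g1 x - g2 x = g x"
    using weak_gradient_unique[OF \<Omega>(1) _ u] by simp
  show ?thesis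
  proof
    show "\<phi> \<in> test_functions \<Omega>" by fact
    have "u x - \<phi> x = (max 0 (u x) - z1 x) - (max 0 (- u x) - z2 x) + (z1 x - z2 x - \<phi> x)" for x
      by (simp add: max_def)
    then show "(LINT x|?M. \<bar>u x - \<phi> x\<bar>) < e"
      using integral_abs_combine[OF 1(5) 2(5) \<phi>(2) 1(7) 2(7) \<phi>(3)] by (simp only:)
    fix i :: 'a assume i: "i \<in> Basis"
    have eq: "(g1 x - h1 x) \<bullet> i - (g2 x - h2 x) \<bullet> i + ((h1 x - h2 x) \<bullet> i - pd \<phi> i x) = (g1 x - g2 x) \<bullet> i - pd \<phi> i x" for x
      by (simp add: inner_diff_left)
    have "integrable ?M (\<lambda>x. (g1 x - h1 x) \<bullet> i - (g2 x - h2 x) \<bullet> i + ((h1 x - h2 x) \<bullet> i - pd \<phi> i x))"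
      by (intro Bochner_Integration.integrable_add Bochner_Integration.integrable_diff bspec[OF 1(6) i] bspec[OF 2(6) i] bspec[OF \<phi>(4) i])
    then have m: "(\<lambda>x. (g1 x - g2 x) \<bullet> i - pd \<phi> i x) \<in> borel_measurable ?M"
      unfolding eq by (rule borel_measurable_integrable)
    have "smooth \<phi>" using \<phi>(1) by (simp add: test_functions_def smooth_def)
    then have pm: "pd \<phi> i \<in> borel_measurable ?M"
      using i by (intro measurable_lebesgue_on_continuous smooth_continuous_on smooth_pd)
    have "(LINT x|?M. \<bar>g x \<bullet> i - pd \<phi> i x\<bar>) = (LINT x|?M. \<bar>(g1 x - g2 x) \<bullet> i - pd \<phi> i x\<bar>)"
    proof (rule integral_cong_AE)
      show "AE x in ?M. \<bar>g x \<bullet> i - pd \<phi> i x\<bar> = \<bar>(g1 x - g2 x) \<bullet> i - pd \<phi> i x\<bar>"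
        using AE by (rule eventually_mono) simp
      show "(\<lambda>x. \<bar>g x \<bullet> i - pd \<phi> i x\<bar>) \<in> borel_measurable ?M"
        using borel_measurable_integrable[OF int(2)[OF i]] pm by measurable
      show "(\<lambda>x. \<bar>(g1 x - g2 x) \<bullet> i - pd \<phi> i x\<bar>) \<in> borel_measurable ?M"
        using m by measurable
    qed
    also have "\<dots> < 3 * (e / 3)"
      using integral_abs_combine[OF bspec[OF 1(6) i] bspec[OF 2(6) i] bspec[OF \<phi>(4) i] bspec[OF 1(8) i] bspec[OF 2(8) i] bspec[OF \<phi>(5) i]] unfolding eq .
    finally show "(LINT x|?M. \<bar>g x \<bullet> i - pd \<phi> i x\<bar>) < e" by simp
  qed
qed

section \<open>The Poincare inequality\<close>

text \<open>The graph of a convex function lies above its tangent at \<open>A\<close>. Convexity is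
  used on the open half-line, so t = 0 is computed directly: the tangent there has the value (1 - p)
  A^p.\<close>

lemma powr_tangent:
  fixes p :: real
  assumes p: "1 \<le> p" and A: "0 < A" and t: "0 \<le> t"
  shows "A powr p + p * A powr (p - 1) * (t - A) \<le> t powr p"
proof (cases "t = 0")
  case True
  have "A powr (p - 1) * A = A powr p" using A by (simp add: powr_diff)
  then have "A powr p + p * A powr (p - 1) * (0 - A) = (1 - p) * A powr p" by (simp add: algebra_simps)
  also have "\<dots> \<le> 0" using p by (simp add: mult_nonpos_nonneg)
  finally show ?thesis using True by simp
next
  case False
  have "t powr p - A powr p \<ge> (p * A powr (p - 1)) * (t - A)"
  proof (rule convex_on_imp_above_tangent[OF powr_convex[OF p]])
    show "((\<lambda>x. x powr p) has_real_derivative p * A powr (p - 1)) (at A within {0<..})"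
      using A by (auto intro!: derivative_eq_intros)
    show "A \<in> interior {0<..}" using A by (simp add: interior_open)
  qed (use t False in auto)
  then show ?thesis by simp
qed

text \<open>Jensen's inequality for a power on the unit interval: integrate the tangent inequality
  taken at the mean \<open>A\<close>; the linear term integrates to 0.\<close>

lemma powr_integral_unit_interval:
  fixes F :: "real \<Rightarrow> real"
  assumes p: "1 \<le> p" and F: "continuous_on UNIV F" "\<And>s. 0 \<le> F s"
  shows "(LINT s|lborel. indicator {0..1} s * F s) powr p \<le> (LINT s|lborel. indicator {0..1} s * F s powr p)"
proof -
  let ?A = "LINT s|lborel. indicator {0..1} s * F s"
  have i1: "integrable lborel (\<lambda>s. indicator {0..1} s * F s)"
    using borel_integrable_compact[of "{0..1}" F] continuous_on_subset[OF F(1)] by simp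
  have "continuous_on {0..1} (\<lambda>s. F s powr p)"
    using p F by (intro continuous_on_powr' continuous_on_subset[OF F(1)] continuous_intros) auto
  then have i2: "integrable lborel (\<lambda>s. indicator {0..1} s * F s powr p)"
    using borel_integrable_compact[of "{0..1}" "\<lambda>s. F s powr p"] by simp
  have ind: "integrable lborel (\<lambda>s::real. indicator {0..1} s :: real)" "(LINT s|lborel. indicator {0..1::real} s :: real) = 1"
    by (auto intro!: integrable_real_indicator)
  have A0: "0 \<le> ?A" using F(2) by simp
  show ?thesis
  proof (cases "?A = 0")
    case True
    then show ?thesis using p by simp
  next
    case False
    define A where "A = ?A"
    have A: "0 < A" using False A0 by (simp add: A_def)
    have "A powr p = (LINT s|lborel. (A powr p - p * A powr (p - 1) * A) * indicator {0..1} s + p * A powr (p - 1) * (indicator {0..1} s * F s))"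
      using i1 ind by (simp add: A_def[symmetric])
    also have "\<dots> \<le> (LINT s|lborel. indicator {0..1} s * F s powr p)"
    proof (rule integral_mono)
      show "integrable lborel (\<lambda>s. (A powr p - p * A powr (p - 1) * A) * indicator {0..1} s + p * A powr (p - 1) * (indicator {0..1} s * F s))"
        by (intro Bochner_Integration.integrable_add integrable_mult_right i1 ind)
      show "(A powr p - p * A powr (p - 1) * A) * indicator {0..1} s + p * A powr (p - 1) * (indicator {0..1} s * F s)
          \<le> indicator {0..1} s * F s powr p" for s
        using powr_tangent[OF p A F(2)[of s]] by (simp add: indicator_def algebra_simps)
    qed (rule i2)
    finally show ?thesis by (simp add: A_def)
  qed
qed

definition grad :: "('a::euclidean_space \<Rightarrow> real) \<Rightarrow> 'a \<Rightarrow> 'a" where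
  "grad f x = (\<Sum>i\<in>Basis. pd f i x *\<^sub>R i)"

lemma pd_eq_inner_grad:
  assumes "f differentiable (at x)"
  shows "pd f h x = h \<bullet> grad f x"
  unfolding pd_sum_Basis[OF assms, of h] grad_def by (simp add: inner_sum_right mult.commute)

lemma continuous_grad: "smooth f \<Longrightarrow> continuous_on S (grad f)"
  unfolding grad_def[abs_def] by (intro continuous_intros smooth_continuous_on smooth_pd) auto

text \<open>Fundamental theorem of calculus along the segment from x to x + h, the Cauchy-Schwarz
  inequality, and Jensen for the p-th power. In \<open>ennreal\<close>, ready for exchanging
  integrals over x.\<close>

lemma smooth_translation_powr_le:
  fixes \<phi> :: "'a::euclidean_space \<Rightarrow> real"
  assumes \<phi>: "smooth \<phi>" and p: "1 \<le> p"
  shows "ennreal (\<bar>\<phi> (x + h) - \<phi> x\<bar> powr p)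
    \<le> ennreal (norm h powr p) * (\<integral>\<^sup>+s. indicator {0..1} s * ennreal (norm (grad \<phi> (x + s *\<^sub>R h)) powr p) \<partial>lborel)"
proof -
  define G where "G s = norm (grad \<phi> (x + s *\<^sub>R h))" for s
  have cG: "continuous_on UNIV G"
    unfolding G_def by (intro continuous_on_norm continuous_on_compose2[OF continuous_grad[OF \<phi>, of UNIV]] continuous_intros) auto
  have iG: "integrable lborel (\<lambda>s. indicator {0..1} s * G s)"
    using borel_integrable_compact[of "{0..1}" G] continuous_on_subset[OF cG] by simp
  have cGp: "continuous_on {0..1} (\<lambda>s. G s powr p)"
    using p by (intro continuous_on_powr' continuous_on_subset[OF cG] continuous_intros) (auto simp: G_def)
  have iGp: "integrable lborel (\<lambda>s. indicator {0..1} s * G s powr p)"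
    using borel_integrable_compact[OF _ cGp] by simp
  let ?f = "\<lambda>s. pd \<phi> h (x + s *\<^sub>R h)"
  have pdG: "\<bar>?f s\<bar> \<le> norm h * G s" for s
    unfolding pd_eq_inner_grad[OF smooth_differentiable[OF \<phi>]] G_def by (rule Cauchy_Schwarz_ineq2)
  have DERIV: "((\<lambda>s. \<phi> (x + s *\<^sub>R h)) has_real_derivative ?f s) (at s)" for s
  proof -
    have d: "(\<phi> has_derivative (\<lambda>k. pd \<phi> k (x + s *\<^sub>R h))) (at (x + s *\<^sub>R h))"
      by (rule has_derivative_pd[OF smooth_differentiable[OF \<phi>]])
    have "((\<lambda>s. x + s *\<^sub>R h) has_derivative (\<lambda>t. t *\<^sub>R h)) (at s)"
      by (auto intro!: derivative_eq_intros)
    from has_derivative_compose[where f="\<lambda>s. x + s *\<^sub>R h" and g=\<phi> and x=s and s=UNIV, OF this d]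
    have "((\<lambda>s. \<phi> (x + s *\<^sub>R h)) has_derivative (\<lambda>t. pd \<phi> (t *\<^sub>R h) (x + s *\<^sub>R h))) (at s)" .
    moreover have "pd \<phi> (t *\<^sub>R h) (x + s *\<^sub>R h) = ?f s * t" for t
      using linear_scale[OF has_derivative_linear[OF d], of t h] by simp
    ultimately show ?thesis by (simp add: has_field_derivative_def mult_commute_abs)
  qed
  have cf: "continuous_on UNIV ?f"
    unfolding pd_eq_inner_grad[OF smooth_differentiable[OF \<phi>]]
    by (intro continuous_intros continuous_on_compose2[OF continuous_grad[OF \<phi>, of UNIV]]) auto
  have "(LINT s|lborel. ?f s * indicator {0..1} s) = \<phi> (x + 1 *\<^sub>R h) - \<phi> (x + 0 *\<^sub>R h)"
    using cf by (intro integral_FTC_Icc_real DERIV) (auto simp: continuous_on_eq_continuous_at)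
  then have "\<bar>\<phi> (x + h) - \<phi> x\<bar> = norm (LINT s|lborel. ?f s * indicator {0..1} s)" by simp
  also have "\<dots> \<le> (LINT s|lborel. norm h * (indicator {0..1} s * G s))"
  proof (rule abs_integral_le)
    show "integrable lborel (\<lambda>s. ?f s * indicator {0..1} s)"
      using borel_integrable_compact[of "{0..1}" ?f] continuous_on_subset[OF cf] by (simp add: mult.commute)
    show "norm (?f s * indicator {0..1} s) \<le> norm h * (indicator {0..1} s * G s)" for s
      using pdG[of s] by (simp add: indicator_def)
  qed (use iG in simp)
  also have "\<dots> = norm h * (LINT s|lborel. indicator {0..1} s * G s)" by simp
  finally have "\<bar>\<phi> (x + h) - \<phi> x\<bar> powr p \<le> (norm h * (LINT s|lborel. indicator {0..1} s * G s)) powr p"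
    using p by (intro powr_mono2) auto
  also have "\<dots> = norm h powr p * (LINT s|lborel. indicator {0..1} s * G s) powr p"
    by (rule powr_mult)
  also have "\<dots> \<le> norm h powr p * (LINT s|lborel. indicator {0..1} s * G s powr p)"
    by (intro mult_left_mono powr_integral_unit_interval p cG) (auto simp: G_def)
  finally have "ennreal (\<bar>\<phi> (x + h) - \<phi> x\<bar> powr p) \<le> ennreal (norm h powr p) * ennreal (LINT s|lborel. indicator {0..1} s * G s powr p)"
    by (simp add: ennreal_mult'[symmetric] ennreal_leI)
  also have "ennreal (LINT s|lborel. indicator {0..1} s * G s powr p) = (\<integral>\<^sup>+s. ennreal (indicator {0..1} s * G s powr p) \<partial>lborel)"
    by (rule nn_integral_eq_integral[symmetric, OF iGp]) simp
  also have "\<dots> = (\<integral>\<^sup>+s. indicator {0..1} s * ennreal (norm (grad \<phi> (x + s *\<^sub>R h)) powr p) \<partial>lborel)"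
    by (intro nn_integral_cong) (simp add: G_def indicator_def)
  finally show ?thesis .
qed

text \<open>For R \<ge> 1 the volume is at least the unit ball volume times R.\<close>

lemma measure_cball_unbounded:
  obtains R where "0 < R" "B \<le> measure lborel (cball (0::'a::euclidean_space) R)"
proof -
  define c where "c = unit_ball_vol (real DIM('a))"
  have c: "0 < c" by (simp add: c_def)
  define R where "R = max 1 (B / c)"
  have R: "1 \<le> R" "B \<le> c * R" using c by (auto simp: R_def max_def field_simps)
  have "R \<le> R ^ DIM('a)" using R(1) DIM_positive[where 'a='a] by (simp add: self_le_power)
  then have "c * R \<le> c * R ^ DIM('a)" using c by simp
  then have "B \<le> c * R ^ DIM('a)" using R(2) by linarith
  then have "B \<le> measure lborel (cball (0::'a) R)"
    using R(1) by (simp add: content_cball c_def)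
  then show ?thesis using that[of R] R(1) by simp
qed

text \<open>A ball of at least twice the measure of \<open>\<Omega>\<close> has, for each \<open>x\<close>, at least half of its elements \<open>h\<close>
  with \<open>x + h\<close> outside \<open>\<Omega>\<close>, where \<open>\<phi> x = \<phi> x - \<phi> (x + h)\<close>. Averaging over the ball proves the inequality.\<close>

lemma Poincare_nn_integral:
  fixes \<Omega> :: "'a::euclidean_space set"
  assumes \<Omega>: "open \<Omega>" "\<Omega> \<in> lmeasurable" and p: "1 \<le> p"
  obtains C where "0 \<le> C" "\<forall>\<phi>\<in>test_functions \<Omega>. (\<integral>\<^sup>+x. ennreal (\<bar>\<phi> x\<bar> powr p) \<partial>lborel)
      \<le> ennreal C * (\<integral>\<^sup>+x. ennreal (norm (grad \<phi> x) powr p) \<partial>lborel)"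
proof -
  define m where "m = measure lborel \<Omega>"
  have \<Omega>b[measurable]: "\<Omega> \<in> sets borel" using \<Omega>(1) by simp
  have "emeasure lborel \<Omega> < \<infinity>" using \<Omega> by (simp add: fmeasurable_def)
  then have em: "emeasure lborel \<Omega> = ennreal m" by (simp add: m_def emeasure_eq_ennreal_measure less_top)
  have m: "0 \<le> m" by (simp add: m_def)
  \<comment> \<open>Beyond twice the measure of \<open>\<Omega>\<close> so that \<open>b - m\<close>
    is at least \<open>b / 2\<close>; the added 1 keeps \<open>b\<close> positive when
    \<open>m\<close> is 0.\<close>
  obtain R where R: "0 < R" "2 * m + 1 \<le> measure lborel (cball (0::'a) R)"
    by (rule measure_cball_unbounded) (rule that)
  define B where "B = cball (0::'a) R"
  define b where "b = measure lborel B"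
  have b: "2 * m + 1 \<le> b" using R(2) by (simp add: b_def B_def)
  have "emeasure lborel B < \<infinity>" unfolding B_def by (rule emeasure_bounded_finite[OF bounded_cball])
  then have eb: "emeasure lborel B = ennreal b" by (simp add: b_def emeasure_eq_ennreal_measure less_top)
  have [measurable]: "B \<in> sets borel" by (simp add: B_def)
  have "(\<integral>\<^sup>+x. ennreal (\<bar>\<phi> x\<bar> powr p) \<partial>lborel) \<le> ennreal (2 * R powr p) * (\<integral>\<^sup>+x. ennreal (norm (grad \<phi> x) powr p) \<partial>lborel)"
    if \<phi>: "\<phi> \<in> test_functions \<Omega>" for \<phi>
  proof -
    obtain K where "smooth \<phi>" "compact K" "K \<subseteq> \<Omega>" "\<And>x. x \<notin> K \<Longrightarrow> \<phi> x = 0" "\<And>x i. x \<notin> K \<Longrightarrow> pd \<phi> i x = 0"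
      using test_functionD[OF \<phi>] by blast
    note K = this(1,3,4)
    have [measurable]: "\<phi> \<in> borel_measurable borel" "grad \<phi> \<in> borel_measurable borel"
      using K(1) by (auto intro: borel_measurable_continuous_onI smooth_continuous_on continuous_grad)
    define W where "W = (\<integral>\<^sup>+x. ennreal (\<bar>\<phi> x\<bar> powr p) \<partial>lborel)"
    define Z where "Z = (\<integral>\<^sup>+x. ennreal (norm (grad \<phi> x) powr p) \<partial>lborel)"
    define Q where "Q x h = indicator B h * ennreal (\<bar>\<phi> (x + h) - \<phi> x\<bar> powr p)" for x h
    have "ennreal (b - m) * W \<le> (\<integral>\<^sup>+x. (\<integral>\<^sup>+h. Q x h \<partial>lborel) \<partial>lborel)"
    proof -
      have "ennreal (b - m) * W = (\<integral>\<^sup>+x. ennreal (b - m) * ennreal (\<bar>\<phi> x\<bar> powr p) \<partial>lborel)"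
        unfolding W_def by (rule nn_integral_cmult[symmetric]) measurable
      also have "\<dots> \<le> (\<integral>\<^sup>+x. (\<integral>\<^sup>+h. Q x h \<partial>lborel) \<partial>lborel)"
      proof (rule nn_integral_mono)
        fix x
        define E where "E = {h. x + h \<in> \<Omega>}"
        have [measurable]: "E \<in> sets borel"
        proof -
          have "{h\<in>space borel. x + h \<in> \<Omega>} \<in> sets borel" by measurable
          then show ?thesis by (simp add: E_def)
        qed
        have "emeasure lborel E = emeasure (distr lborel borel ((+) x)) \<Omega>"
          by (simp add: emeasure_distr E_def vimage_def)
        then have eE: "emeasure lborel E = ennreal m" by (simp add: lborel_distr_plus em)
        have "ennreal b \<le> emeasure lborel (B - E) + emeasure lborel E"
          unfolding eb[symmetric] using emeasure_subadditive[of "B - E" lborel E] emeasure_mono[of B "B - E \<union> E" lborel]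
          by (auto intro: order_trans)
        \<comment> \<open>\<open>E\<close> is a translate of \<open>\<Omega>\<close>, so it removes
          at most \<open>m\<close> from the ball, whatever x is.\<close>
        then have "ennreal (b - m) \<le> emeasure lborel (B - E)"
          using b m by (simp add: eE ennreal_minus[symmetric] ennreal_minus_le_iff add.commute)
        then have "ennreal (b - m) * ennreal (\<bar>\<phi> x\<bar> powr p) \<le> emeasure lborel (B - E) * ennreal (\<bar>\<phi> x\<bar> powr p)"
          by (rule mult_right_mono) simp
        also have "\<dots> = (\<integral>\<^sup>+h. ennreal (\<bar>\<phi> x\<bar> powr p) * indicator (B - E) h \<partial>lborel)"
          by (subst nn_integral_cmult_indicator) (simp_all add: mult.commute)
        also have "\<dots> \<le> (\<integral>\<^sup>+h. Q x h \<partial>lborel)"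
        proof (rule nn_integral_mono)
          fix h
          have "\<phi> (x + h) = 0" if "h \<notin> E" using that K(2,3) by (auto simp: E_def)
          then show "ennreal (\<bar>\<phi> x\<bar> powr p) * indicator (B - E) h \<le> Q x h"
            by (auto simp: Q_def indicator_def)
        qed
        finally show "ennreal (b - m) * ennreal (\<bar>\<phi> x\<bar> powr p) \<le> (\<integral>\<^sup>+h. Q x h \<partial>lborel)" .
      qed
      finally show ?thesis .
    qed
    also have "\<dots> = (\<integral>\<^sup>+h. (\<integral>\<^sup>+x. Q x h \<partial>lborel) \<partial>lborel)"
      unfolding Q_def by (rule lborel_pair.Fubini') measurable
    also have "\<dots> \<le> (\<integral>\<^sup>+h. ennreal (R powr p) * Z * indicator B h \<partial>lborel)"
    proof (rule nn_integral_mono)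
      fix h
      show "(\<integral>\<^sup>+x. Q x h \<partial>lborel) \<le> ennreal (R powr p) * Z * indicator B h"
      proof (cases "h \<in> B")
        case True
        have "(\<integral>\<^sup>+x. Q x h \<partial>lborel) = (\<integral>\<^sup>+x. ennreal (\<bar>\<phi> (x + h) - \<phi> x\<bar> powr p) \<partial>lborel)"
          using True by (simp add: Q_def)
        also have "\<dots> \<le> (\<integral>\<^sup>+x. ennreal (norm h powr p) * (\<integral>\<^sup>+s. indicator {0..1} s * ennreal (norm (grad \<phi> (x + s *\<^sub>R h)) powr p) \<partial>lborel) \<partial>lborel)"
          by (intro nn_integral_mono smooth_translation_powr_le K(1) p)
        also have "\<dots> = ennreal (norm h powr p) * (\<integral>\<^sup>+x. (\<integral>\<^sup>+s. indicator {0..1} s * ennreal (norm (grad \<phi> (x + s *\<^sub>R h)) powr p) \<partial>lborel) \<partial>lborel)"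
          by (rule nn_integral_cmult) measurable
        also have "(\<integral>\<^sup>+x. (\<integral>\<^sup>+s. indicator {0..1} s * ennreal (norm (grad \<phi> (x + s *\<^sub>R h)) powr p) \<partial>lborel) \<partial>lborel)
            = (\<integral>\<^sup>+s. (\<integral>\<^sup>+x. indicator {0..1} s * ennreal (norm (grad \<phi> (x + s *\<^sub>R h)) powr p) \<partial>lborel) \<partial>lborel)"
          by (rule lborel_pair.Fubini') measurable
        \<comment> \<open>After the exchange, the inner integral over x is translation invariant and
          depends neither on s nor on h.\<close>
        also have "\<dots> = (\<integral>\<^sup>+s. Z * indicator {0..1::real} s \<partial>lborel)"
        proof (rule nn_integral_cong)
          fix s :: real
          have "(\<integral>\<^sup>+x. indicator {0..1} s * ennreal (norm (grad \<phi> (x + s *\<^sub>R h)) powr p) \<partial>lborel)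
              = indicator {0..1} s * (\<integral>\<^sup>+x. ennreal (norm (grad \<phi> (x + s *\<^sub>R h)) powr p) \<partial>lborel)"
            by (rule nn_integral_cmult) measurable
          also have "(\<integral>\<^sup>+x. ennreal (norm (grad \<phi> (x + s *\<^sub>R h)) powr p) \<partial>lborel) = Z"
            unfolding Z_def by (rule nn_integral_translate[of "\<lambda>x. ennreal (norm (grad \<phi> x) powr p)"]) measurable
          finally show "(\<integral>\<^sup>+x. indicator {0..1} s * ennreal (norm (grad \<phi> (x + s *\<^sub>R h)) powr p) \<partial>lborel) = Z * indicator {0..1} s"
            by (simp add: mult.commute)
        qed
        also have "\<dots> = Z" by (simp add: nn_integral_cmult_indicator)
        also have "ennreal (norm h powr p) * Z \<le> ennreal (R powr p) * Z"
          using True p by (intro mult_right_mono ennreal_leI powr_mono2) (auto simp: B_def)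
        finally show ?thesis using True by simp
      qed (simp add: Q_def)
    qed
    also have "\<dots> = ennreal (R powr p) * Z * ennreal b"
      by (simp add: nn_integral_cmult_indicator eb)
    finally have main: "ennreal (b - m) * W \<le> ennreal (R powr p) * Z * ennreal b" .
    have "ennreal (b / 2) * W \<le> ennreal (b - m) * W"
      using b m by (intro mult_right_mono ennreal_leI) auto
    with main have "ennreal (b / 2) * W \<le> ennreal (R powr p) * Z * ennreal b" by (rule order_trans[rotated])
    \<comment> \<open>Dividing by b/2 leaves the factor 2 in the constant, independently of the size
      of the ball.\<close>
    then have "ennreal (2 / b) * (ennreal (b / 2) * W) \<le> ennreal (2 / b) * (ennreal (R powr p) * Z * ennreal b)"
      by (rule mult_left_mono) simp
    moreover have "ennreal (2 / b) * (ennreal (b / 2) * W) = W"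
      using b m by (simp add: mult.assoc[symmetric] ennreal_mult'[symmetric])
    moreover have "ennreal (2 / b) * (ennreal (R powr p) * Z * ennreal b) = (ennreal (2 / b) * ennreal b) * ennreal (R powr p) * Z"
      by (simp add: mult_ac)
    moreover have "ennreal (2 / b) * ennreal b = ennreal 2" using b m by (simp add: ennreal_mult'[symmetric])
    moreover have "ennreal 2 * ennreal (R powr p) = ennreal (2 * R powr p)" by (rule ennreal_mult'[symmetric]) simp
    ultimately show ?thesis by (simp add: W_def Z_def)
  qed
  then show ?thesis using that[of "2 * R powr p"] by simp
qed

section \<open>Sobolev spaces and weak Lebesgue spaces\<close>

lemma has_weak_gradient_weak_grad:
  "weakly_differentiable \<Omega> u \<Longrightarrow> has_weak_gradient \<Omega> u (weak_grad \<Omega> u)"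
  unfolding weakly_differentiable_def weak_grad_def by (rule someI_ex[of "has_weak_gradient \<Omega> u"])

text \<open>\<open>weak_grad\<close> is selected by choice, so a computed gradient identifies it
  only up to a null set; this lemma transfers estimates from one to the other.\<close>

lemma weak_grad_AE_eq:
  fixes \<Omega> :: "'a::euclidean_space set"
  assumes "open \<Omega>" "has_weak_gradient \<Omega> u g"
  shows "AE x in lebesgue_on \<Omega>. weak_grad \<Omega> u x = g x"
  using weak_gradient_unique[OF assms(1) has_weak_gradient_weak_grad assms(2)] assms(2)
  by (auto simp: weakly_differentiable_def)

lemma weak_gradient_measurable:
  fixes \<Omega> :: "'a::euclidean_space set"
  assumes "open \<Omega>" "has_weak_gradient \<Omega> u g"
  shows "u \<in> borel_measurable (lebesgue_on \<Omega>)" "g \<in> borel_measurable (lebesgue_on \<Omega>)"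
proof -
  show "u \<in> borel_measurable (lebesgue_on \<Omega>)"
    using assms by (auto simp: has_weak_gradient_def intro: locally_integrable_measurable)
  have "\<forall>i\<in>Basis. (\<lambda>x. g x \<bullet> i) \<in> borel_measurable (lebesgue_on \<Omega>)"
    using assms by (auto simp: has_weak_gradient_def intro: locally_integrable_measurable)
  then show "g \<in> borel_measurable (lebesgue_on \<Omega>)"
    using borel_measurable_euclidean_space[of g "lebesgue_on \<Omega>"] by blast
qed

section \<open>Elementary facts on Lebesgue spaces and gradients\<close>

lemma Lp_1_iff: "f \<in> Lp \<Omega> 1 \<longleftrightarrow> integrable (lebesgue_on \<Omega>) f"
proof -
  have "(\<lambda>x. \<bar>f x\<bar> powr 1) = (\<lambda>x. \<bar>f x\<bar>)" by (simp add: fun_eq_iff)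
  then show ?thesis unfolding Lp_def by (auto simp: integrable_abs_iff dest: borel_measurable_integrable)
qed

lemma Lp_norm_1: "Lp_norm \<Omega> 1 f = (LINT x|lebesgue_on \<Omega>. \<bar>f x\<bar>)"
  by (simp add: Lp_norm_def)

lemma Lp_AE_bound:
  assumes "f \<in> Lp \<Omega> q" "h \<in> borel_measurable (lebesgue_on \<Omega>)" "AE x in lebesgue_on \<Omega>. \<bar>h x\<bar> \<le> \<bar>f x\<bar>" "0 < q"
  shows "h \<in> Lp \<Omega> q"
proof -
  have [measurable]: "h \<in> borel_measurable (lebesgue_on \<Omega>)" by fact
  have f: "integrable (lebesgue_on \<Omega>) (\<lambda>x. \<bar>f x\<bar> powr q)" using assms(1) by (simp add: Lp_def)
  have "integrable (lebesgue_on \<Omega>) (\<lambda>x. \<bar>h x\<bar> powr q)"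
  proof (rule Bochner_Integration.integrable_bound[OF f])
    show "AE x in lebesgue_on \<Omega>. norm (\<bar>h x\<bar> powr q) \<le> norm (\<bar>f x\<bar> powr q)"
      using assms(3) by (rule eventually_mono) (use assms(4) in \<open>auto intro: powr_mono2\<close>)
  qed measurable
  then show ?thesis by (simp add: Lp_def)
qed

lemma powr_add_le:
  fixes a b q :: real
  assumes "0 \<le> a" "0 \<le> b" "0 < q"
  shows "(a + b) powr q \<le> 2 powr q * (a powr q + b powr q)"
proof -
  have "(a + b) powr q \<le> (2 * max a b) powr q" using assms by (intro powr_mono2) auto
  also have "\<dots> = 2 powr q * max a b powr q" by (rule powr_mult)
  also have "\<dots> \<le> 2 powr q * (a powr q + b powr q)" by (intro mult_left_mono) (auto simp: max_def)
  finally show ?thesis .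
qed

lemma Lp_add:
  assumes "f \<in> Lp \<Omega> q" "h \<in> Lp \<Omega> q" "0 < q"
  shows "(\<lambda>x. \<bar>f x\<bar> + \<bar>h x\<bar>) \<in> Lp \<Omega> q"
proof -
  have [measurable]: "f \<in> borel_measurable (lebesgue_on \<Omega>)" "h \<in> borel_measurable (lebesgue_on \<Omega>)"
    using assms by (auto simp: Lp_def)
  have "integrable (lebesgue_on \<Omega>) (\<lambda>x. (\<bar>f x\<bar> + \<bar>h x\<bar>) powr q)"
  proof (rule Bochner_Integration.integrable_bound)
    show "integrable (lebesgue_on \<Omega>) (\<lambda>x. 2 powr q * (\<bar>f x\<bar> powr q + \<bar>h x\<bar> powr q))"
      using assms by (simp add: Lp_def)
    show "AE x in lebesgue_on \<Omega>. norm ((\<bar>f x\<bar> + \<bar>h x\<bar>) powr q) \<le> norm (2 powr q * (\<bar>f x\<bar> powr q + \<bar>h x\<bar> powr q))"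
      using powr_add_le[OF abs_ge_zero abs_ge_zero assms(3)] by (intro AE_I2) simp
  qed measurable
  then show ?thesis by (simp add: Lp_def)
qed

lemma Lp_sum:
  assumes "finite I" "\<And>i. i \<in> I \<Longrightarrow> f i \<in> Lp \<Omega> q" "0 < q"
  shows "(\<lambda>x. \<Sum>i\<in>I. \<bar>f i x\<bar>) \<in> Lp \<Omega> q"
  using assms(1,2)
proof (induction I rule: finite_induct)
  case empty
  then show ?case by (simp add: Lp_def)
next
  case (insert j I)
  have "(\<lambda>x. \<bar>f j x\<bar> + \<bar>\<Sum>i\<in>I. \<bar>f i x\<bar>\<bar>) \<in> Lp \<Omega> q"
    using insert by (intro Lp_add assms(3)) auto
  then show ?case using insert(1,2) by (simp add: sum_nonneg)
qed

text \<open>Reconciles the gradient hypothesis, stated for the norm, with \<open>W1\<close>, stated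
  for components; the Euclidean norm and the sum of the absolute values of the components bound one
  another up to constants.\<close>

lemma Lp_gradient_iff:
  fixes \<Omega> :: "'a::euclidean_space set"
  assumes "open \<Omega>" "has_weak_gradient \<Omega> u g" "0 < q"
  shows "(\<lambda>x. norm (g x)) \<in> Lp \<Omega> q \<longleftrightarrow> (\<forall>i\<in>Basis. (\<lambda>x. g x \<bullet> i) \<in> Lp \<Omega> q)"
proof
  have [measurable]: "g \<in> borel_measurable (lebesgue_on \<Omega>)" using assms weak_gradient_measurable by blast
  show "\<forall>i\<in>Basis. (\<lambda>x. g x \<bullet> i) \<in> Lp \<Omega> q" if "(\<lambda>x. norm (g x)) \<in> Lp \<Omega> q"
  proof
    fix i :: 'a assume "i \<in> Basis"
    then show "(\<lambda>x. g x \<bullet> i) \<in> Lp \<Omega> q"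
      by (intro Lp_AE_bound[OF that _ _ assms(3)] AE_I2) (simp_all add: Basis_le_norm)
  qed
  show "(\<lambda>x. norm (g x)) \<in> Lp \<Omega> q" if "\<forall>i\<in>Basis. (\<lambda>x. g x \<bullet> i) \<in> Lp \<Omega> q"
  proof (rule Lp_AE_bound[OF Lp_sum[OF finite_Basis] _ _ assms(3)])
    show "AE x in lebesgue_on \<Omega>. \<bar>norm (g x)\<bar> \<le> \<bar>\<Sum>i\<in>Basis. \<bar>g x \<bullet> i\<bar>\<bar>"
    proof (rule AE_I2)
      fix x
      show "\<bar>norm (g x)\<bar> \<le> \<bar>\<Sum>i\<in>Basis. \<bar>g x \<bullet> i\<bar>\<bar>"
        using norm_le_l1[of "g x"] by (simp add: sum_nonneg)
    qed
  qed (use that assms(3) in auto)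
qed

lemma Lp_gradient_AE:
  fixes \<Omega> :: "'a::euclidean_space set"
  assumes "open \<Omega>" "has_weak_gradient \<Omega> u g" "0 < q" "\<forall>i\<in>Basis. (\<lambda>x. g x \<bullet> i) \<in> Lp \<Omega> q"
  shows "\<forall>i\<in>Basis. (\<lambda>x. weak_grad \<Omega> u x \<bullet> i) \<in> Lp \<Omega> q"
proof
  fix i :: 'a assume i: "i \<in> Basis"
  have wd: "weakly_differentiable \<Omega> u" using assms(2) by (auto simp: weakly_differentiable_def)
  have [measurable]: "weak_grad \<Omega> u \<in> borel_measurable (lebesgue_on \<Omega>)"
    using weak_gradient_measurable(2)[OF assms(1) has_weak_gradient_weak_grad[OF wd]] .
  show "(\<lambda>x. weak_grad \<Omega> u x \<bullet> i) \<in> Lp \<Omega> q"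
  proof (rule Lp_AE_bound[OF _ _ _ assms(3)])
    show "(\<lambda>x. g x \<bullet> i) \<in> Lp \<Omega> q" using assms(4) i by blast
    show "AE x in lebesgue_on \<Omega>. \<bar>weak_grad \<Omega> u x \<bullet> i\<bar> \<le> \<bar>g x \<bullet> i\<bar>"
      using weak_grad_AE_eq[OF assms(1,2)] by (rule eventually_mono) simp
  qed measurable
qed

lemma Lp_finite_measure_subset:
  assumes "\<Omega> \<in> lmeasurable" "1 \<le> q" "f \<in> Lp \<Omega> q"
  shows "integrable (lebesgue_on \<Omega>) f"
proof -
  interpret finite_measure "lebesgue_on \<Omega>" using assms(1) by (rule finite_measure_lebesgue_on)
  have f: "f \<in> borel_measurable (lebesgue_on \<Omega>)" "integrable (lebesgue_on \<Omega>) (\<lambda>x. \<bar>f x\<bar> powr q)"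
    using assms(3) by (auto simp: Lp_def)
  show ?thesis
  proof (rule Bochner_Integration.integrable_bound[OF _ f(1)])
    show "integrable (lebesgue_on \<Omega>) (\<lambda>x. 1 + \<bar>f x\<bar> powr q)" using f(2) by simp
    have "\<bar>f x\<bar> \<le> 1 + \<bar>f x\<bar> powr q" for x
    proof (cases "\<bar>f x\<bar> \<le> 1")
      case False
      then have "\<bar>f x\<bar> powr 1 \<le> \<bar>f x\<bar> powr q" using assms(2) by (intro powr_mono) auto
      then show ?thesis by simp
    qed (simp add: add_increasing2)
    then show "AE x in lebesgue_on \<Omega>. norm (f x) \<le> norm (1 + \<bar>f x\<bar> powr q)"
      by (intro AE_I2) simp
  qed
qed

lemma const_weak_gradient:
  fixes \<Omega> :: "'a::euclidean_space set"
  assumes "open \<Omega>"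
  shows "has_weak_gradient \<Omega> (\<lambda>x. c) (\<lambda>x. 0)"
proof -
  have "pd (\<lambda>x::'a. c) i x = 0" for i x by (rule pd_eqI) simp
  then show ?thesis using smooth_weak_gradient[OF assms smooth_const, of c] by simp
qed

text \<open>Two applications of the minimum with \<open>c\<close>, separated by sign changes, each
  minimum being v minus the positive part of v - c. The pointwise alternative for \<open>G\<close>
  yields every bound by \<open>g\<close> that is needed later, without locating the truncated
  region.\<close>

lemma truncation_weak_gradient:
  fixes \<Omega> :: "'a::euclidean_space set"
  assumes \<Omega>: "open \<Omega>" and u: "has_weak_gradient \<Omega> u g"
  obtains G where "has_weak_gradient \<Omega> (\<lambda>x. max (- c) (min c (u x))) G" "\<And>x. G x = g x \<or> G x = 0"
proof -
  have min: "has_weak_gradient \<Omega> (\<lambda>x. min c (v x)) (\<lambda>x. h x - (if 0 < v x - c then h x - 0 else 0))"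
    if "has_weak_gradient \<Omega> v h" for v h
  proof -
    have "(\<lambda>x. min c (v x)) = (\<lambda>x. v x - max 0 (v x - c))" by (auto simp: fun_eq_iff max_def min_def)
    then show ?thesis
      using has_weak_gradient_diff[OF \<Omega> that weak_gradient_positive_part[OF \<Omega> has_weak_gradient_diff[OF \<Omega> that const_weak_gradient[OF \<Omega>]]]]
      by simp
  qed
  define v where "v x = - min c (u x)" for x
  define h where "h x = - (g x - (if 0 < u x - c then g x - 0 else 0))" for x
  have "has_weak_gradient \<Omega> v h"
    unfolding v_def[abs_def] h_def[abs_def] by (rule has_weak_gradient_minus[OF \<Omega> min[OF u]])
  note has_weak_gradient_minus[OF \<Omega> min[OF this]]
  moreover have "(\<lambda>x. - min c (v x)) = (\<lambda>x. max (- c) (min c (u x)))"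
    by (auto simp: v_def fun_eq_iff max_def min_def)
  ultimately show ?thesis
    by (intro that[of "\<lambda>x. - (h x - (if 0 < v x - c then h x - 0 else 0))"]) (auto simp: h_def)
qed

text \<open>A lower bound of Chebyshev type: take t to be half the measure of \<open>E\<close>.
  Restricted to \<open>E\<close>, the function exceeds every level below \<open>k\<close> on the
  whole of \<open>E\<close>, so no such level is admissible in the rearrangement at t. The factor
  1/2 is the price of this t.\<close>

lemma weak_L1_norm_ge:
  fixes \<Omega> :: "'a::euclidean_space set" and f :: "'a \<Rightarrow> real"
  assumes \<Omega>: "\<Omega> \<in> lmeasurable" and f: "f \<in> borel_measurable (lebesgue_on \<Omega>)" and "0 \<le> k"
  defines "E \<equiv> {x\<in>\<Omega>. k < \<bar>f x\<bar>}"
  shows "ennreal (k * measure (lebesgue_on \<Omega>) E / 2) \<le> weak_L1_norm \<Omega> (\<lambda>x. f x * indicator E x)"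
proof -
  define m where "m = measure (lebesgue_on \<Omega>) E"
  have fin: "finite_measure (lebesgue_on \<Omega>)" using \<Omega> by (rule finite_measure_lebesgue_on)
  have em: "emeasure lebesgue E = ennreal m"
  proof -
    have "emeasure lebesgue E = emeasure (lebesgue_on \<Omega>) E"
      using \<Omega> by (subst emeasure_restrict_space) (auto simp: E_def)
    then show ?thesis using finite_measure.emeasure_eq_measure[OF fin] by (simp add: m_def)
  qed
  show ?thesis
  proof (cases "m = 0")
    case True
    then show ?thesis by (simp add: m_def)
  next
    case False
    then have m: "0 < m" using measure_nonneg[of "lebesgue_on \<Omega>" E] unfolding m_def by linarith
    have "ennreal k \<le> rearrangement \<Omega> (\<lambda>x. f x * indicator E x) (m / 2)"
      unfolding rearrangement_def
    proof (rule Inf_greatest)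
      fix y assume "y \<in> {ennreal \<xi> |\<xi>. 0 \<le> \<xi> \<and> emeasure lebesgue {x \<in> \<Omega>. \<xi> < \<bar>f x * indicator E x\<bar>} \<le> ennreal (m / 2)}"
      then obtain \<xi> where \<xi>: "y = ennreal \<xi>" "0 \<le> \<xi>" "emeasure lebesgue {x \<in> \<Omega>. \<xi> < \<bar>f x * indicator E x\<bar>} \<le> ennreal (m / 2)"
        by blast
      have "k \<le> \<xi>"
      proof (rule ccontr)
        assume "\<not> k \<le> \<xi>"
        then have "{x \<in> \<Omega>. \<xi> < \<bar>f x * indicator E x\<bar>} = E"
          using \<xi>(2) by (auto simp: E_def indicator_def)
        then show False using \<xi>(3) m by (simp add: em ennreal_le_iff)
      qed
      then show "ennreal k \<le> y" using \<xi>(1) by (simp add: ennreal_leI)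
    qed
    then have "ennreal (m / 2) * ennreal k \<le> ennreal (m / 2) * rearrangement \<Omega> (\<lambda>x. f x * indicator E x) (m / 2)"
      by (rule mult_left_mono) simp
    also have "\<dots> \<le> weak_L1_norm \<Omega> (\<lambda>x. f x * indicator E x)"
      unfolding weak_L1_norm_def using m by (intro SUP_upper) simp
    finally show ?thesis using m \<open>0 \<le> k\<close> by (simp add: ennreal_mult'[symmetric] m_def mult.commute)
  qed
qed

text \<open>Absolute continuity of the weak norm, applied to the level sets of the quotient itself.
  The quotient is real-valued, so each point leaves these sets eventually. Positivity of the
  distance then allows multiplying out the denominator.\<close>

lemma weak_L1_a_level_sets:
  fixes \<Omega> :: "'a::euclidean_space set"
  assumes \<Omega>: "open \<Omega>" "\<Omega> \<in> lmeasurable" and f: "(\<lambda>x. u x / boundary_dist \<Omega> x) \<in> weak_L1_a \<Omega>"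
  shows "(\<lambda>k. real k * measure (lebesgue_on \<Omega>) {x\<in>\<Omega>. real k * boundary_dist \<Omega> x < \<bar>u x\<bar>}) \<longlonglongrightarrow> 0"
proof -
  let ?f = "\<lambda>x. u x / boundary_dist \<Omega> x"
  have fm[measurable]: "?f \<in> borel_measurable (lebesgue_on \<Omega>)" using f by (simp add: weak_L1_a_def weak_L1_def)
  have nU: "\<Omega> \<noteq> UNIV" using \<Omega>(2) by (auto simp: fmeasurable_def)
  define E where "E k = {x\<in>\<Omega>. real k < \<bar>?f x\<bar>}" for k :: nat
  have Es: "E k \<in> sets (lebesgue_on \<Omega>)" for k
  proof -
    have "{x\<in>space (lebesgue_on \<Omega>). real k < \<bar>?f x\<bar>} \<in> sets (lebesgue_on \<Omega>)" by measurable
    then show ?thesis by (simp add: E_def)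
  qed
  have "(\<lambda>k. indicator (E k) x :: real) \<longlonglongrightarrow> 0" for x
  proof (rule tendsto_eventually)
    obtain N :: nat where N: "\<bar>?f x\<bar> \<le> real N" using real_arch_simple by blast
    have "indicator (E k) x = (0::real)" if "N \<le> k" for k
      using N that by (auto simp: E_def indicator_def)
    then show "eventually (\<lambda>k. indicator (E k) x = (0::real)) sequentially"
      unfolding eventually_sequentially by blast
  qed
  then have N0: "(\<lambda>k. weak_L1_norm \<Omega> (\<lambda>x. ?f x * indicator (E k) x)) \<longlonglongrightarrow> 0"
    using f Es unfolding weak_L1_a_def by simp
  have "(\<lambda>k. real k * measure (lebesgue_on \<Omega>) (E k)) \<longlonglongrightarrow> 0"
  proof (rule LIMSEQ_I)
    fix e :: real assume e: "0 < e"
    have "eventually (\<lambda>k. weak_L1_norm \<Omega> (\<lambda>x. ?f x * indicator (E k) x) < ennreal (e / 2)) sequentially"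
      using order_tendstoD(2)[OF N0] e by simp
    then obtain N where N: "\<And>k. N \<le> k \<Longrightarrow> weak_L1_norm \<Omega> (\<lambda>x. ?f x * indicator (E k) x) < ennreal (e / 2)"
      unfolding eventually_sequentially by blast
    have "norm (real k * measure (lebesgue_on \<Omega>) (E k) - 0) < e" if "N \<le> k" for k
    proof -
      have "ennreal (real k * measure (lebesgue_on \<Omega>) (E k) / 2) \<le> weak_L1_norm \<Omega> (\<lambda>x. ?f x * indicator (E k) x)"
        using weak_L1_norm_ge[OF \<Omega>(2) fm, of "real k"] by (simp add: E_def)
      then have "ennreal (real k * measure (lebesgue_on \<Omega>) (E k) / 2) < ennreal (e / 2)"
        using N[OF that] by (rule le_less_trans)
      then show ?thesis by (simp add: ennreal_less_iff)
    qed
    then show "\<exists>no. \<forall>k\<ge>no. norm (real k * measure (lebesgue_on \<Omega>) (E k) - 0) < e" by blast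
  qed
  moreover have "E k = {x\<in>\<Omega>. real k * boundary_dist \<Omega> x < \<bar>u x\<bar>}" for k
  proof -
    have "real k < \<bar>?f x\<bar> \<longleftrightarrow> real k * boundary_dist \<Omega> x < \<bar>u x\<bar>" if "x \<in> \<Omega>" for x
      using boundary_dist_pos[OF \<Omega>(1) nU that] by (simp add: abs_divide pos_less_divide_eq)
    then show ?thesis unfolding E_def by blast
  qed
  ultimately show ?thesis by simp
qed

text \<open>Converts the \<open>lborel\<close> integrals in the Poincare inequality for test
  functions into the integrals over \<open>\<Omega>\<close> from which the Sobolev norms are
  built.\<close>

lemma test_function_Lp:
  fixes \<phi> :: "'a::euclidean_space \<Rightarrow> real"
  assumes \<Omega>: "open \<Omega>" and \<phi>: "\<phi> \<in> test_functions \<Omega>" and q: "0 < q"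
  shows "\<phi> \<in> Lp \<Omega> q" "(\<lambda>x. norm (grad \<phi> x)) \<in> Lp \<Omega> q"
    and "(\<integral>\<^sup>+x. ennreal (\<bar>\<phi> x\<bar> powr q) \<partial>lborel) = ennreal (LINT x|lebesgue_on \<Omega>. \<bar>\<phi> x\<bar> powr q)"
    and "(\<integral>\<^sup>+x. ennreal (norm (grad \<phi> x) powr q) \<partial>lborel) = ennreal (LINT x|lebesgue_on \<Omega>. norm (grad \<phi> x) powr q)"
proof -
  obtain K where K: "smooth \<phi>" "compact K" "K \<subseteq> \<Omega>" "\<And>x. x \<notin> K \<Longrightarrow> \<phi> x = 0" "\<And>x i. x \<notin> K \<Longrightarrow> pd \<phi> i x = 0"
    using test_functionD[OF \<phi>] by blast
  obtain r where r: "\<And>x. x \<in> K \<Longrightarrow> norm x \<le> r"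
    using compact_imp_bounded[OF K(2)] by (auto simp: bounded_iff)
  have g0: "grad \<phi> x = 0" if "x \<notin> K" for x using K(5)[OF that] by (simp add: grad_def)
  have *: "f \<in> Lp \<Omega> q \<and> (\<integral>\<^sup>+x. ennreal (\<bar>f x\<bar> powr q) \<partial>lborel) = ennreal (LINT x|lebesgue_on \<Omega>. \<bar>f x\<bar> powr q)"
    if cf: "continuous_on UNIV f" and f0: "\<And>x. x \<notin> K \<Longrightarrow> f x = 0" for f :: "'a \<Rightarrow> real"
  proof -
    have c: "continuous_on UNIV (\<lambda>x. \<bar>f x\<bar> powr q)"
      using q by (intro continuous_on_powr' continuous_on_rabs cf continuous_intros) auto
    have z: "\<bar>f x\<bar> powr q = 0" if "x \<notin> K" for x using f0[OF that] by simp
    have i: "integrable lborel (\<lambda>x. \<bar>f x\<bar> powr q)"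
      by (rule integrable_continuous_compact_support[OF c, of r]) (use z r in blast)
    have il: "integrable lebesgue (\<lambda>x. \<bar>f x\<bar> powr q)"
      using i borel_measurable_integrable[OF i] by (simp add: integrable_completion)
    have "integrable (lebesgue_on \<Omega>) (\<lambda>x. \<bar>f x\<bar> powr q)"
      using il lebesgue_on_supported(1)[OF \<Omega> K(3), of "\<lambda>x. \<bar>f x\<bar> powr q"] z by blast
    moreover have "(LINT x|lebesgue_on \<Omega>. \<bar>f x\<bar> powr q) = (LINT x|lborel. \<bar>f x\<bar> powr q)"
      using lebesgue_on_supported(2)[OF \<Omega> K(3), of "\<lambda>x. \<bar>f x\<bar> powr q"] z integral_completion[of "\<lambda>x. \<bar>f x\<bar> powr q" lborel] borel_measurable_integrable[OF i]
      by simp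
    moreover have "f \<in> borel_measurable (lebesgue_on \<Omega>)" using cf by (rule measurable_lebesgue_on_continuous)
    ultimately show ?thesis using nn_integral_eq_integral[OF i] by (simp add: Lp_def)
  qed
  have 1: "continuous_on UNIV \<phi>" "continuous_on UNIV (\<lambda>x. norm (grad \<phi> x))"
    using K(1) by (auto intro!: smooth_continuous_on continuous_on_norm continuous_grad)
  have g0': "norm (grad \<phi> x) = 0" if "x \<notin> K" for x using g0[OF that] by simp
  show "\<phi> \<in> Lp \<Omega> q" "(\<lambda>x. norm (grad \<phi> x)) \<in> Lp \<Omega> q"
    "(\<integral>\<^sup>+x. ennreal (\<bar>\<phi> x\<bar> powr q) \<partial>lborel) = ennreal (LINT x|lebesgue_on \<Omega>. \<bar>\<phi> x\<bar> powr q)"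
    "(\<integral>\<^sup>+x. ennreal (norm (grad \<phi> x) powr q) \<partial>lborel) = ennreal (LINT x|lebesgue_on \<Omega>. norm (grad \<phi> x) powr q)"
    using *[OF 1(1) K(4)] *[OF 1(2) g0'] by simp_all
qed

lemma weak_grad_diff_test:
  fixes \<Omega> :: "'a::euclidean_space set"
  assumes \<Omega>: "open \<Omega>" and u: "has_weak_gradient \<Omega> u g" and \<phi>: "\<phi> \<in> test_functions \<Omega>"
  shows "weakly_differentiable \<Omega> (\<lambda>x. u x - \<phi> x)"
    and "AE x in lebesgue_on \<Omega>. weak_grad \<Omega> (\<lambda>x. u x - \<phi> x) x = g x - grad \<phi> x"
proof -
  have "smooth \<phi>" using \<phi> by (simp add: test_functions_def smooth_def)
  from has_weak_gradient_diff[OF \<Omega> u smooth_weak_gradient[OF \<Omega> this]]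
  have d: "has_weak_gradient \<Omega> (\<lambda>x. u x - \<phi> x) (\<lambda>x. g x - grad \<phi> x)" unfolding grad_def .
  then show "weakly_differentiable \<Omega> (\<lambda>x. u x - \<phi> x)" by (auto simp: weakly_differentiable_def)
  show "AE x in lebesgue_on \<Omega>. weak_grad \<Omega> (\<lambda>x. u x - \<phi> x) x = g x - grad \<phi> x"
    by (rule weak_grad_AE_eq[OF \<Omega> d])
qed

lemma W1_0_1_intro:
  fixes \<Omega> :: "'a::euclidean_space set"
  assumes \<Omega>: "open \<Omega>" "\<Omega> \<in> lmeasurable" and u: "has_weak_gradient \<Omega> u g"
    and int: "integrable (lebesgue_on \<Omega>) u" "\<And>i. i \<in> Basis \<Longrightarrow> integrable (lebesgue_on \<Omega>) (\<lambda>x. g x \<bullet> i)"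
    and H: "(\<lambda>k. real k * measure (lebesgue_on \<Omega>) {x\<in>\<Omega>. real k * boundary_dist \<Omega> x < \<bar>u x\<bar>}) \<longlonglongrightarrow> 0"
  shows "u \<in> W1_0 \<Omega> 1"
proof -
  have wd: "weakly_differentiable \<Omega> u" using u by (auto simp: weakly_differentiable_def)
  have "\<forall>i\<in>Basis. (\<lambda>x. weak_grad \<Omega> u x \<bullet> i) \<in> Lp \<Omega> 1"
    using int(2) by (intro Lp_gradient_AE[OF \<Omega>(1) u]) (auto simp: Lp_1_iff)
  then have W: "u \<in> W1 \<Omega> 1" using int(1) wd by (simp add: W1_def Lp_1_iff)
  have "\<exists>\<phi>\<in>test_functions \<Omega>. W1_norm \<Omega> 1 (\<lambda>x. u x - \<phi> x) < \<epsilon>" if \<epsilon>: "0 < \<epsilon>" for \<epsilon>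
  proof -
    \<comment> \<open>One share for the function and one for each partial derivative, since the
      Euclidean norm of the gradient is at most the sum of its components.\<close>
    define e where "e = \<epsilon> / (1 + DIM('a))"
    have e: "0 < e" "(1 + DIM('a)) * e = \<epsilon>" using \<epsilon> by (simp_all add: e_def add_pos_nonneg)
    obtain \<phi> where \<phi>: "\<phi> \<in> test_functions \<Omega>" "(LINT x|lebesgue_on \<Omega>. \<bar>u x - \<phi> x\<bar>) < e"
      "\<And>i. i \<in> Basis \<Longrightarrow> (LINT x|lebesgue_on \<Omega>. \<bar>g x \<bullet> i - pd \<phi> i x\<bar>) < e"
      using test_function_approximation[OF \<Omega> u int H e(1)] by blast
    have s: "smooth \<phi>" using \<phi>(1) by (simp add: test_functions_def smooth_def)
    have gi: "grad \<phi> x \<bullet> i = pd \<phi> i x" if "i \<in> Basis" for i x using that by (simp add: grad_def sum_Basis_inner)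
    have i: "integrable (lebesgue_on \<Omega>) (\<lambda>x. \<bar>g x \<bullet> i - pd \<phi> i x\<bar>)" if "i \<in> Basis" for i
    proof -
      have "(\<lambda>x. norm (grad \<phi> x)) \<in> Lp \<Omega> 1" by (rule test_function_Lp(2)[OF \<Omega>(1) \<phi>(1)]) simp
      then have "\<forall>i\<in>Basis. (\<lambda>x. grad \<phi> x \<bullet> i) \<in> Lp \<Omega> 1"
        using Lp_gradient_iff[OF \<Omega>(1) smooth_weak_gradient[OF \<Omega>(1) s], of 1] unfolding grad_def[symmetric] by simp
      then have "integrable (lebesgue_on \<Omega>) (\<lambda>x. pd \<phi> i x)" using that by (simp add: Lp_1_iff gi)
      then show ?thesis using int(2)[OF that] by simp
    qed
    note wg = weak_grad_diff_test[OF \<Omega>(1) u \<phi>(1)]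
    have "(LINT x|lebesgue_on \<Omega>. norm (weak_grad \<Omega> (\<lambda>x. u x - \<phi> x) x)) \<le> (LINT x|lebesgue_on \<Omega>. (\<Sum>i\<in>Basis. \<bar>g x \<bullet> i - pd \<phi> i x\<bar>))"
    proof (rule integral_mono_AE')
      show "integrable (lebesgue_on \<Omega>) (\<lambda>x. \<Sum>i\<in>Basis. \<bar>g x \<bullet> i - pd \<phi> i x\<bar>)" using i by auto
      show "AE x in lebesgue_on \<Omega>. norm (weak_grad \<Omega> (\<lambda>x. u x - \<phi> x) x) \<le> (\<Sum>i\<in>Basis. \<bar>g x \<bullet> i - pd \<phi> i x\<bar>)"
        using wg(2)
      proof (rule eventually_mono)
        fix x assume "weak_grad \<Omega> (\<lambda>x. u x - \<phi> x) x = g x - grad \<phi> x"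
        then show "norm (weak_grad \<Omega> (\<lambda>x. u x - \<phi> x) x) \<le> (\<Sum>i\<in>Basis. \<bar>g x \<bullet> i - pd \<phi> i x\<bar>)"
          using norm_le_l1[of "g x - grad \<phi> x"] by (simp add: inner_diff_left gi)
      qed
    qed auto
    also have "\<dots> = (\<Sum>i\<in>Basis. (LINT x|lebesgue_on \<Omega>. \<bar>g x \<bullet> i - pd \<phi> i x\<bar>))"
      using i by (rule Bochner_Integration.integral_sum)
    also have "\<dots> \<le> DIM('a) * e" using \<phi>(3) by (intro sum_bounded_above less_imp_le)
    finally have "W1_norm \<Omega> 1 (\<lambda>x. u x - \<phi> x) < \<epsilon>"
      using \<phi>(2) e(2) by (simp add: W1_norm_def Lp_norm_1 distrib_right)
    then show ?thesis using \<phi>(1) by blast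
  qed
  then show ?thesis using W by (simp add: W1_0_def)
qed

lemma Lp_norm_less_1:
  assumes "Lp_norm \<Omega> q f < 1" "0 < q"
  shows "(LINT x|lebesgue_on \<Omega>. \<bar>f x\<bar> powr q) \<le> 1"
proof (rule ccontr)
  assume "\<not> ?thesis"
  then have "1 \<le> (LINT x|lebesgue_on \<Omega>. \<bar>f x\<bar> powr q) powr (1 / q)"
    using assms(2) by (intro ge_one_powr_ge_zero) auto
  then show False using assms(1) by (simp add: Lp_norm_def)
qed

text \<open>A crude substitute for the triangle inequality in L^q, stated for the q-th powers; the
  loss of a factor is harmless, as only the existence of a constant matters.\<close>

lemma Lp_integral_split:
  assumes "a \<in> Lp \<Omega> q" "b \<in> Lp \<Omega> q" "0 < q" "AE x in lebesgue_on \<Omega>. \<bar>c x\<bar> \<le> \<bar>a x\<bar> + \<bar>b x\<bar>"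
  shows "(LINT x|lebesgue_on \<Omega>. \<bar>c x\<bar> powr q)
    \<le> 2 powr q * ((LINT x|lebesgue_on \<Omega>. \<bar>a x\<bar> powr q) + (LINT x|lebesgue_on \<Omega>. \<bar>b x\<bar> powr q))"
proof -
  have i: "integrable (lebesgue_on \<Omega>) (\<lambda>x. \<bar>a x\<bar> powr q)" "integrable (lebesgue_on \<Omega>) (\<lambda>x. \<bar>b x\<bar> powr q)"
    using assms by (auto simp: Lp_def)
  have "(LINT x|lebesgue_on \<Omega>. \<bar>c x\<bar> powr q) \<le> (LINT x|lebesgue_on \<Omega>. 2 powr q * (\<bar>a x\<bar> powr q + \<bar>b x\<bar> powr q))"
  proof (rule integral_mono_AE')
    show "integrable (lebesgue_on \<Omega>) (\<lambda>x. 2 powr q * (\<bar>a x\<bar> powr q + \<bar>b x\<bar> powr q))" using i by simp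
    show "AE x in lebesgue_on \<Omega>. \<bar>c x\<bar> powr q \<le> 2 powr q * (\<bar>a x\<bar> powr q + \<bar>b x\<bar> powr q)"
      using assms(4)
    proof (rule eventually_mono)
      fix x assume "\<bar>c x\<bar> \<le> \<bar>a x\<bar> + \<bar>b x\<bar>"
      then have "\<bar>c x\<bar> powr q \<le> (\<bar>a x\<bar> + \<bar>b x\<bar>) powr q" using assms(3) by (intro powr_mono2) auto
      also have "\<dots> \<le> 2 powr q * (\<bar>a x\<bar> powr q + \<bar>b x\<bar> powr q)" by (rule powr_add_le[OF abs_ge_zero abs_ge_zero assms(3)])
      finally show "\<bar>c x\<bar> powr q \<le> 2 powr q * (\<bar>a x\<bar> powr q + \<bar>b x\<bar> powr q)" .
    qed
  qed auto
  then show ?thesis using i by simp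
qed

text \<open>The summand \<open>1\<close> is the approximation error; the test function need not be closer.\<close>

lemma Poincare_W1_0:
  fixes \<Omega> :: "'a::euclidean_space set"
  assumes \<Omega>: "open \<Omega>" "\<Omega> \<in> lmeasurable" and p: "1 \<le> p"
  obtains C where "0 \<le> C" "\<forall>v\<in>W1_0 \<Omega> p. (LINT x|lebesgue_on \<Omega>. \<bar>v x\<bar> powr p)
      \<le> C * ((LINT x|lebesgue_on \<Omega>. norm (weak_grad \<Omega> v x) powr p) + 1)"
proof -
  have p0: "0 < p" using p by simp
  obtain C where C: "0 \<le> C" "\<forall>\<phi>\<in>test_functions \<Omega>. (\<integral>\<^sup>+x. ennreal (\<bar>\<phi> x\<bar> powr p) \<partial>lborel)
      \<le> ennreal C * (\<integral>\<^sup>+x. ennreal (norm (grad \<phi> x) powr p) \<partial>lborel)"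
    by (rule Poincare_nn_integral[OF \<Omega> p]) (rule that)
  \<comment> \<open>The crude triangle inequality is used twice: to pass from \<open>v\<close> to a
    test function, and back from its gradient to that of \<open>v\<close>.\<close>
  define C' where "C' = 2 powr p * (C * 2 powr p + 1)"
  have bound: "(LINT x|lebesgue_on \<Omega>. \<bar>v x\<bar> powr p) \<le> C' * ((LINT x|lebesgue_on \<Omega>. norm (weak_grad \<Omega> v x) powr p) + 1)"
    if v: "v \<in> W1_0 \<Omega> p" for v
  proof -
    let ?I = "\<lambda>f. LINT x|lebesgue_on \<Omega>. \<bar>f x\<bar> powr p"
    have vL: "v \<in> Lp \<Omega> p" and wd: "weakly_differentiable \<Omega> v"
      and gL: "\<forall>i\<in>Basis. (\<lambda>x. weak_grad \<Omega> v x \<bullet> i) \<in> Lp \<Omega> p"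
      using v by (auto simp: W1_0_def W1_def)
    note g = has_weak_gradient_weak_grad[OF wd]
    have nL: "(\<lambda>x. norm (weak_grad \<Omega> v x)) \<in> Lp \<Omega> p" using Lp_gradient_iff[OF \<Omega>(1) g p0] gL by blast
    obtain \<phi> where \<phi>: "\<phi> \<in> test_functions \<Omega>" "W1_norm \<Omega> p (\<lambda>x. v x - \<phi> x) < 1"
      using v zero_less_one unfolding W1_0_def by blast
    note \<phi>L = test_function_Lp[OF \<Omega>(1) \<phi>(1) p0]
    note wg = weak_grad_diff_test[OF \<Omega>(1) g \<phi>(1)]
    let ?w = "\<lambda>x. norm (weak_grad \<Omega> (\<lambda>x. v x - \<phi> x) x)"
    have nn: "0 \<le> Lp_norm \<Omega> p f" for f by (simp add: Lp_norm_def)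
    have "Lp_norm \<Omega> p (\<lambda>x. v x - \<phi> x) < 1" "Lp_norm \<Omega> p ?w < 1"
      using \<phi>(2) nn[of "\<lambda>x. v x - \<phi> x"] nn[of ?w] unfolding W1_norm_def by linarith+
    then have n1: "?I (\<lambda>x. v x - \<phi> x) \<le> 1" and n2: "?I ?w \<le> 1"
      using Lp_norm_less_1[OF _ p0] by blast+
    have [measurable]: "v \<in> borel_measurable (lebesgue_on \<Omega>)" "\<phi> \<in> borel_measurable (lebesgue_on \<Omega>)"
      using vL \<phi>L(1) by (auto simp: Lp_def)
    have dL: "(\<lambda>x. v x - \<phi> x) \<in> Lp \<Omega> p"
    proof (rule Lp_AE_bound[OF Lp_add[OF vL \<phi>L(1) p0] _ _ p0])
      show "(\<lambda>x. v x - \<phi> x) \<in> borel_measurable (lebesgue_on \<Omega>)" by measurable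
    qed auto
    have wL: "?w \<in> Lp \<Omega> p"
    proof (rule Lp_AE_bound[OF Lp_add[OF nL \<phi>L(2) p0] _ _ p0])
      have [measurable]: "weak_grad \<Omega> (\<lambda>x. v x - \<phi> x) \<in> borel_measurable (lebesgue_on \<Omega>)"
        by (rule weak_gradient_measurable(2)[OF \<Omega>(1) has_weak_gradient_weak_grad[OF wg(1)]])
      show "?w \<in> borel_measurable (lebesgue_on \<Omega>)" by measurable
      show "AE x in lebesgue_on \<Omega>. \<bar>?w x\<bar> \<le> \<bar>\<bar>norm (weak_grad \<Omega> v x)\<bar> + \<bar>norm (grad \<phi> x)\<bar>\<bar>"
        using wg(2) by (rule eventually_mono) (simp add: norm_triangle_ineq4)
    qed
    have "?I v \<le> 2 powr p * (?I (\<lambda>x. v x - \<phi> x) + ?I \<phi>)"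
      by (rule Lp_integral_split[OF dL \<phi>L(1) p0]) (auto intro!: AE_I2)
    also have "\<dots> \<le> 2 powr p * (1 + ?I \<phi>)" using n1 by (intro mult_left_mono) auto
    finally have 1: "?I v \<le> 2 powr p * (1 + ?I \<phi>)" .
    have "ennreal (?I \<phi>) \<le> ennreal C * ennreal (?I (\<lambda>x. norm (grad \<phi> x)))"
      using bspec[OF C(2) \<phi>(1)] unfolding \<phi>L(3,4) by simp
    then have 2: "?I \<phi> \<le> C * ?I (\<lambda>x. norm (grad \<phi> x))"
      using C(1) by (simp add: ennreal_mult'[symmetric] ennreal_le_iff)
    have "?I (\<lambda>x. norm (grad \<phi> x)) \<le> 2 powr p * (?I (\<lambda>x. norm (weak_grad \<Omega> v x)) + ?I ?w)"
    proof (rule Lp_integral_split[OF nL wL p0])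
      show "AE x in lebesgue_on \<Omega>. \<bar>norm (grad \<phi> x)\<bar> \<le> \<bar>norm (weak_grad \<Omega> v x)\<bar> + \<bar>?w x\<bar>"
        using wg(2)
      proof (rule eventually_mono)
        fix x assume "weak_grad \<Omega> (\<lambda>x. v x - \<phi> x) x = weak_grad \<Omega> v x - grad \<phi> x"
        then show "\<bar>norm (grad \<phi> x)\<bar> \<le> \<bar>norm (weak_grad \<Omega> v x)\<bar> + \<bar>?w x\<bar>"
          using norm_triangle_ineq4[of "weak_grad \<Omega> v x" "weak_grad \<Omega> v x - grad \<phi> x"] by simp
      qed
    qed
    also have "\<dots> \<le> 2 powr p * (?I (\<lambda>x. norm (weak_grad \<Omega> v x)) + 1)" using n2 by (intro mult_left_mono) auto
    finally have 3: "?I (\<lambda>x. norm (grad \<phi> x)) \<le> 2 powr p * (?I (\<lambda>x. norm (weak_grad \<Omega> v x)) + 1)" .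
    define J where "J = ?I (\<lambda>x. norm (weak_grad \<Omega> v x))"
    have J: "0 \<le> J" by (simp add: J_def)
    have "?I \<phi> \<le> C * (2 powr p * (J + 1))" using 2 mult_left_mono[OF 3 C(1)] by (simp add: J_def)
    then have "1 + ?I \<phi> \<le> (C * 2 powr p + 1) * (J + 1)" using J by (simp add: algebra_simps)
    then have "?I v \<le> 2 powr p * ((C * 2 powr p + 1) * (J + 1))"
      using 1 by (meson mult_left_mono order_trans powr_ge_zero)
    then show ?thesis by (simp add: C'_def J_def mult.assoc)
  qed
  have "0 \<le> C'" using C(1) by (simp add: C'_def)
  then show ?thesis using bound that by blast
qed

section \<open>Truncation, and removal of the truncation\<close>

lemma abs_truncation_le: "0 \<le> c \<Longrightarrow> \<bar>max (- c) (min c t)\<bar> \<le> \<bar>t\<bar>" for c t :: real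
  by (auto simp: max_def min_def)

lemma abs_truncation_le_bound: "0 \<le> c \<Longrightarrow> \<bar>max (- c) (min c t)\<bar> \<le> c" for c t :: real
  by (auto simp: max_def min_def)

lemma level_sets_mono:
  fixes u v :: "'a::euclidean_space \<Rightarrow> real"
  assumes fin: "\<Omega> \<in> lmeasurable" and u: "u \<in> borel_measurable (lebesgue_on \<Omega>)" and le: "\<And>x. \<bar>v x\<bar> \<le> \<bar>u x\<bar>"
    and H: "(\<lambda>k. real k * measure (lebesgue_on \<Omega>) {x\<in>\<Omega>. real k * boundary_dist \<Omega> x < \<bar>u x\<bar>}) \<longlonglongrightarrow> 0"
  shows "(\<lambda>k. real k * measure (lebesgue_on \<Omega>) {x\<in>\<Omega>. real k * boundary_dist \<Omega> x < \<bar>v x\<bar>}) \<longlonglongrightarrow> 0"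
proof (rule tendsto_sandwich[OF _ _ tendsto_const H])
  interpret finite_measure "lebesgue_on \<Omega>" using fin by (rule finite_measure_lebesgue_on)
  note [measurable] = u
  have [measurable]: "boundary_dist \<Omega> \<in> borel_measurable (lebesgue_on \<Omega>)"
    unfolding boundary_dist_def[abs_def] by (intro measurable_lebesgue_on_continuous continuous_intros)
  have "real k * measure (lebesgue_on \<Omega>) {x\<in>\<Omega>. real k * boundary_dist \<Omega> x < \<bar>v x\<bar>}
      \<le> real k * measure (lebesgue_on \<Omega>) {x\<in>\<Omega>. real k * boundary_dist \<Omega> x < \<bar>u x\<bar>}" for k
  proof (intro mult_left_mono finite_measure_mono)
    have "{x\<in>space (lebesgue_on \<Omega>). real k * boundary_dist \<Omega> x < \<bar>u x\<bar>} \<in> sets (lebesgue_on \<Omega>)" by measurable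
    then show "{x\<in>\<Omega>. real k * boundary_dist \<Omega> x < \<bar>u x\<bar>} \<in> sets (lebesgue_on \<Omega>)" by simp
  qed (use le in \<open>auto intro: less_le_trans\<close>)
  then show "eventually (\<lambda>k. real k * measure (lebesgue_on \<Omega>) {x\<in>\<Omega>. real k * boundary_dist \<Omega> x < \<bar>v x\<bar>}
      \<le> real k * measure (lebesgue_on \<Omega>) {x\<in>\<Omega>. real k * boundary_dist \<Omega> x < \<bar>u x\<bar>}) sequentially"
    by (rule always_eventually[OF allI])
qed simp

text \<open>Fatou's lemma: at each point the truncations eventually equal \<open>u\<close>, and
  their integrals share the bound \<open>B\<close>.\<close>

lemma Lp_of_truncations:
  assumes u: "u \<in> borel_measurable (lebesgue_on \<Omega>)" and B: "0 \<le> B"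
    and i: "\<And>n::nat. integrable (lebesgue_on \<Omega>) (\<lambda>x. \<bar>max (- real n) (min (real n) (u x))\<bar> powr q)"
    and le: "\<And>n::nat. (LINT x|lebesgue_on \<Omega>. \<bar>max (- real n) (min (real n) (u x))\<bar> powr q) \<le> B"
  shows "u \<in> Lp \<Omega> q"
proof -
  note [measurable] = u
  define T where "T n x = max (- real n) (min (real n) (u x))" for n :: nat and x
  have [measurable]: "T n \<in> borel_measurable (lebesgue_on \<Omega>)" for n unfolding T_def by measurable
  have lim: "(\<lambda>n. ennreal (\<bar>T n x\<bar> powr q)) \<longlonglongrightarrow> ennreal (\<bar>u x\<bar> powr q)" for x
  proof (rule tendsto_eventually)
    obtain N :: nat where "\<bar>u x\<bar> \<le> real N" using real_arch_simple by blast
    then have "T n x = u x" if "N \<le> n" for n using that by (auto simp: T_def)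
    then have "ennreal (\<bar>T n x\<bar> powr q) = ennreal (\<bar>u x\<bar> powr q)" if "N \<le> n" for n using that by simp
    then show "eventually (\<lambda>n. ennreal (\<bar>T n x\<bar> powr q) = ennreal (\<bar>u x\<bar> powr q)) sequentially"
      unfolding eventually_sequentially by blast
  qed
  have "(\<integral>\<^sup>+x. ennreal (\<bar>u x\<bar> powr q) \<partial>lebesgue_on \<Omega>) = (\<integral>\<^sup>+x. liminf (\<lambda>n. ennreal (\<bar>T n x\<bar> powr q)) \<partial>lebesgue_on \<Omega>)"
    by (intro nn_integral_cong lim_imp_Liminf[symmetric] lim) simp
  also have "\<dots> \<le> liminf (\<lambda>n. \<integral>\<^sup>+x. ennreal (\<bar>T n x\<bar> powr q) \<partial>lebesgue_on \<Omega>)"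
    by (rule nn_integral_liminf) measurable
  also have "\<dots> \<le> liminf (\<lambda>n. ennreal B)"
  proof (rule Liminf_mono, rule always_eventually, rule allI)
    fix n
    have "(\<integral>\<^sup>+x. ennreal (\<bar>T n x\<bar> powr q) \<partial>lebesgue_on \<Omega>) = ennreal (LINT x|lebesgue_on \<Omega>. \<bar>T n x\<bar> powr q)"
      by (rule nn_integral_eq_integral) (use i in \<open>simp_all add: T_def\<close>)
    then show "(\<integral>\<^sup>+x. ennreal (\<bar>T n x\<bar> powr q) \<partial>lebesgue_on \<Omega>) \<le> ennreal B"
      using le[of n] by (simp add: T_def ennreal_leI)
  qed
  also have "\<dots> = ennreal B" by (simp add: Liminf_const)
  finally have "(\<integral>\<^sup>+x. ennreal (norm (\<bar>u x\<bar> powr q)) \<partial>lebesgue_on \<Omega>) < \<infinity>"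
    by (simp add: le_less_trans)
  then have "integrable (lebesgue_on \<Omega>) (\<lambda>x. \<bar>u x\<bar> powr q)"
    by (intro integrableI_bounded) measurable
  then show ?thesis using u by (simp add: Lp_def)
qed

theorem corollary4p6:
  fixes \<Omega> :: "(real ^ 'n) set" and p :: real and u :: "real ^ 'n \<Rightarrow> real"
  assumes "1 < p"
    and "open \<Omega>" and "connected \<Omega>"
    and "W1 \<Omega> p \<inter> W1_0 \<Omega> 1 = W1_0 \<Omega> p"
    and "\<And>v. weakly_differentiable \<Omega> v \<Longrightarrow> (\<lambda>x. norm (weak_grad \<Omega> v x)) \<in> Lp \<Omega> p \<Longrightarrow> v \<in> Lp \<Omega> 1"
    and "\<And>v. v \<in> W1_0 \<Omega> p \<Longrightarrow> (\<lambda>x. v x / boundary_dist \<Omega> x) \<in> weak_L1_a \<Omega>"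
    and "weakly_differentiable \<Omega> u"
  shows "(\<lambda>x. norm (weak_grad \<Omega> u x)) \<in> Lp \<Omega> p \<and> (\<lambda>x. u x / boundary_dist \<Omega> x) \<in> weak_L1_a \<Omega>
         \<longleftrightarrow> u \<in> W1_0 \<Omega> p"
proof
  have p0: "0 < p" and p1: "1 \<le> p" using assms(1) by auto
  note \<Omega> = assms(2)
  note g = has_weak_gradient_weak_grad[OF assms(7)]
  show "(\<lambda>x. norm (weak_grad \<Omega> u x)) \<in> Lp \<Omega> p \<and> (\<lambda>x. u x / boundary_dist \<Omega> x) \<in> weak_L1_a \<Omega>"
    if "u \<in> W1_0 \<Omega> p"
  proof
    have "\<forall>i\<in>Basis. (\<lambda>x. weak_grad \<Omega> u x \<bullet> i) \<in> Lp \<Omega> p" using that by (simp add: W1_0_def W1_def)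
    then show "(\<lambda>x. norm (weak_grad \<Omega> u x)) \<in> Lp \<Omega> p" using Lp_gradient_iff[OF \<Omega> g p0] by blast
    show "(\<lambda>x. u x / boundary_dist \<Omega> x) \<in> weak_L1_a \<Omega>" using assms(6) that .
  qed
  show "u \<in> W1_0 \<Omega> p"
    if hyp: "(\<lambda>x. norm (weak_grad \<Omega> u x)) \<in> Lp \<Omega> p \<and> (\<lambda>x. u x / boundary_dist \<Omega> x) \<in> weak_L1_a \<Omega>"
  proof -
    have fin: "\<Omega> \<in> lmeasurable"
    proof -
      note c = const_weak_gradient[OF \<Omega>, of 1]
      have wd: "weakly_differentiable \<Omega> (\<lambda>x. 1)" using c by (auto simp: weakly_differentiable_def)
      have "\<forall>i\<in>Basis. (\<lambda>x. weak_grad \<Omega> (\<lambda>x. 1) x \<bullet> i) \<in> Lp \<Omega> p"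
        by (rule Lp_gradient_AE[OF \<Omega> c p0]) (simp add: Lp_def)
      then have "(\<lambda>x. 1) \<in> Lp \<Omega> 1"
        using assms(5)[OF wd] Lp_gradient_iff[OF \<Omega> has_weak_gradient_weak_grad[OF wd] p0] by blast
      then have "integrable lebesgue (\<lambda>x. indicator \<Omega> x * 1 :: real)"
        unfolding Lp_1_iff lebesgue_on_open(1)[OF \<Omega>] .
      then show ?thesis by (simp add: lmeasurable_iff_integrable)
    qed
    interpret finite_measure "lebesgue_on \<Omega>" using fin by (rule finite_measure_lebesgue_on)
    have nL: "(\<lambda>x. norm (weak_grad \<Omega> u x)) \<in> Lp \<Omega> p" using hyp by blast
    then have gL: "\<forall>i\<in>Basis. (\<lambda>x. weak_grad \<Omega> u x \<bullet> i) \<in> Lp \<Omega> p" using Lp_gradient_iff[OF \<Omega> g p0] by blast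
    have gi: "integrable (lebesgue_on \<Omega>) (\<lambda>x. weak_grad \<Omega> u x \<bullet> i)" if "i \<in> Basis" for i
      using Lp_finite_measure_subset[OF fin p1] gL that by blast
    have u1: "integrable (lebesgue_on \<Omega>) u" using assms(5)[OF assms(7) nL] by (simp add: Lp_1_iff)
    have um[measurable]: "u \<in> borel_measurable (lebesgue_on \<Omega>)" using u1 by simp
    have H: "(\<lambda>k. real k * measure (lebesgue_on \<Omega>) {x\<in>\<Omega>. real k * boundary_dist \<Omega> x < \<bar>u x\<bar>}) \<longlonglongrightarrow> 0"
      using hyp by (intro weak_L1_a_level_sets[OF \<Omega> fin]) blast
    obtain C where C: "0 \<le> C" "\<forall>v\<in>W1_0 \<Omega> p. (LINT x|lebesgue_on \<Omega>. \<bar>v x\<bar> powr p)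
        \<le> C * ((LINT x|lebesgue_on \<Omega>. norm (weak_grad \<Omega> v x) powr p) + 1)"
      by (rule Poincare_W1_0[OF \<Omega> fin p1]) (rule that)
    define J where "J = (LINT x|lebesgue_on \<Omega>. norm (weak_grad \<Omega> u x) powr p)"
    have iJ: "integrable (lebesgue_on \<Omega>) (\<lambda>x. norm (weak_grad \<Omega> u x) powr p)" using nL by (simp add: Lp_def)
    have trunc: "integrable (lebesgue_on \<Omega>) (\<lambda>x. \<bar>max (- real n) (min (real n) (u x))\<bar> powr p) \<and>
        (LINT x|lebesgue_on \<Omega>. \<bar>max (- real n) (min (real n) (u x))\<bar> powr p) \<le> C * (J + 1)" for n :: nat
    proof -
      define T where "T x = max (- real n) (min (real n) (u x))" for x
      have Tm[measurable]: "T \<in> borel_measurable (lebesgue_on \<Omega>)" unfolding T_def[abs_def] by measurable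
      have Tle: "\<bar>T x\<bar> \<le> \<bar>u x\<bar>" "\<bar>T x\<bar> \<le> real n" for x
        unfolding T_def by (auto intro!: abs_truncation_le abs_truncation_le_bound)
      obtain G where "has_weak_gradient \<Omega> (\<lambda>x. max (- real n) (min (real n) (u x))) G"
          and G0: "\<And>x. G x = weak_grad \<Omega> u x \<or> G x = 0"
        using truncation_weak_gradient[OF \<Omega> g, of "real n"] by blast
      then have G: "has_weak_gradient \<Omega> T G" by (simp add: T_def[abs_def])
      have Gle: "norm (G x) \<le> norm (weak_grad \<Omega> u x)" "\<bar>G x \<bullet> i\<bar> \<le> \<bar>weak_grad \<Omega> u x \<bullet> i\<bar>" for x i
        using G0[of x] by auto
      note Gm[measurable] = weak_gradient_measurable(2)[OF \<Omega> G]
      have GL: "\<forall>i\<in>Basis. (\<lambda>x. G x \<bullet> i) \<in> Lp \<Omega> p"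
      proof
        fix i :: "real ^ 'n" assume "i \<in> Basis"
        then have "(\<lambda>x. weak_grad \<Omega> u x \<bullet> i) \<in> Lp \<Omega> p" using gL by blast
        then show "(\<lambda>x. G x \<bullet> i) \<in> Lp \<Omega> p"
        proof (rule Lp_AE_bound[OF _ _ _ p0])
          show "(\<lambda>x. G x \<bullet> i) \<in> borel_measurable (lebesgue_on \<Omega>)" by measurable
        qed (intro AE_I2 Gle)
      qed
      have Gi: "integrable (lebesgue_on \<Omega>) (\<lambda>x. G x \<bullet> i)" if "i \<in> Basis" for i
        using Lp_finite_measure_subset[OF fin p1] GL that by blast
      have Ti: "integrable (lebesgue_on \<Omega>) T"
        by (rule Bochner_Integration.integrable_bound[OF u1 Tm]) (use Tle in auto)
      have wd: "weakly_differentiable \<Omega> T" using G by (auto simp: weakly_differentiable_def)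
      have TL: "T \<in> Lp \<Omega> p"
      proof (rule Lp_AE_bound[OF _ Tm _ p0])
        \<comment> \<open>Constants are in L^p because \<open>\<Omega>\<close> has finite measure;
          this is what a bounded truncation gains over \<open>u\<close>.\<close>
        show "(\<lambda>x. real n) \<in> Lp \<Omega> p" by (simp add: Lp_def)
      qed (use Tle in auto)
      have "T \<in> W1 \<Omega> p" using TL wd Lp_gradient_AE[OF \<Omega> G p0 GL] by (simp add: W1_def)
      \<comment> \<open>Truncation shrinks the level sets, so their decay passes from
        \<open>u\<close> to \<open>T\<close>.\<close>
      moreover have "T \<in> W1_0 \<Omega> 1"
        by (rule W1_0_1_intro[OF \<Omega> fin G Ti Gi level_sets_mono[OF fin um Tle(1) H]])
      ultimately have "T \<in> W1_0 \<Omega> p" using assms(4) by blast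
      then have "(LINT x|lebesgue_on \<Omega>. \<bar>T x\<bar> powr p) \<le> C * ((LINT x|lebesgue_on \<Omega>. norm (weak_grad \<Omega> T x) powr p) + 1)"
        using C(2) by blast
      \<comment> \<open>Truncation does not increase the gradient, which makes the bound independent
        of n.\<close>
      also have "(LINT x|lebesgue_on \<Omega>. norm (weak_grad \<Omega> T x) powr p) \<le> J"
        unfolding J_def
      proof (rule integral_mono_AE'[OF iJ])
        show "AE x in lebesgue_on \<Omega>. norm (weak_grad \<Omega> T x) powr p \<le> norm (weak_grad \<Omega> u x) powr p"
          using weak_grad_AE_eq[OF \<Omega> G] by (rule eventually_mono) (use Gle(1) p0 in \<open>auto intro: powr_mono2\<close>)
      qed auto
      then have "C * ((LINT x|lebesgue_on \<Omega>. norm (weak_grad \<Omega> T x) powr p) + 1) \<le> C * (J + 1)"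
        using C(1) by (intro mult_left_mono) auto
      finally show ?thesis using TL by (simp add: Lp_def T_def)
    qed
    have "0 \<le> C * (J + 1)" using C(1) by (simp add: J_def)
    then have "u \<in> Lp \<Omega> p" using trunc by (intro Lp_of_truncations[OF um, of "C * (J + 1)"]) auto
    then have "u \<in> W1 \<Omega> p" using assms(7) gL by (simp add: W1_def)
    moreover have "u \<in> W1_0 \<Omega> 1" by (rule W1_0_1_intro[OF \<Omega> fin g u1 gi H])
    ultimately show ?thesis using assms(4) by blast
  qed
qed

end
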